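(* Let $m,s\ge1$ and let $n_{ip}\ge1$ be integers ($1\le i\le s$, $1\le p\le m$). For each $p$ let $A^p=(A^p_{ij})_{i,j=1}^s$ be a positive definite complex matrix partitioned into blocks $A^p_{ij}\in M_{n_{ip},n_{jp}}(\mathbb{C})$ (so diagonal blocks are square). Put $\sigma_{ip}=n_{ip}^{-1}\prod_{q=1}^mn_{iq}$ and $A=\bigodot_{p=1}^mA^p$. Then for each $i=1,\dots,s$, $$\frac{|(A)_i|}{|(A)_{i-1}|}\ \ge\ \prod_{p=1}^m|A^p_{ii}|^{\sigma_{ip}}-\prod_{p=1}^m\Bigl\{|A^p_{ii}|^{\sigma_{ip}}-\Bigl(\frac{|(A^p)_i|}{|(A^p)_{i-1}|}\Bigr)^{\sigma_{ip}}\Bigr\}.$$ Equality holds if and only if one of the following holds: (a) $m=1$ or $i=1$; (b) there exists $p$ such that $A^p_{li}=0$ and $A^p_{il}=0$ for every $l<i$; (c) $n_{ip}=1$ for every $p$, and there exists $i_0<i$ such that $A^p_{li}=A^p_{li_0}(A^p_{i_0i_0})^{-1}A^p_{i_0i}$ for every $l<i$ and every $p$.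
   Context: $|X|$ denotes the determinant. For block matrices $A^p=(A^p_{ij})_{i,j=1}^s$ the Hadamard (Khatri–Rao) product is $\bigodot_{p=1}^mA^p=(A^1_{ij}\otimes\cdots\otimes A^m_{ij})_{i,j=1}^s$ ($\otimes$ = Kronecker product). For a block matrix $X=(X_{jk})_{j,k=1}^s$, $(X)_i=(X_{jk})_{j,k=1}^i$ is its $i$-th leading principal block submatrix, with the convention $|(X)_0|=1$. *)

theory Defs
  imports "Jordan_Normal_Form.Schur_Decomposition" "Jordan_Normal_Form.Gauss_Jordan_Elimination"
begin

text \<open>Complex numbers carry the partial order of HOL-Library.Complex_Order
  (z \<le> w iff Re z \<le> Re w and Im z = Im w), imported via Jordan_Normal_Form.\<close>

definition pos_def :: "complex mat \<Rightarrow> bool" where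
  "pos_def A \<longleftrightarrow> A \<in> carrier_mat (dim_row A) (dim_row A) \<and> mat_adjoint A = A \<and>
     (\<forall>v \<in> carrier_vec (dim_row A). v \<noteq> 0\<^sub>v (dim_row A) \<longrightarrow> (A *\<^sub>v v) \<bullet>c v > 0)"

definition kron :: "'a :: times mat \<Rightarrow> 'a mat \<Rightarrow> 'a mat" where
  "kron A B = mat (dim_row A * dim_row B) (dim_col A * dim_col B)
     (\<lambda>(r, c). A $$ (r div dim_row B, c div dim_col B) * B $$ (r mod dim_row B, c mod dim_col B))"

fun kron_prod :: "nat \<Rightarrow> (nat \<Rightarrow> 'a :: semiring_1 mat) \<Rightarrow> 'a mat" where
  "kron_prod 0 F = 1\<^sub>m 1"
| "kron_prod (Suc k) F = kron (kron_prod k F) (F (Suc k))"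

text \<open>Block structure with block sizes r 1, r 2, ... (blocks indexed from 1).\<close>
definition blk_idx :: "(nat \<Rightarrow> nat) \<Rightarrow> nat \<Rightarrow> nat" where
  "blk_idx r a = (LEAST i. a < (\<Sum>l\<in>{1..i}. r l))"

definition blk_off :: "(nat \<Rightarrow> nat) \<Rightarrow> nat \<Rightarrow> nat" where
  "blk_off r i = (\<Sum>l\<in>{1..<i}. r l)"

text \<open>The block matrix (F i j)_{i,j=1}^k with row block sizes r and column block sizes c.
  For k = 0 this is the 0x0 matrix (determinant 1).  Hence block_mat r c i F is the
  i-th leading principal block submatrix (X)_i of X = block_mat r c s F.\<close>
definition block_mat :: "(nat \<Rightarrow> nat) \<Rightarrow> (nat \<Rightarrow> nat) \<Rightarrow> nat \<Rightarrow> (nat \<Rightarrow> nat \<Rightarrow> 'a mat) \<Rightarrow> 'a mat" where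
  "block_mat r c k F = mat (\<Sum>l\<in>{1..k}. r l) (\<Sum>l\<in>{1..k}. c l)
     (\<lambda>(a, b). let i = blk_idx r a; j = blk_idx c b in F i j $$ (a - blk_off r i, b - blk_off c j))"

end

theory Submission
  imports Defs "Jordan_Normal_Form.Spectral_Radius"
begin

text \<open>Write \<open>(A\<^sup>p)\<^sub>i = [[C\<^sub>p, b\<^sub>p], [b\<^sub>p\<^sup>*, D\<^sub>p]]\<close>, \<open>v\<^sub>p = C\<^sub>p\<^sup>-\<^sup>1 b\<^sub>p\<close> and
  \<open>T\<^sub>p = v\<^sub>p\<^sup>* C\<^sub>p v\<^sub>p\<close>, so that the determinant ratio of \<open>A\<^sup>p\<close> is \<open>|D\<^sub>p - T\<^sub>p|\<close>. The
  Khatri--Rao product is a principal submatrix of the Kronecker product, hence its Schur complement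
  is \<open>\<Otimes>D\<^sub>p - \<Otimes>T\<^sub>p + R\<close>, where \<open>R \<ge> 0\<close> is the Gram matrix, with respect to \<open>\<Otimes>C\<^sub>p\<close>, of the
  error in approximating \<open>\<Otimes>v\<^sub>p\<close> by matrices supported on the diagonal blocks. Diagonalizing each
  pair \<open>D\<^sub>p, T\<^sub>p\<close> simultaneously gives eigenvalues \<open>x\<^sub>p\<^sub>j \<in> [0, 1)\<close> and
  \<open>|\<Otimes>D\<^sub>p - \<Otimes>T\<^sub>p| = |\<Otimes>D\<^sub>p| \<Prod>\<^sub>J (1 - \<Prod>\<^sub>p x\<^sub>p\<^sub>J)\<close>, which reduces the claim to a scalar inequality
  with a probabilistic interpretation. Equality forces \<open>R = 0\<close>, i.e. \<open>\<Otimes>v\<^sub>p\<close> is supported on the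
  diagonal blocks, together with equality in the scalar inequality.\<close>

section \<open>An elementary inequality for products\<close>

text \<open>The exponents \<open>\<sigma> p\<close> are multiplicities: in a Kronecker product each
  eigenvalue of the \<open>p\<close>-th factor recurs once for every choice of the remaining
  coordinates. Hence both sides can be divided by the determinant of the Kronecker product of the
  diagonal blocks, which leaves only numbers in [0, 1). Two losses separate the two sides: dropping
  \<open>R\<close> from the Schur complement, and the scalar inequality. The scalar one is tight
  exactly if \<open>m = 1\<close>, some \<open>T p\<close> is zero, or all diagonal blocks at
  position \<open>i\<close> are 1 by 1. In the first two situations \<open>R\<close> vanishes
  automatically, which gives (a) and (b). In the third, with at least two factors and no
  \<open>v p\<close> zero, vanishing of \<open>R\<close> forces all \<open>v p\<close> into one
  common block \<open>i0\<close>, because non-zero rows of different factors can be combined freely;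
  this is (c).\<close>

lemma prod_prob_union_ge:
  fixes a c :: "'p \<Rightarrow> real"
  assumes "finite P" "\<And>p. p \<in> P \<Longrightarrow> 0 \<le> a p \<and> a p \<le> 1" "\<And>p. p \<in> P \<Longrightarrow> 0 \<le> c p \<and> c p \<le> 1"
  shows "prod a P + prod c P - prod a P * prod c P \<le> (\<Prod>p\<in>P. a p + c p - a p * c p)"
  using assms
proof (induction P rule: finite_induct)
  case (insert q P)
  define x y A C where "x = a q" and "y = c q" and "A = prod a P" and "C = prod c P"
  have r: "0 \<le> x" "x \<le> 1" "0 \<le> y" "y \<le> 1" "0 \<le> A" "A \<le> 1" "0 \<le> C" "C \<le> 1"
    using insert.prems by (auto simp: x_def y_def A_def C_def intro!: prod_nonneg prod_le_1)
  \<comment> \<open>The sum is exactly the difference of the two sides of the next inequality. For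
    independent events with probabilities \<open>a p\<close> and \<open>c p\<close> it measures the
    mixed outcomes: at \<open>q\<close> only the event of one family occurs, while on the remaining
    indices the other family is complete and this one is not.\<close>
  have "0 \<le> x * C * ((1 - A) * (1 - y)) + y * A * ((1 - C) * (1 - x))" using r by simp
  then have "x * A + y * C - (x * A) * (y * C) \<le> (x + y - x * y) * (A + C - A * C)"
    by (simp add: algebra_simps)
  also have "\<dots> \<le> (x + y - x * y) * (\<Prod>p\<in>P. a p + c p - a p * c p)"
  proof (rule mult_left_mono)
    have "0 \<le> x * (1 - y) + y" using r by simp
    then show "0 \<le> x + y - x * y" by (simp add: algebra_simps)
  qed (use insert in \<open>auto simp: A_def C_def\<close>)
  finally show ?case using insert.hyps by (simp add: x_def y_def A_def C_def)
qed simp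

text \<open>The outcome with the \<open>a\<close>-event at \<open>q\<close>, the
  \<open>c\<close>-event at every other index and nothing else has positive probability. It
  satisfies every factor on the right but completes neither family on the left.\<close>

lemma prod_prob_union_gt:
  fixes a c :: "'p \<Rightarrow> real"
  assumes "finite P" "\<And>p. p \<in> P \<Longrightarrow> 0 \<le> a p \<and> a p < 1" "\<And>p. p \<in> P \<Longrightarrow> 0 \<le> c p \<and> c p < 1"
    and q: "q \<in> P" "P - {q} \<noteq> {}" "0 < a q" "\<And>p. p \<in> P - {q} \<Longrightarrow> 0 < c p"
  shows "prod a P + prod c P - prod a P * prod c P < (\<Prod>p\<in>P. a p + c p - a p * c p)"
proof -
  let ?P = "P - {q}"
  define x y A C where "x = a q" and "y = c q" and "A = prod a ?P" and "C = prod c ?P"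
  \<comment> \<open>Here \<open>P - {q}\<close> must be non-empty: an empty product would be
    1.\<close>
  have "A < 1"
  proof -
    obtain p where p: "p \<in> ?P" using q(2) by auto
    have "A = a p * prod a (?P - {p})"
      unfolding A_def using p assms(1) by (simp add: prod.remove)
    also have "\<dots> \<le> a p * 1"
      using assms(2) p by (intro mult_left_mono prod_le_1) (auto intro: less_imp_le)
    also have "\<dots> < 1" using assms(2) p by auto
    finally show ?thesis .
  qed
  moreover have "0 < C" unfolding C_def using q(4) by (intro prod_pos) auto
  ultimately have r: "0 < x" "x < 1" "0 \<le> y" "y < 1" "0 \<le> A" "A < 1" "0 < C" "C \<le> 1"
    using assms(2,3) q(1,3)
    by (auto simp: x_def y_def A_def C_def less_imp_le intro!: prod_nonneg prod_le_1)
  have "0 < x * C * ((1 - A) * (1 - y)) + y * A * ((1 - C) * (1 - x))"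
    using r by (intro add_pos_nonneg) simp_all
  then have "x * A + y * C - (x * A) * (y * C) < (x + y - x * y) * (A + C - A * C)"
    by (simp add: algebra_simps)
  also have "\<dots> \<le> (x + y - x * y) * (\<Prod>p\<in>?P. a p + c p - a p * c p)"
  proof (rule mult_left_mono)
    have "0 \<le> x * (1 - y) + y" using r by simp
    then show "0 \<le> x + y - x * y" by (simp add: algebra_simps)
    show "A + C - A * C \<le> (\<Prod>p\<in>?P. a p + c p - a p * c p)"
      unfolding A_def C_def using assms(1-3) 
      by (intro prod_prob_union_ge) (auto intro: less_imp_le)
  qed
  finally show ?thesis using assms(1) q(1)
    by (simp add: x_def y_def A_def C_def prod.remove[of P q])
qed

text \<open>With \<open>c p\<close> the probability that some event indexed by \<open>J\<close>
  occurs, adding \<open>j\<close> changes it to \<open>u p j + c p - u p j * c p\<close>. The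
  inequality for two families, applied to the events at \<open>j\<close> and to \<open>c\<close>,
  therefore peels off \<open>j\<close>.\<close>

lemma prod_complement_bound_insert:
  fixes u :: "'p \<Rightarrow> 'j \<Rightarrow> real"
  assumes "finite J" "finite P" "j \<notin> J"
    and u: "\<And>p k. p \<in> P \<Longrightarrow> k \<in> insert j J \<Longrightarrow> 0 \<le> u p k \<and> u p k \<le> 1"
  shows "1 - (\<Prod>p\<in>P. 1 - (\<Prod>k\<in>insert j J. 1 - u p k))
    \<le> (1 - (\<Prod>p\<in>P. u p j)) * (1 - (\<Prod>p\<in>P. 1 - (\<Prod>k\<in>J. 1 - u p k)))"
proof -
  define c where "c p = 1 - (\<Prod>k\<in>J. 1 - u p k)" for p
  have "(\<Prod>p\<in>P. u p j) + prod c P - (\<Prod>p\<in>P. u p j) * prod c P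
    \<le> (\<Prod>p\<in>P. u p j + c p - u p j * c p)"
    using assms by (intro prod_prob_union_ge) (auto simp: c_def intro!: prod_nonneg prod_le_1)
  also have "\<dots> = (\<Prod>p\<in>P. 1 - (\<Prod>k\<in>insert j J. 1 - u p k))"
    using assms by (intro prod.cong) (auto simp: c_def algebra_simps)
  finally show ?thesis unfolding c_def[symmetric] by (simp add: algebra_simps)
qed

text \<open>Reading \<open>u p j\<close> as probabilities of independent events \<open>E p j\<close>, the left side is the
  probability that for some \<open>p\<close> no \<open>E p j\<close> occurs, and the right side the probability that every
  \<open>j\<close> has some \<open>p\<close> for which \<open>E p j\<close> does not occur.\<close>

lemma prod_complement_bound:
  fixes u :: "'p \<Rightarrow> 'j \<Rightarrow> real"
  assumes "finite J" "finite P" "P \<noteq> {}"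
    and "\<And>p k. p \<in> P \<Longrightarrow> k \<in> J \<Longrightarrow> 0 \<le> u p k \<and> u p k \<le> 1"
  shows "1 - (\<Prod>p\<in>P. 1 - (\<Prod>j\<in>J. 1 - u p j)) \<le> (\<Prod>j\<in>J. 1 - (\<Prod>p\<in>P. u p j))"
  using assms
proof (induction J rule: finite_induct)
  case (insert j J)
  have "1 - (\<Prod>p\<in>P. 1 - (\<Prod>k\<in>insert j J. 1 - u p k))
    \<le> (1 - (\<Prod>p\<in>P. u p j)) * (1 - (\<Prod>p\<in>P. 1 - (\<Prod>k\<in>J. 1 - u p k)))"
    using insert by (intro prod_complement_bound_insert) auto
  also have "\<dots> \<le> (1 - (\<Prod>p\<in>P. u p j)) * (\<Prod>k\<in>J. 1 - (\<Prod>p\<in>P. u p k))"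
    using insert by (intro mult_left_mono) (auto intro!: prod_le_1)
  finally show ?case using insert.hyps by simp
qed simp

text \<open>Factor \<open>q\<close> is positive at \<open>j0\<close> and all other factors are
  positive at \<open>j1\<close>, so the strict inequality for two families applies to this pair.
  Each further index multiplies by \<open>1 - (\<Prod>p\<in>P. u p k)\<close>, which is positive and
  keeps the strictness.\<close>

lemma prod_complement_bound_strict:
  fixes u :: "'p \<Rightarrow> 'j \<Rightarrow> real"
  assumes "finite J" "finite P"
    and u: "\<And>p k. p \<in> P \<Longrightarrow> k \<in> J \<Longrightarrow> 0 \<le> u p k \<and> u p k < 1"
    and q: "q \<in> P" "P - {q} \<noteq> {}"
    and j: "j0 \<in> J" "j1 \<in> J" "j0 \<noteq> j1" "0 < u q j0" "\<And>p. p \<in> P - {q} \<Longrightarrow> 0 < u p j1"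
  shows "1 - (\<Prod>p\<in>P. 1 - (\<Prod>j\<in>J. 1 - u p j)) < (\<Prod>j\<in>J. 1 - (\<Prod>p\<in>P. u p j))"
proof -
  \<comment> \<open>Inducting on \<open>K'\<close> starts the argument at the pair
    \<open>{j0, j1}\<close> and not at the empty set, where both sides agree.\<close>
  have "1 - (\<Prod>p\<in>P. 1 - (\<Prod>j\<in>K. 1 - u p j)) < (\<Prod>j\<in>K. 1 - (\<Prod>p\<in>P. u p j))"
    if "K = K' \<union> {j0, j1}" "K' \<subseteq> J - {j0, j1}" for K K'
  proof -
    have "finite K'" using that assms(1) finite_subset by blast
    then show ?thesis using that
    proof (induction K' arbitrary: K rule: finite_induct)
      case empty
      have "(\<Prod>p\<in>P. u p j0) + (\<Prod>p\<in>P. u p j1) - (\<Prod>p\<in>P. u p j0) * (\<Prod>p\<in>P. u p j1)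
        < (\<Prod>p\<in>P. u p j0 + u p j1 - u p j0 * u p j1)"
        using assms by (intro prod_prob_union_gt[of _ _ _ q]) auto
      also have "\<dots> = (\<Prod>p\<in>P. 1 - (1 - u p j0) * (1 - u p j1))"
        by (intro prod.cong) (auto simp: algebra_simps)
      finally show ?case using empty j(3) by (simp add: algebra_simps)
    next
      case (insert k K')
      define L where "L = K' \<union> {j0, j1}"
      have L: "K = insert k L" "k \<notin> L" "finite L" "L \<subseteq> J" "k \<in> J"
        using insert j by (auto simp: L_def)
      have "(\<Prod>p\<in>P. u p k) < 1"
      proof -
        have "(\<Prod>p\<in>P. u p k) = u q k * (\<Prod>p\<in>P - {q}. u p k)"
          using assms(2) q by (simp add: prod.remove)
        also have "\<dots> \<le> u q k * 1"
          using u q L by (intro mult_left_mono prod_le_1) (auto intro: less_imp_le)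
        also have "\<dots> < 1" using u q L by auto
        finally show ?thesis .
      qed
      moreover have "1 - (\<Prod>p\<in>P. 1 - (\<Prod>j\<in>L. 1 - u p j)) < (\<Prod>j\<in>L. 1 - (\<Prod>p\<in>P. u p j))"
        using insert L_def by auto
      moreover have "1 - (\<Prod>p\<in>P. 1 - (\<Prod>j\<in>K. 1 - u p j))
          \<le> (1 - (\<Prod>p\<in>P. u p k)) * (1 - (\<Prod>p\<in>P. 1 - (\<Prod>j\<in>L. 1 - u p j)))"
        unfolding L(1) using L assms(2) u
        by (intro prod_complement_bound_insert) (auto intro: less_imp_le)
      ultimately show ?case using L
        by (simp, smt (verit) mult_strict_left_mono)
    qed
  qed
  from this[of J "J - {j0, j1}"] j show ?thesis by auto
qed

section \<open>Positive definite matrices and simultaneous diagonalization\<close>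

lemma dim_mat_adjoint [simp]:
  "dim_row (mat_adjoint A) = dim_col A" "dim_col (mat_adjoint A) = dim_row A"
  by (auto simp: mat_adjoint_def)

lemma index_mat_adjoint [simp]:
  "i < dim_col A \<Longrightarrow> j < dim_row A \<Longrightarrow> mat_adjoint A $$ (i, j) = conjugate (A $$ (j, i))"
  by (auto simp: mat_adjoint_def mat_of_rows_def)

lemma mat_adjoint_carrier [simp]:
  "A \<in> carrier_mat n m \<Longrightarrow> mat_adjoint A \<in> carrier_mat m n"
  by (auto intro: carrier_matI)

lemma mat_adjoint_adjoint [simp]: "mat_adjoint (mat_adjoint A) = A"
  by (rule eq_matI) auto

lemma mat_adjoint_one [simp]: "mat_adjoint (1\<^sub>m n :: complex mat) = 1\<^sub>m n"
  by (rule eq_matI) auto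

text \<open>Equations between dimensions, in place of carrier sets with free dimension variables,
  let the simplifier discharge the side conditions and re-associate long products.\<close>

lemma mult_mat_assoc_dim:
  fixes A B C :: "'a :: semiring_0 mat"
  assumes "dim_col A = dim_row B" "dim_col B = dim_row C"
  shows "A * B * C = A * (B * C)"
  using assms by (intro assoc_mult_mat[of _ "dim_row A" "dim_row B" _ "dim_row C" _ "dim_col C"])
    (auto intro: carrier_matI)

lemma mult_mat_vec_assoc_dim:
  fixes A B :: "'a :: semiring_0 mat"
  assumes "dim_col A = dim_row B" "dim_col B = dim_vec v"
  shows "(A * B) *\<^sub>v v = A *\<^sub>v (B *\<^sub>v v)"
  using assms by (intro assoc_mult_mat_vec[of _ "dim_row A" "dim_row B" _ "dim_vec v"])
    (auto intro: carrier_matI)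

lemma mat_adjoint_mult:
  fixes A B :: "complex mat"
  assumes "dim_col A = dim_row B"
  shows "mat_adjoint (A * B) = mat_adjoint B * mat_adjoint A"
  using assms by (intro eq_matI) (auto simp: scalar_prod_def mult.commute)

lemma mat_adjoint_minus:
  fixes A B :: "complex mat"
  assumes "dim_row A = dim_row B" "dim_col A = dim_col B"
  shows "mat_adjoint (A - B) = mat_adjoint A - mat_adjoint B"
  using assms by (intro eq_matI) auto

lemma det_mat_adjoint:
  fixes A :: "complex mat"
  assumes "A \<in> carrier_mat n n"
  shows "det (mat_adjoint A) = cnj (det A)"
proof -
  have "mat_adjoint A = transpose_mat (map_mat cnj A)"
    using assms by (intro eq_matI) auto
  moreover have "det (map_mat cnj A) = cnj (det A)"
  proof -
    \<comment> \<open>Signs are real, so conjugation passes through the Leibniz expansion term by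
      term.\<close>
    have "cnj (signof p) = signof p" for p :: "nat \<Rightarrow> nat"
      by (auto simp: sign_def)
    then show ?thesis using assms
      by (auto simp: det_def' [of _ n] intro!: sum.cong prod.cong)
  qed
  ultimately show ?thesis using det_transpose[of "map_mat cnj A" n] assms by auto
qed

lemma mat_adjoint_mult_vec_inner:
  fixes A :: "complex mat"
  assumes "A \<in> carrier_mat n k" "v \<in> carrier_vec n" "w \<in> carrier_vec k"
  shows "(mat_adjoint A *\<^sub>v v) \<bullet>c w = v \<bullet>c (A *\<^sub>v w)"
proof -
  have "(mat_adjoint A *\<^sub>v v) \<bullet>c w = (\<Sum>j<k. \<Sum>i<n. cnj (A $$ (i, j)) * v $ i * cnj (w $ j))"
    using assms by (auto simp: scalar_prod_def sum_distrib_right lessThan_atLeast0 intro!: sum.cong)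
  also have "\<dots> = (\<Sum>i<n. \<Sum>j<k. cnj (A $$ (i, j)) * v $ i * cnj (w $ j))"
    by (rule sum.swap)
  also have "\<dots> = v \<bullet>c (A *\<^sub>v w)"
    using assms by (auto simp: scalar_prod_def sum_distrib_left lessThan_atLeast0 algebra_simps
        intro!: sum.cong)
  finally show ?thesis .
qed

lemma hermitian_inner_commute:
  fixes A :: "complex mat"
  assumes "A \<in> carrier_mat n n" "mat_adjoint A = A" "v \<in> carrier_vec n" "w \<in> carrier_vec n"
  shows "(A *\<^sub>v v) \<bullet>c w = v \<bullet>c (A *\<^sub>v w)"
  using mat_adjoint_mult_vec_inner[OF assms(1,3,4)] assms(2) by simp

lemma cnj_inner:
  fixes v w :: "complex vec"
  assumes "v \<in> carrier_vec n" "w \<in> carrier_vec n"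
  shows "cnj (v \<bullet>c w) = w \<bullet>c v"
  using assms by (auto simp: scalar_prod_def mult.commute)

text \<open>Entries of a congruence are values of the sesquilinear form of \<open>X\<close> on
  columns. Since \<open>\<bullet>c\<close> conjugates its second argument, the column index
  \<open>j\<close> enters on the left and the row index \<open>i\<close> on the right.\<close>

lemma index_congruence:
  fixes X P Q :: "complex mat"
  assumes "X \<in> carrier_mat n n" "P \<in> carrier_mat n k" "Q \<in> carrier_mat n l" "i < k" "j < l"
  shows "(mat_adjoint P * (X * Q)) $$ (i, j) = (X *\<^sub>v col Q j) \<bullet>c col P i"
proof -
  have "col (X * Q) j = X *\<^sub>v col Q j" using assms by (intro col_mult2) auto
  moreover have "row (mat_adjoint P) i = conjugate (col P i)" using assms by (intro eq_vecI) auto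
  ultimately show ?thesis using assms
    by (simp add: comm_scalar_prod[of "conjugate (col P i)" n])
qed

lemma hermitian_congruence:
  fixes X P :: "complex mat"
  assumes "X \<in> carrier_mat n n" "mat_adjoint X = X" "P \<in> carrier_mat n k"
  shows "mat_adjoint (mat_adjoint P * (X * P)) = mat_adjoint P * (X * P)"
  using assms by (simp add: mat_adjoint_mult mult_mat_assoc_dim)

lemma pos_def_dest:
  assumes "pos_def A" "A \<in> carrier_mat n n"
  shows "mat_adjoint A = A" "\<And>v. v \<in> carrier_vec n \<Longrightarrow> v \<noteq> 0\<^sub>v n \<Longrightarrow> (A *\<^sub>v v) \<bullet>c v > 0"
  using assms by (auto simp: pos_def_def)

lemma pos_def_congruence:
  assumes D: "D \<in> carrier_mat n n" "pos_def D" and P: "P \<in> carrier_mat n k"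
    and inj: "\<And>v. v \<in> carrier_vec k \<Longrightarrow> P *\<^sub>v v = 0\<^sub>v n \<Longrightarrow> v = 0\<^sub>v k"
  shows "pos_def (mat_adjoint P * (D * P))"
  unfolding pos_def_def
proof (intro conjI ballI impI)
  show "mat_adjoint (mat_adjoint P * (D * P)) = mat_adjoint P * (D * P)"
    using hermitian_congruence[OF D(1) pos_def_dest(1)[OF D(2,1)] P] .
  fix v :: "complex vec" assume "v \<in> carrier_vec (dim_row (mat_adjoint P * (D * P)))"
    and "v \<noteq> 0\<^sub>v (dim_row (mat_adjoint P * (D * P)))"
  then have v: "v \<in> carrier_vec k" "v \<noteq> 0\<^sub>v k" using P by auto
  have Pv: "P *\<^sub>v v \<in> carrier_vec n" using P v by simp
  have "(mat_adjoint P * (D * P)) *\<^sub>v v = mat_adjoint P *\<^sub>v (D *\<^sub>v (P *\<^sub>v v))"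
    using D P v by (simp add: mult_mat_vec_assoc_dim)
  then have "((mat_adjoint P * (D * P)) *\<^sub>v v) \<bullet>c v = (D *\<^sub>v (P *\<^sub>v v)) \<bullet>c (P *\<^sub>v v)"
    using mat_adjoint_mult_vec_inner[OF P _ v(1), of "D *\<^sub>v (P *\<^sub>v v)"] D P v by simp
  also have "\<dots> > 0" using pos_def_dest(2)[OF D(2,1) Pv] inj v by blast
  finally show "((mat_adjoint P * (D * P)) *\<^sub>v v) \<bullet>c v > 0" .
qed (use P in \<open>auto intro: carrier_matI\<close>)

lemma det_nonzero_inverse:
  fixes A :: "'a :: field mat"
  assumes "A \<in> carrier_mat n n" "det A \<noteq> 0"
  obtains B where "B \<in> carrier_mat n n" "A * B = 1\<^sub>m n" "B * A = 1\<^sub>m n"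
  using det_non_zero_imp_unit[OF assms, of "()"] by (auto simp: Units_def ring_mat_def)

lemma pos_def_det_nonzero:
  assumes "A \<in> carrier_mat n n" "pos_def A"
  shows "det A \<noteq> 0"
proof
  assume "det A = 0"
  then obtain v where v: "v \<in> carrier_vec n" "v \<noteq> 0\<^sub>v n" "A *\<^sub>v v = 0\<^sub>v n"
    using det_0_iff_vec_prod_zero[OF assms(1)] by blast
  then show False using pos_def_dest(2)[OF assms(2,1), of v] by (simp add: scalar_prod_def)
qed

section \<open>Simultaneous diagonalization of two Hermitian forms\<close>

lemma orthogonal_complement_matrix:
  fixes w :: "complex vec"
  assumes w: "w \<in> carrier_vec (Suc n)" "w \<noteq> 0\<^sub>v (Suc n)"
  obtains U where "U \<in> carrier_mat (Suc n) n" "mat_adjoint U *\<^sub>v w = 0\<^sub>v n"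
    "\<And>y. y \<in> carrier_vec n \<Longrightarrow> U *\<^sub>v y = 0\<^sub>v (Suc n) \<Longrightarrow> y = 0\<^sub>v n"
proof -
  obtain k where k: "k < Suc n" "w $ k \<noteq> 0" using w by (metis carrier_vecD eq_vecI index_zero_vec)
  let ?s = "insert_index k"
  have s: "?s j < Suc n" "?s j \<noteq> k" if "j < n" for j using that by (auto simp: insert_index_def)
  have s_inj: "?s i = ?s j \<longleftrightarrow> i = j" for i j by (auto simp: insert_index_def split: if_splits)
  \<comment> \<open>Column \<open>j\<close> is the unit vector at \<open>?s j\<close>, corrected at
    the pivot \<open>k\<close> to become orthogonal to \<open>w\<close>; row \<open>?s j\<close> is
    a unit row, which gives injectivity. The columns are just a basis of the complement, and the
    congruence by \<open>P1\<close> in the diagonalization normalizes them.\<close>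
  define U where "U = mat (Suc n) n (\<lambda>(r, j). if r = ?s j then 1
    else if r = k then - cnj (w $ (?s j)) / cnj (w $ k) else 0)"
  have U: "U \<in> carrier_mat (Suc n) n" by (simp add: U_def)
  show ?thesis
  proof (rule that[OF U])
    show "mat_adjoint U *\<^sub>v w = 0\<^sub>v n"
    proof (rule eq_vecI)
      fix j assume "j < dim_vec (0\<^sub>v n :: complex vec)"
      then have j: "j < n" by simp
      have "(mat_adjoint U *\<^sub>v w) $ j = (\<Sum>r\<in>{0..<Suc n}. cnj (U $$ (r, j)) * w $ r)"
        using j U w by (simp add: scalar_prod_def)
      also have "\<dots> = (\<Sum>r\<in>{?s j, k}. cnj (U $$ (r, j)) * w $ r)"
        using s[OF j] k j by (intro sum.mono_neutral_right) (auto simp: U_def)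
      also have "\<dots> = 0" using s[OF j] s(2)[OF j, symmetric] k j by (simp add: U_def)
      finally show "(mat_adjoint U *\<^sub>v w) $ j = 0\<^sub>v n $ j" using j by simp
    qed (use U in simp)
    fix y assume y: "y \<in> carrier_vec n" "U *\<^sub>v y = 0\<^sub>v (Suc n)"
    show "y = 0\<^sub>v n"
    proof (rule eq_vecI)
      fix j assume "j < dim_vec (0\<^sub>v n :: complex vec)"
      then have j: "j < n" by simp
      have "0 = (U *\<^sub>v y) $ (?s j)" using y s[OF j] by simp
      also have "\<dots> = (\<Sum>l\<in>{0..<n}. U $$ (?s j, l) * y $ l)"
        using s[OF j] U y(1) by (simp add: scalar_prod_def)
      also have "\<dots> = (\<Sum>l\<in>{j}. U $$ (?s j, l) * y $ l)"
        using s[OF j] j by (intro sum.mono_neutral_right) (auto simp: U_def s_inj)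
      finally show "y $ j = 0\<^sub>v n $ j" using s[OF j] j by (simp add: U_def)
    qed (use y in simp)
  qed
qed

text \<open>An eigenvector \<open>v\<close> of the inverse of \<open>D\<close> times
  \<open>T\<close> satisfies \<open>T *\<^sub>v v = e \<cdot>\<^sub>v w\<close> with
  \<open>w = D *\<^sub>v v\<close>. Neither form has cross terms between \<open>v\<close> and
  vectors orthogonal to \<open>w\<close>, so \<open>v\<close> splits off and induction applies to
  the compressions of both forms to that complement.\<close>

theorem simultaneous_diagonalization:
  assumes "D \<in> carrier_mat n n" "pos_def D" "T \<in> carrier_mat n n" "mat_adjoint T = T"
  shows "\<exists>P x. P \<in> carrier_mat n n \<and> mat_adjoint P * (D * P) = 1\<^sub>m n \<and>
    mat_adjoint P * (T * P) = mat_diag n (\<lambda>j. complex_of_real (x j))"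
  using assms
proof (induction n arbitrary: D T)
  case 0
  then show ?case by (intro exI[of _ "1\<^sub>m 0"]) (auto intro!: eq_matI simp: mat_diag_def)
next
  case (Suc n)
  let ?N = "Suc n"
  note D = Suc.prems(1,2) and T = Suc.prems(3,4)
  obtain Di where Di: "Di \<in> carrier_mat ?N ?N" "D * Di = 1\<^sub>m ?N"
    using det_nonzero_inverse[OF D(1) pos_def_det_nonzero[OF D]] by metis
  have "Di * T \<in> carrier_mat ?N ?N" using Di T by auto
  \<comment> \<open>\<open>Di * T\<close> is in general not Hermitian, so at this point only some
    complex eigenvalue is available; its reality is established below.\<close>
  then obtain e v where v: "v \<in> carrier_vec ?N" "v \<noteq> 0\<^sub>v ?N" "(Di * T) *\<^sub>v v = e \<cdot>\<^sub>v v"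
    using spectrum_non_empty[of "Di * T" ?N] Di
    by (auto simp: spectrum_def eigenvalue_def eigenvector_def)
  define w where "w = D *\<^sub>v v"
  have w: "w \<in> carrier_vec ?N" using D v by (simp add: w_def)
  have Tv: "T *\<^sub>v v = e \<cdot>\<^sub>v w"
  proof -
    have "T *\<^sub>v v = (D * Di) *\<^sub>v (T *\<^sub>v v)" using Di T v by simp
    also have "\<dots> = D *\<^sub>v (Di *\<^sub>v (T *\<^sub>v v))"
      using D Di T v by (intro assoc_mult_mat_vec[of _ ?N ?N]) auto
    also have "Di *\<^sub>v (T *\<^sub>v v) = (Di * T) *\<^sub>v v"
      using Di T v by (intro assoc_mult_mat_vec[symmetric, of _ ?N ?N]) auto
    also have "D *\<^sub>v \<dots> = D *\<^sub>v (e \<cdot>\<^sub>v v)" using v by simp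
    also have "\<dots> = e \<cdot>\<^sub>v w" using D v by (simp add: w_def mult_mat_vec)
    finally show ?thesis .
  qed
  define r where "r = Re (w \<bullet>c v)"
  have wv: "w \<bullet>c v > 0" using pos_def_dest(2)[OF D(2,1) v(1,2)] by (simp add: w_def)
  then have r: "r > 0" "w \<bullet>c v = complex_of_real r"
    by (auto simp: r_def less_complex_def complex_eq_iff)
  have "w \<noteq> 0\<^sub>v ?N" using wv v by (auto simp: scalar_prod_def)
  then obtain U where U: "U \<in> carrier_mat ?N n" "mat_adjoint U *\<^sub>v w = 0\<^sub>v n"
      "\<And>y. y \<in> carrier_vec n \<Longrightarrow> U *\<^sub>v y = 0\<^sub>v ?N \<Longrightarrow> y = 0\<^sub>v n"
    using orthogonal_complement_matrix[OF w] by metis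
  have carr: "mat_adjoint U * (X * U) \<in> carrier_mat n n" if "X \<in> carrier_mat ?N ?N" for X
    using U that by (auto intro: carrier_matI)
  obtain P1 x1 where P1: "P1 \<in> carrier_mat n n"
      "mat_adjoint P1 * ((mat_adjoint U * (D * U)) * P1) = 1\<^sub>m n"
      "mat_adjoint P1 * ((mat_adjoint U * (T * U)) * P1) = mat_diag n (\<lambda>j. complex_of_real (x1 j))"
    using Suc.IH[OF carr[OF D(1)] pos_def_congruence[OF D U(1,3)] carr[OF T(1)]
        hermitian_congruence[OF T U(1)]]
    by auto
  define Q where "Q = U * P1"
  have Q: "Q \<in> carrier_mat ?N n" using U P1 by (simp add: Q_def)
  have Q_w: "w \<bullet>c col Q j = 0" if j: "j < n" for j
  proof -
    have "col Q j = U *\<^sub>v col P1 j" unfolding Q_def using U P1 j by (intro col_mult2) auto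
    then have "w \<bullet>c col Q j = (mat_adjoint U *\<^sub>v w) \<bullet>c col P1 j"
      using mat_adjoint_mult_vec_inner[OF U(1) w, of "col P1 j"] P1 j by auto
    then show ?thesis using U P1 j by (simp add: scalar_prod_def)
  qed
  define P where "P = mat ?N ?N (\<lambda>(i, j). if j = 0 then v $ i / sqrt r else Q $$ (i, j - 1))"
  have P: "P \<in> carrier_mat ?N ?N" by (simp add: P_def)
  have col0: "col P 0 = complex_of_real (1 / sqrt r) \<cdot>\<^sub>v v"
    using v by (intro eq_vecI) (auto simp: P_def)
  have colS: "col P (Suc j) = col Q j" if "j < n" for j
    using Q that by (intro eq_vecI) (auto simp: P_def)
  \<comment> \<open>One computation serves both forms: \<open>X = D\<close> with
    \<open>c = 1\<close> and \<open>X = T\<close> with \<open>c = e\<close>. The relation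
    \<open>X *\<^sub>v v = c \<cdot>\<^sub>v w\<close> kills the entries between \<open>v\<close>
    and the columns of \<open>Q\<close>, and the scaling by \<open>sqrt r\<close> makes the corner
    entry \<open>c\<close>.\<close>
  have diag: "mat_adjoint P * (X * P) = mat_diag ?N (\<lambda>j. if j = 0 then c else k (j - 1))"
    if X: "X \<in> carrier_mat ?N ?N" "mat_adjoint X = X" "X *\<^sub>v v = c \<cdot>\<^sub>v w"
      and k: "mat_adjoint P1 * ((mat_adjoint U * (X * U)) * P1) = mat_diag n k" for X c k
  proof (rule eq_matI)
    fix i j assume "i < dim_row (mat_diag ?N (\<lambda>j. if j = 0 then c else k (j - 1)))"
      "j < dim_col (mat_diag ?N (\<lambda>j. if j = 0 then c else k (j - 1)))"
    then have ij: "i < ?N" "j < ?N" by (auto simp: mat_diag_def)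
    have Xv: "X *\<^sub>v col P 0 = complex_of_real (1 / sqrt r) \<cdot>\<^sub>v (c \<cdot>\<^sub>v w)"
      unfolding col0 using X v by (simp add: mult_mat_vec)
    have entry: "(mat_adjoint P * (X * P)) $$ (i, j) = (X *\<^sub>v col P j) \<bullet>c col P i"
      using index_congruence[OF X(1) P P ij] .
    show "(mat_adjoint P * (X * P)) $$ (i, j)
      = mat_diag ?N (\<lambda>j. if j = 0 then c else k (j - 1)) $$ (i, j)"
    proof (cases j)
      case 0
      show ?thesis
      proof (cases i)
        case i0: 0
        have "(X *\<^sub>v col P 0) \<bullet>c col P 0 = of_real (1 / sqrt r) * (of_real (1 / sqrt r) * c * (w \<bullet>c v))"
          unfolding Xv unfolding col0 using w v by (simp add: conjugate_smult_vec)
        also have "\<dots> = c * of_real (1 / sqrt r * (1 / sqrt r) * r)"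
          unfolding r(2) of_real_mult by (simp only: mult_ac)
        also have "1 / sqrt r * (1 / sqrt r) * r = 1" using r by (simp add: field_simps)
        finally show ?thesis using entry 0 i0 by (simp add: mat_diag_def)
      next
        case (Suc i')
        then have "(X *\<^sub>v col P 0) \<bullet>c col P i = 0"
          unfolding Xv using colS Q_w[of i'] ij w Q by simp
        then show ?thesis using entry 0 Suc ij by (simp add: mat_diag_def)
      qed
    next
      case (Suc j')
      then have j': "j' < n" using ij by simp
      show ?thesis
      proof (cases i)
        case i0: 0
        have "(X *\<^sub>v col P j) \<bullet>c col P 0 = col Q j' \<bullet>c (X *\<^sub>v col P 0)"
          unfolding Suc colS[OF j']
          using X Q j' v by (intro hermitian_inner_commute[of _ ?N]) (auto simp: col0)
        also have "\<dots> = cnj ((X *\<^sub>v col P 0) \<bullet>c col Q j')"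
          using X Q j' w by (intro cnj_inner[of _ ?N, symmetric]) (auto simp: Xv)
        also have "\<dots> = 0" unfolding Xv using Q_w[OF j'] w Q by simp
        finally show ?thesis using entry Suc i0 j' by (simp add: mat_diag_def)
      next
        case i: (Suc i')
        then have i': "i' < n" using ij by simp
        have "(X *\<^sub>v col P j) \<bullet>c col P i = (mat_adjoint Q * (X * Q)) $$ (i', j')"
          unfolding Suc i colS[OF j'] colS[OF i'] using index_congruence[OF X(1) Q Q i' j'] by simp
        also have "mat_adjoint Q * (X * Q) = mat_diag n k"
          unfolding k[symmetric] Q_def using U P1 X
          by (simp add: mat_adjoint_mult mult_mat_assoc_dim)
        finally show ?thesis using entry Suc i i' j' by (simp add: mat_diag_def)
      qed
    qed
  qed (use P in \<open>auto simp: mat_diag_def\<close>)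
  \<comment> \<open>\<open>e * r\<close> is the value of the Hermitian form \<open>T\<close> at
    \<open>v\<close>, hence real, and \<open>r\<close> is a positive real.\<close>
  have e: "e = complex_of_real (Re e)"
  proof -
    have "cnj (e * r) = e * r"
      using hermitian_inner_commute[OF T v(1) v(1)] cnj_inner[of "T *\<^sub>v v" ?N v] v w r T
      by (simp add: Tv)
    then have "Im (e * r) = 0" by (metis Reals_cnj_iff complex_is_Real_iff)
    then show ?thesis using r by (auto simp: complex_eq_iff)
  qed
  have "mat_adjoint P * (D * P) = mat_diag ?N (\<lambda>j. if j = 0 then 1 else (\<lambda>_. 1) (j - 1))"
    using diag[of D 1 "\<lambda>_. 1"] D pos_def_dest(1)[OF D(2,1)] P1 w by (simp add: w_def)
  moreover have "mat_adjoint P * (T * P)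
      = mat_diag ?N (\<lambda>j. if j = 0 then e else (\<lambda>j. of_real (x1 j)) (j - 1))"
    using diag[of T e "\<lambda>j. of_real (x1 j)"] T P1 Tv by simp
  ultimately show ?case using P e
    by (intro exI[of _ P] exI[of _ "\<lambda>j. if j = 0 then Re e else x1 (j - 1)"])
      (auto simp: mat_diag_def intro!: eq_matI)
qed

lemma mat_diag_dims [simp]: "dim_row (mat_diag n f) = n" "dim_col (mat_diag n f) = n"
  by (auto simp: mat_diag_def)

lemma det_mat_diag: "det (mat_diag n f) = (\<Prod>j<n. f j)"
proof -
  have "upper_triangular (mat_diag n f)" by (auto simp: mat_diag_def)
  then have "det (mat_diag n f) = prod_list (diag_mat (mat_diag n f))"
    by (rule det_upper_triangular[of _ n]) simp
  also have "diag_mat (mat_diag n f) = map f [0..<n]"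
    by (auto simp: diag_mat_def mat_diag_def)
  also have "prod_list (map f [0..<n]) = (\<Prod>j<n. f j)"
    by (simp add: prod.distinct_set_conv_list[symmetric] lessThan_atLeast0)
  finally show ?thesis .
qed

lemma det_congruence:
  fixes X P :: "complex mat"
  assumes "X \<in> carrier_mat n n" "P \<in> carrier_mat n n"
  shows "det (mat_adjoint P * (X * P)) = det X * complex_of_real ((cmod (det P))\<^sup>2)"
proof -
  have "det (mat_adjoint P * (X * P)) = cnj (det P) * (det X * det P)"
    using assms by (simp add: det_mult[of _ n] det_mat_adjoint)
  then show ?thesis unfolding complex_norm_square by (simp only: mult_ac)
qed

lemma congruence_eq_zero:
  fixes X P :: "complex mat"
  assumes X: "X \<in> carrier_mat n n" and P: "P \<in> carrier_mat n n" "det P \<noteq> 0"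
    and "mat_adjoint P * (X * P) = 0\<^sub>m n n"
  shows "X = 0\<^sub>m n n"
proof -
  obtain Q where Q: "Q \<in> carrier_mat n n" "P * Q = 1\<^sub>m n" "Q * P = 1\<^sub>m n"
    using det_nonzero_inverse[OF P] by metis
  have "mat_adjoint Q * mat_adjoint P = 1\<^sub>m n"
    using P Q mat_adjoint_mult[of P Q] by simp
  then have "X = (mat_adjoint Q * mat_adjoint P) * X * (P * Q)" using X Q by simp
  also have "\<dots> = mat_adjoint Q * (mat_adjoint P * (X * P)) * Q"
    using X P Q by (simp add: mult_mat_assoc_dim)
  also have "\<dots> = 0\<^sub>m n n" using assms Q by (simp add: left_mult_zero_mat[of _ n n])
  finally show ?thesis .
qed

section \<open>Semidefinite matrices and monotonicity of the determinant\<close>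

definition pos_semidef :: "complex mat \<Rightarrow> bool" where
  "pos_semidef A \<longleftrightarrow> A \<in> carrier_mat (dim_row A) (dim_row A) \<and> mat_adjoint A = A \<and>
     (\<forall>v \<in> carrier_vec (dim_row A). (A *\<^sub>v v) \<bullet>c v \<ge> 0)"

text \<open>The diagonal entry at \<open>j\<close> is the squared \<open>D\<close>-norm of column
  \<open>j\<close> of \<open>P\<close>, so a vanishing Gram matrix forces all columns to vanish.
  Later this turns \<open>R = 0\<close> into a support condition and \<open>T p = 0\<close> into
  \<open>v p = 0\<close>.\<close>

lemma pos_semidef_congruence:
  assumes D: "D \<in> carrier_mat n n" "pos_def D" and P: "P \<in> carrier_mat n k"
  shows "pos_semidef (mat_adjoint P * (D * P))"
    and "mat_adjoint P * (D * P) = 0\<^sub>m k k \<longleftrightarrow> P = 0\<^sub>m n k"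
proof -
  show "pos_semidef (mat_adjoint P * (D * P))" unfolding pos_semidef_def
  proof (intro conjI ballI)
    show "mat_adjoint (mat_adjoint P * (D * P)) = mat_adjoint P * (D * P)"
      using hermitian_congruence[OF D(1) pos_def_dest(1)[OF D(2,1)] P] .
    fix v :: "complex vec" assume "v \<in> carrier_vec (dim_row (mat_adjoint P * (D * P)))"
    then have v: "v \<in> carrier_vec k" using P by auto
    have Pv: "P *\<^sub>v v \<in> carrier_vec n" using P v by simp
    have "(mat_adjoint P * (D * P)) *\<^sub>v v = mat_adjoint P *\<^sub>v (D *\<^sub>v (P *\<^sub>v v))"
      using D P v by (simp add: mult_mat_vec_assoc_dim)
    then have "((mat_adjoint P * (D * P)) *\<^sub>v v) \<bullet>c v = (D *\<^sub>v (P *\<^sub>v v)) \<bullet>c (P *\<^sub>v v)"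
      using mat_adjoint_mult_vec_inner[OF P _ v, of "D *\<^sub>v (P *\<^sub>v v)"] D P v by simp
    also have "\<dots> \<ge> 0"
      using pos_def_dest(2)[OF D(2,1) Pv] Pv D
      by (cases "P *\<^sub>v v = 0\<^sub>v n") (auto simp: less_imp_le)
    finally show "((mat_adjoint P * (D * P)) *\<^sub>v v) \<bullet>c v \<ge> 0" .
  qed (use P in \<open>auto intro: carrier_matI\<close>)
  show "mat_adjoint P * (D * P) = 0\<^sub>m k k \<longleftrightarrow> P = 0\<^sub>m n k"
  proof
    assume 0: "mat_adjoint P * (D * P) = 0\<^sub>m k k"
    have "col P j = 0\<^sub>v n" if j: "j < k" for j
    proof (rule ccontr)
      assume "col P j \<noteq> 0\<^sub>v n"
      then have "(D *\<^sub>v col P j) \<bullet>c col P j > 0"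
        using pos_def_dest(2)[OF D(2,1)] P j by auto
      then show False using index_congruence[OF D(1) P P j j] 0 j by simp
    qed
    then show "P = 0\<^sub>m n k" using P
      by (intro eq_matI) (auto, metis index_col carrier_matD index_zero_vec(1))
  next
    assume "P = 0\<^sub>m n k"
    then show "mat_adjoint P * (D * P) = 0\<^sub>m k k"
      using D by (auto simp: scalar_prod_def intro!: eq_matI)
  qed
qed

lemma pos_def_one: "pos_def (1\<^sub>m n)"
  unfolding pos_def_def by (auto simp: conjugate_square_greater_0_vec)

lemma pos_def_of_congruence:
  assumes M: "M \<in> carrier_mat n n" and P: "P \<in> carrier_mat n n" "det P \<noteq> 0"
    and pos: "pos_def (mat_adjoint P * (M * P))"
  shows "pos_def M"
proof -
  let ?M = "mat_adjoint P * (M * P)"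
  obtain Q where Q: "Q \<in> carrier_mat n n" "P * Q = 1\<^sub>m n" "Q * P = 1\<^sub>m n"
    using det_nonzero_inverse[OF P] by metis
  have "mat_adjoint Q * mat_adjoint P = 1\<^sub>m n"
    using P Q mat_adjoint_mult[of P Q] by simp
  then have "M = (mat_adjoint Q * mat_adjoint P) * M * (P * Q)" using M Q by simp
  also have "\<dots> = mat_adjoint Q * (?M * Q)"
    using M P Q by (simp add: mult_mat_assoc_dim)
  finally have M_eq: "M = mat_adjoint Q * (?M * Q)" .
  have "v = 0\<^sub>v n" if "v \<in> carrier_vec n" "Q *\<^sub>v v = 0\<^sub>v n" for v
  proof -
    have "v = (P * Q) *\<^sub>v v" using that Q by simp
    also have "\<dots> = P *\<^sub>v (Q *\<^sub>v v)" using that(1) P Q by (intro assoc_mult_mat_vec) auto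
    also have "\<dots> = 0\<^sub>v n" using that P by (auto simp: scalar_prod_def intro!: eq_vecI)
    finally show ?thesis .
  qed
  then have "pos_def (mat_adjoint Q * (?M * Q))"
    using M P by (intro pos_def_congruence[OF _ pos Q(1)] mult_carrier_mat) auto
  then show ?thesis using M_eq by simp
qed

text \<open>A congruence to the identity certifies positivity; invertibility of \<open>P\<close> is
  read off from the determinants in that relation.\<close>

lemma pos_def_of_congruence_one:
  assumes M: "M \<in> carrier_mat n n" and P: "P \<in> carrier_mat n n"
    and one: "mat_adjoint P * (M * P) = 1\<^sub>m n"
  shows "pos_def M"
proof -
  have "det P \<noteq> 0" using det_congruence[OF M P] one by auto
  then show ?thesis using pos_def_of_congruence[OF M P] one pos_def_one by simp
qed

lemma pos_def_mat_diag:
  assumes "\<And>j. j < n \<Longrightarrow> 0 < f j"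
  shows "pos_def (mat_diag n (\<lambda>j. complex_of_real (f j)))"
proof (rule pos_def_of_congruence_one)
  let ?P = "mat_diag n (\<lambda>j. complex_of_real (1 / sqrt (f j)))"
  have "mat_adjoint ?P = ?P" by (rule eq_matI) (auto simp: mat_diag_def)
  moreover have "1 / sqrt (f j) * (f j * (1 / sqrt (f j))) = 1" if "j < n" for j
    using assms[OF that] by (simp add: field_simps)
  then have "complex_of_real (1 / sqrt (f j)) * (complex_of_real (f j) * complex_of_real (1 / sqrt (f j))) = 1"
    if "j < n" for j
    using that by (metis of_real_1 of_real_mult)
  then have "mat_diag n (\<lambda>j. complex_of_real (1 / sqrt (f j)) *
      (complex_of_real (f j) * complex_of_real (1 / sqrt (f j)))) = 1\<^sub>m n"
    by (intro eq_matI) (auto simp: mat_diag_def)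
  ultimately show "mat_adjoint ?P * (mat_diag n (\<lambda>j. complex_of_real (f j)) * ?P) = 1\<^sub>m n"
    by (simp del: of_real_divide)
qed auto

lemma index_mat_diag_congruence:
  fixes X :: "complex mat"
  assumes "X \<in> carrier_mat n n" "P \<in> carrier_mat n n"
    "mat_adjoint P * (X * P) = mat_diag n f" "j < n"
  shows "f j = (X *\<^sub>v col P j) \<bullet>c col P j"
  using index_congruence[OF assms(1,2,2,4,4)] assms(3,4) by (simp add: mat_diag_def)

text \<open>The determinant is computed on the whole pencil in \<open>c\<close> because both signs
  occur: \<open>c = 1\<close> when \<open>R\<close> is added and \<open>c = -1\<close> when
  \<open>T\<close> is subtracted. The formula for \<open>det D\<close> shows that it is real and
  positive.\<close>

lemma pos_semidef_spectrum:
  assumes D: "D \<in> carrier_mat n n" "pos_def D" and T: "T \<in> carrier_mat n n" "pos_semidef T"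
  shows "\<exists>P x. P \<in> carrier_mat n n \<and> det P \<noteq> 0 \<and> mat_adjoint P * (D * P) = 1\<^sub>m n \<and>
    mat_adjoint P * (T * P) = mat_diag n (\<lambda>j. complex_of_real (x j)) \<and>
    (\<forall>j<n. 0 \<le> x j) \<and> (T = 0\<^sub>m n n \<longleftrightarrow> (\<forall>j<n. x j = 0)) \<and>
    det D = complex_of_real (1 / (cmod (det P))\<^sup>2) \<and>
    (\<forall>c. det (D + complex_of_real c \<cdot>\<^sub>m T) = det D * complex_of_real (\<Prod>j<n. 1 + c * x j))"
proof -
  have TH: "mat_adjoint T = T" using T by (simp add: pos_semidef_def)
  obtain P x where P: "P \<in> carrier_mat n n" "mat_adjoint P * (D * P) = 1\<^sub>m n"
      and x: "mat_adjoint P * (T * P) = mat_diag n (\<lambda>j. complex_of_real (x j))"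
    using simultaneous_diagonalization[OF D T(1) TH] by blast
  have dP: "det D * complex_of_real ((cmod (det P))\<^sup>2) = 1"
    using det_congruence[OF D(1) P(1)] P(2) by simp
  then have P0: "det P \<noteq> 0" by auto
  have "0 \<le> x j" if j: "j < n" for j
  proof -
    have "0 \<le> complex_of_real (x j)"
      using index_mat_diag_congruence[OF T(1) P(1) x j] T P j by (simp add: pos_semidef_def)
    then show ?thesis by (simp add: less_eq_complex_def)
  qed
  moreover have "T = 0\<^sub>m n n \<longleftrightarrow> (\<forall>j<n. x j = 0)"
  proof
    assume T0: "T = 0\<^sub>m n n"
    have "complex_of_real (x j) = 0" if "j < n" for j
      using index_mat_diag_congruence[OF T(1) P(1) x that] T0 P that
      by (simp add: scalar_prod_def)
    then show "\<forall>j<n. x j = 0" by simp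
  next
    assume "\<forall>j<n. x j = 0"
    then have "mat_adjoint P * (T * P) = 0\<^sub>m n n"
      unfolding x by (intro eq_matI) (auto simp: mat_diag_def)
    then show "T = 0\<^sub>m n n" using congruence_eq_zero[OF T(1) P(1) P0] by simp
  qed
  moreover have dD: "det D = complex_of_real (1 / (cmod (det P))\<^sup>2)"
    using dP P0 by (simp add: field_simps)
  moreover have "det (D + complex_of_real c \<cdot>\<^sub>m T) = det D * complex_of_real (\<Prod>j<n. 1 + c * x j)" for c
  proof -
    have "mat_adjoint P * ((D + complex_of_real c \<cdot>\<^sub>m T) * P)
      = mat_adjoint P * (D * P) + complex_of_real c \<cdot>\<^sub>m (mat_adjoint P * (T * P))"
    proof -
      have "(D + complex_of_real c \<cdot>\<^sub>m T) * P = D * P + complex_of_real c \<cdot>\<^sub>m (T * P)"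
        using P D T add_mult_distrib_mat[of D n n "complex_of_real c \<cdot>\<^sub>m T" P n]
          mult_smult_assoc_mat[of T n n P n] by simp
      then show ?thesis
        using P D T mult_add_distrib_mat[of "mat_adjoint P" n n "D * P" n "complex_of_real c \<cdot>\<^sub>m (T * P)"]
          mult_smult_distrib[of "mat_adjoint P" n n "T * P" n] by simp
    qed
    also have "\<dots> = mat_diag n (\<lambda>j. complex_of_real (1 + c * x j))"
      unfolding x P by (intro eq_matI) (auto simp: mat_diag_def)
    finally have "det (D + complex_of_real c \<cdot>\<^sub>m T) * complex_of_real ((cmod (det P))\<^sup>2)
      = complex_of_real (\<Prod>j<n. 1 + c * x j)"
      using det_congruence[of "D + complex_of_real c \<cdot>\<^sub>m T" n P] D T P by (simp add: det_mat_diag)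
    then show ?thesis unfolding dD using P0 by (simp add: field_simps)
  qed
  ultimately show ?thesis using P x P0 by (intro exI[of _ P] exI[of _ x]) blast
qed

lemma pos_def_det_pos:
  assumes D: "D \<in> carrier_mat n n" "pos_def D"
  shows "det D = complex_of_real (Re (det D))" "Re (det D) > 0"
proof -
  \<comment> \<open>The zero matrix serves as a dummy second form; what is extracted is the formula
    for \<open>det D\<close>.\<close>
  have "pos_semidef (0\<^sub>m n n)" by (auto simp: pos_semidef_def intro!: eq_matI simp: scalar_prod_def)
  then obtain P where P: "det P \<noteq> 0" "det D = complex_of_real (1 / (cmod (det P))\<^sup>2)"
    using pos_semidef_spectrum[OF D zero_carrier_mat] by blast
  then show "det D = complex_of_real (Re (det D))" "Re (det D) > 0" by simp_all
qed

text \<open>Adding \<open>R\<close> multiplies the determinant by the product of the numbers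
  \<open>1 + x j\<close> with \<open>x j \<ge> 0\<close>; this is 1 only if all \<open>x j\<close>
  vanish, and then \<open>R\<close> vanishes too. It is the tool for judging the loss caused by
  dropping \<open>R\<close>.\<close>

lemma pos_def_det_add:
  assumes D: "D \<in> carrier_mat n n" "pos_def D" and R: "R \<in> carrier_mat n n" "pos_semidef R"
  shows "det (D + R) \<ge> det D" "det (D + R) = det D \<longleftrightarrow> R = 0\<^sub>m n n"
proof -
  obtain x where x: "\<forall>j<n. 0 \<le> x j" "R = 0\<^sub>m n n \<longleftrightarrow> (\<forall>j<n. x j = 0)"
    "\<forall>c. det (D + complex_of_real c \<cdot>\<^sub>m R) = det D * complex_of_real (\<Prod>j<n. 1 + c * x j)"
    using pos_semidef_spectrum[OF D R] by blast
  have one: "complex_of_real 1 \<cdot>\<^sub>m R = R" by (intro eq_matI) auto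
  define k where "k = (\<Prod>j<n. 1 + x j)"
  obtain d where d: "det D = complex_of_real d" "d > 0" using pos_def_det_pos[OF D] by metis
  have det: "det (D + R) = complex_of_real (d * k)"
    using x(3)[rule_format, of 1] unfolding one k_def d by simp
  have k1: "1 \<le> k" unfolding k_def using x(1) by (intro prod_ge_1) auto
  then show "det (D + R) \<ge> det D" unfolding det d using d by (simp add: less_eq_complex_def)
  have "k = 1 \<longleftrightarrow> (\<forall>j<n. x j = 0)"
  proof
    assume "k = 1"
    show "\<forall>j<n. x j = 0"
    proof (intro allI impI)
      fix j assume j: "j < n"
      have "k = (1 + x j) * (\<Prod>i\<in>{..<n} - {j}. 1 + x i)"
        unfolding k_def using j by (intro prod.remove) auto
      moreover have "1 \<le> (\<Prod>i\<in>{..<n} - {j}. 1 + x i)" using x(1) by (intro prod_ge_1) auto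
      ultimately have "1 + x j \<le> k" using x(1)[rule_format, OF j]
        by (metis add_nonneg_nonneg mult_left_mono mult.right_neutral zero_le_one)
      then show "x j = 0" using \<open>k = 1\<close> x(1)[rule_format, OF j] by simp
    qed
  qed (simp add: k_def)
  then show "det (D + R) = det D \<longleftrightarrow> R = 0\<^sub>m n n"
    unfolding x(2) det d using d
    by (metis mult_cancel_left1 of_real_eq_iff less_irrefl)
qed

section \<open>Kronecker products\<close>

lemma bij_betw_div_mod:
  fixes a b :: nat
  shows "bij_betw (\<lambda>r. (r div b, r mod b)) {..<a * b} ({..<a} \<times> {..<b})"
proof (cases "b = 0")
  case False
  show ?thesis
  proof (rule bij_betw_byWitness[where f' = "\<lambda>(i, j). i * b + j"])
    have "i * b + j < a * b" if "i < a" "j < b" for i j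
    proof -
      have "i * b + j < Suc i * b" using that by simp
      also have "\<dots> \<le> a * b" using that by (intro mult_right_mono) auto
      finally show ?thesis .
    qed
    then show "(\<lambda>(i, j). i * b + j) ` ({..<a} \<times> {..<b}) \<subseteq> {..<a * b}" by auto
  qed (use False in \<open>auto simp: less_mult_imp_div_less\<close>)
qed (simp add: bij_betw_def)

lemma sum_div_mod:
  fixes f :: "nat \<Rightarrow> nat \<Rightarrow> 'a :: comm_monoid_add"
  shows "(\<Sum>r<a * b. f (r div b) (r mod b)) = (\<Sum>i<a. \<Sum>j<b. f i j)"
  using sum.reindex_bij_betw[OF bij_betw_div_mod[of b a], of "\<lambda>(i, j). f i j"]
  by (simp add: sum.cartesian_product)

lemma prod_div_mod:
  fixes f :: "nat \<Rightarrow> nat \<Rightarrow> 'a :: comm_monoid_mult"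
  shows "(\<Prod>r<a * b. f (r div b) (r mod b)) = (\<Prod>i<a. \<Prod>j<b. f i j)"
  using prod.reindex_bij_betw[OF bij_betw_div_mod[of b a], of "\<lambda>(i, j). f i j"]
  by (simp add: prod.cartesian_product)

lemma mod_less_of_less_mult: "r < a * b \<Longrightarrow> r mod b < (b :: nat)"
  by (cases "b = 0") auto

lemma dim_kron [simp]:
  "dim_row (kron A B) = dim_row A * dim_row B" "dim_col (kron A B) = dim_col A * dim_col B"
  by (auto simp: kron_def)

lemma index_kron:
  "r < dim_row A * dim_row B \<Longrightarrow> c < dim_col A * dim_col B \<Longrightarrow> kron A B $$ (r, c)
    = A $$ (r div dim_row B, c div dim_col B) * B $$ (r mod dim_row B, c mod dim_col B)"
  by (simp add: kron_def)

text \<open>The summation index of the matrix product is split into quotient and remainder, and the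
  resulting double sum factors.\<close>

lemma kron_mult:
  fixes A B C D :: "'a :: comm_semiring_0 mat"
  assumes "dim_col A = dim_row C" "dim_col B = dim_row D"
  shows "kron A B * kron C D = kron (A * C) (B * D)"
proof (rule eq_matI)
  fix r c assume "r < dim_row (kron (A * C) (B * D))" "c < dim_col (kron (A * C) (B * D))"
  then have r: "r < dim_row A * dim_row B" and c: "c < dim_col C * dim_col D" by auto
  let ?r1 = "r div dim_row B" and ?r2 = "r mod dim_row B"
    and ?c1 = "c div dim_col D" and ?c2 = "c mod dim_col D"
  have b: "?r1 < dim_row A" "?r2 < dim_row B" "?c1 < dim_col C" "?c2 < dim_col D"
    using r c by (auto intro: less_mult_imp_div_less mod_less_of_less_mult)
  let ?f = "\<lambda>i j. (A $$ (?r1, i) * C $$ (i, ?c1)) * (B $$ (?r2, j) * D $$ (j, ?c2))"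
  have "(kron A B * kron C D) $$ (r, c)
    = (\<Sum>k<dim_row C * dim_row D. ?f (k div dim_row D) (k mod dim_row D))"
    using r c assms
    by (auto simp: scalar_prod_def index_kron lessThan_atLeast0 mult_ac intro!: sum.cong)
  also have "\<dots> = (\<Sum>i<dim_row C. \<Sum>j<dim_row D. ?f i j)" by (rule sum_div_mod)
  also have "\<dots> = (A * C) $$ (?r1, ?c1) * (B * D) $$ (?r2, ?c2)"
    using b assms by (simp add: scalar_prod_def lessThan_atLeast0 sum_product)
  finally show "(kron A B * kron C D) $$ (r, c) = kron (A * C) (B * D) $$ (r, c)"
    using r c by (simp add: index_kron)
qed auto

lemma mat_adjoint_kron: "mat_adjoint (kron A B) = kron (mat_adjoint A) (mat_adjoint (B :: complex mat))"
  by (rule eq_matI)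
    (auto simp: index_kron less_mult_imp_div_less mod_less_of_less_mult)

lemma kron_prod_carrier:
  assumes "\<And>p. p \<in> {1..k} \<Longrightarrow> F p \<in> carrier_mat (a p) (b p)"
  shows "kron_prod k F \<in> carrier_mat (\<Prod>p\<in>{1..k}. a p) (\<Prod>p\<in>{1..k}. b p)"
  using assms
proof (induction k)
  case (Suc k)
  then have "kron_prod k F \<in> carrier_mat (\<Prod>p\<in>{1..k}. a p) (\<Prod>p\<in>{1..k}. b p)"
    "F (Suc k) \<in> carrier_mat (a (Suc k)) (b (Suc k))" by auto
  then show ?case by (auto simp: mult.commute intro!: carrier_matI)
qed auto

lemma kron_prod_cong:
  assumes "\<And>p. p \<in> {1..k} \<Longrightarrow> F p = G p"
  shows "kron_prod k F = kron_prod k G"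
  using assms by (induction k) auto

lemma kron_prod_mult:
  fixes F G :: "nat \<Rightarrow> 'a :: comm_semiring_1 mat"
  assumes "\<And>p. p \<in> {1..k} \<Longrightarrow> F p \<in> carrier_mat (a p) (b p)"
    "\<And>p. p \<in> {1..k} \<Longrightarrow> G p \<in> carrier_mat (b p) (c p)"
  shows "kron_prod k F * kron_prod k G = kron_prod k (\<lambda>p. F p * G p)"
  using assms
proof (induction k)
  case (Suc k)
  have "kron_prod k F \<in> carrier_mat (\<Prod>p\<in>{1..k}. a p) (\<Prod>p\<in>{1..k}. b p)"
    "kron_prod k G \<in> carrier_mat (\<Prod>p\<in>{1..k}. b p) (\<Prod>p\<in>{1..k}. c p)"
    by (rule kron_prod_carrier; use Suc.prems in simp)+
  moreover have "F (Suc k) \<in> carrier_mat (a (Suc k)) (b (Suc k))"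
    "G (Suc k) \<in> carrier_mat (b (Suc k)) (c (Suc k))" using Suc.prems by auto
  moreover have "kron_prod k F * kron_prod k G = kron_prod k (\<lambda>p. F p * G p)"
    by (rule Suc.IH) (use Suc.prems in auto)
  ultimately show ?case by (simp add: kron_mult)
qed simp

lemma mat_adjoint_kron_prod:
  fixes F :: "nat \<Rightarrow> complex mat"
  shows "mat_adjoint (kron_prod k F) = kron_prod k (\<lambda>p. mat_adjoint (F p))"
  by (induction k) (auto simp: mat_adjoint_kron)

section \<open>Mixed-radix coordinates of Kronecker indices\<close>

fun undigits :: "(nat \<Rightarrow> nat) \<Rightarrow> nat \<Rightarrow> (nat \<Rightarrow> nat) \<Rightarrow> nat" where
  "undigits d 0 x = 0"
| "undigits d (Suc k) x = undigits d k x * d (Suc k) + x (Suc k)"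

text \<open>The last factor is the least significant digit, because \<open>kron_prod\<close> appends
  factors on the right and in \<open>kron\<close> the index of the right factor varies fastest.
  Coordinates are numbered from 1; those outside \<open>{1..k}\<close> are set to 0.\<close>

fun digits :: "(nat \<Rightarrow> nat) \<Rightarrow> nat \<Rightarrow> nat \<Rightarrow> nat \<Rightarrow> nat" where
  "digits d 0 r = (\<lambda>_. 0)"
| "digits d (Suc k) r = (digits d k (r div d (Suc k)))(Suc k := r mod d (Suc k))"

lemma digits_less:
  assumes "r < (\<Prod>p\<in>{1..k}. d p)" "p \<in> {1..k}"
  shows "digits d k r p < d p"
  using assms
proof (induction k arbitrary: r)
  case (Suc k)
  have r: "r < (\<Prod>p\<in>{1..k}. d p) * d (Suc k)" using Suc.prems by (simp add: mult.commute)
  show ?case using Suc.IH[OF less_mult_imp_div_less[OF r]] mod_less_of_less_mult[OF r] Suc.prems(2)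
    by (auto simp: le_Suc_eq)
qed simp

lemma undigits_cong:
  assumes "\<And>p. p \<in> {1..k} \<Longrightarrow> x p = y p"
  shows "undigits d k x = undigits d k y"
  using assms by (induction k) auto

lemma undigits_less:
  assumes "\<And>p. p \<in> {1..k} \<Longrightarrow> x p < d p"
  shows "undigits d k x < (\<Prod>p\<in>{1..k}. d p)"
  using assms
proof (induction k)
  case (Suc k)
  have "undigits d k x * d (Suc k) + x (Suc k) < Suc (undigits d k x) * d (Suc k)"
    using Suc.prems by simp
  also have "\<dots> \<le> (\<Prod>p\<in>{1..k}. d p) * d (Suc k)"
    using Suc by (intro mult_right_mono) (auto simp: Suc_le_eq)
  finally show ?case by (simp add: mult.commute)
qed simp

lemma undigits_digits:
  assumes "r < (\<Prod>p\<in>{1..k}. d p)"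
  shows "undigits d k (digits d k r) = r"
  using assms
proof (induction k arbitrary: r)
  case (Suc k)
  have r: "r < (\<Prod>p\<in>{1..k}. d p) * d (Suc k)" using Suc.prems by (simp add: mult.commute)
  have "undigits d k (digits d (Suc k) r) = undigits d k (digits d k (r div d (Suc k)))"
    by (rule undigits_cong) auto
  also have "\<dots> = r div d (Suc k)" by (rule Suc.IH[OF less_mult_imp_div_less[OF r]])
  finally show ?case by (simp only: undigits.simps) simp
qed simp

lemma digits_undigits:
  assumes "\<And>p. p \<in> {1..k} \<Longrightarrow> x p < d p" "p \<in> {1..k}"
  shows "digits d k (undigits d k x) p = x p"
  using assms
proof (induction k)
  case (Suc k)
  have "x (Suc k) < d (Suc k)" using Suc.prems by simp
  then show ?case using Suc by (auto simp: le_Suc_eq)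
qed simp

lemma index_kron_prod:
  fixes F :: "nat \<Rightarrow> 'a :: comm_semiring_1 mat"
  assumes "\<And>p. p \<in> {1..k} \<Longrightarrow> F p \<in> carrier_mat (a p) (b p)"
    and "r < (\<Prod>p\<in>{1..k}. a p)" "c < (\<Prod>p\<in>{1..k}. b p)"
  shows "kron_prod k F $$ (r, c) = (\<Prod>p\<in>{1..k}. F p $$ (digits a k r p, digits b k c p))"
  using assms
proof (induction k arbitrary: r c)
  case (Suc k)
  have r: "r < (\<Prod>p\<in>{1..k}. a p) * a (Suc k)" using Suc.prems by (simp add: mult.commute)
  have c: "c < (\<Prod>p\<in>{1..k}. b p) * b (Suc k)" using Suc.prems by (simp add: mult.commute)
  have F: "kron_prod k F \<in> carrier_mat (\<Prod>p\<in>{1..k}. a p) (\<Prod>p\<in>{1..k}. b p)"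
    by (rule kron_prod_carrier) (use Suc.prems in auto)
  have FS: "F (Suc k) \<in> carrier_mat (a (Suc k)) (b (Suc k))" using Suc.prems by auto
  have "kron_prod (Suc k) F $$ (r, c) = kron_prod k F $$ (r div a (Suc k), c div b (Suc k))
      * F (Suc k) $$ (r mod a (Suc k), c mod b (Suc k))"
    using F FS r c by (simp add: index_kron)
  also have "kron_prod k F $$ (r div a (Suc k), c div b (Suc k))
      = (\<Prod>p\<in>{1..k}. F p $$ (digits a k (r div a (Suc k)) p, digits b k (c div b (Suc k)) p))"
    using Suc.prems by (intro Suc.IH less_mult_imp_div_less r c) auto
  also have "\<dots> = (\<Prod>p\<in>{1..k}. F p $$ (digits a (Suc k) r p, digits b (Suc k) c p))"
    by (intro prod.cong) auto
  finally show ?case by (simp add: mult.commute)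
qed simp

lemma kron_prod_diag:
  fixes f :: "nat \<Rightarrow> nat \<Rightarrow> 'a :: comm_semiring_1"
  shows "kron_prod k (\<lambda>p. mat_diag (d p) (f p))
    = mat_diag (\<Prod>p\<in>{1..k}. d p) (\<lambda>r. \<Prod>p\<in>{1..k}. f p (digits d k r p))" (is "?L = ?R")
proof (rule eq_matI)
  have carr: "?L \<in> carrier_mat (\<Prod>p\<in>{1..k}. d p) (\<Prod>p\<in>{1..k}. d p)"
    by (intro kron_prod_carrier) auto
  then show "dim_row ?L = dim_row ?R" "dim_col ?L = dim_col ?R" by auto
  fix r c assume "r < dim_row ?R" "c < dim_col ?R"
  then have rc: "r < (\<Prod>p\<in>{1..k}. d p)" "c < (\<Prod>p\<in>{1..k}. d p)" by auto
  have L: "?L $$ (r, c) = (\<Prod>p\<in>{1..k}. mat_diag (d p) (f p) $$ (digits d k r p, digits d k c p))"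
    using rc by (intro index_kron_prod) auto
  show "?L $$ (r, c) = ?R $$ (r, c)"
  proof (cases "r = c")
    case True
    then show ?thesis unfolding L using rc digits_less[OF rc(1)]
      by (auto simp: mat_diag_def intro!: prod.cong)
  next
    case False
    \<comment> \<open>Distinct indices differ in some digit, and the factor at that digit is an
      off-diagonal zero.\<close>
    have "\<exists>p\<in>{1..k}. digits d k r p \<noteq> digits d k c p"
    proof (rule ccontr)
      assume "\<not> ?thesis"
      then have "undigits d k (digits d k r) = undigits d k (digits d k c)"
        by (intro undigits_cong) auto
      then show False using False rc by (simp add: undigits_digits)
    qed
    then have "\<exists>p\<in>{1..k}. mat_diag (d p) (f p) $$ (digits d k r p, digits d k c p) = 0"
      using digits_less[OF rc(1)] digits_less[OF rc(2)] by (auto simp: mat_diag_def)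
    then have "?L $$ (r, c) = 0" unfolding L by (intro prod_zero) auto
    then show ?thesis using False rc by (simp add: mat_diag_def)
  qed
qed

lemma kron_prod_one:
  "kron_prod k (\<lambda>p. 1\<^sub>m (d p)) = (1\<^sub>m (\<Prod>p\<in>{1..k}. d p) :: 'a :: comm_semiring_1 mat)"
  using kron_prod_diag[of k d "\<lambda>_ _. 1 :: 'a"] by simp

text \<open>As \<open>r\<close> runs through all indices, its digit \<open>p\<close> takes each
  value equally often, once for each choice of the other digits. This multiplicity is the origin of
  \<open>\<sigma>\<close>.\<close>

lemma prod_digits:
  fixes g :: "nat \<Rightarrow> 'a :: comm_semiring_1"
  assumes "\<And>p. p \<in> {1..k} \<Longrightarrow> 0 < d p" "p \<in> {1..k}"
  shows "(\<Prod>r<(\<Prod>q\<in>{1..k}. d q). g (digits d k r p)) = (\<Prod>j<d p. g j) ^ ((\<Prod>q\<in>{1..k}. d q) div d p)"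
  using assms
proof (induction k)
  case (Suc k)
  define N where "N = (\<Prod>q\<in>{1..k}. d q)"
  have N: "(\<Prod>q\<in>{1..Suc k}. d q) = N * d (Suc k)" by (simp add: N_def mult.commute)
  have d: "0 < d (Suc k)" using Suc.prems by simp
  show ?case
  proof (cases "p = Suc k")
    case True
    then show ?thesis unfolding N using d prod_div_mod[of "\<lambda>_. g" "d (Suc k)" N]
      by (simp add: prod_constant)
  next
    case False
    then have p: "p \<in> {1..k}" using Suc.prems by auto
    have "(\<Prod>r<N * d (Suc k). g (digits d (Suc k) r p))
      = (\<Prod>r<N. \<Prod>j<d (Suc k). g (digits d k r p))"
      using False prod_div_mod[of "\<lambda>r j. g (digits d k r p)" "d (Suc k)" N] by simp
    also have "\<dots> = (\<Prod>r<N. g (digits d k r p)) ^ d (Suc k)"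
      by (simp add: prod_power_distrib)
    also have "\<dots> = (\<Prod>j<d p. g j) ^ (N div d p * d (Suc k))"
      using Suc.IH[OF Suc.prems(1) p] by (simp add: N_def power_mult)
    \<comment> \<open>The division is exact, \<open>d p\<close> being one of the factors of
      \<open>N\<close>, so it commutes with the multiplication.\<close>
    also have "N div d p * d (Suc k) = N * d (Suc k) div d p"
      using p by (simp add: N_def dvd_prodI div_mult_swap mult.commute)
    finally show ?thesis unfolding N .
  qed
qed simp

lemma kron_prod_congruence:
  fixes X P :: "nat \<Rightarrow> complex mat"
  assumes "\<And>p. p \<in> {1..k} \<Longrightarrow> X p \<in> carrier_mat (a p) (a p)"
    "\<And>p. p \<in> {1..k} \<Longrightarrow> P p \<in> carrier_mat (a p) (b p)"
  shows "mat_adjoint (kron_prod k P) * (kron_prod k X * kron_prod k P)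
    = kron_prod k (\<lambda>p. mat_adjoint (P p) * (X p * P p))"
proof -
  have "kron_prod k X * kron_prod k P = kron_prod k (\<lambda>p. X p * P p)"
    using assms by (rule kron_prod_mult)
  moreover have "kron_prod k (\<lambda>p. mat_adjoint (P p)) * kron_prod k (\<lambda>p. X p * P p)
      = kron_prod k (\<lambda>p. mat_adjoint (P p) * (X p * P p))"
    using assms by (intro kron_prod_mult[of k _ b a _ b] mult_carrier_mat) auto
  ultimately show ?thesis unfolding mat_adjoint_kron_prod by simp
qed

text \<open>Each factor is carried to the identity by a congruence, and the Kronecker product of
  these congruences carries the whole product to the identity.\<close>

lemma pos_def_kron_prod:
  assumes X: "\<And>p. p \<in> {1..k} \<Longrightarrow> X p \<in> carrier_mat (a p) (a p)"
    "\<And>p. p \<in> {1..k} \<Longrightarrow> pos_def (X p)"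
  shows "pos_def (kron_prod k X)"
proof -
  have "\<exists>P. P \<in> carrier_mat (a p) (a p) \<and> mat_adjoint P * (X p * P) = 1\<^sub>m (a p)"
    if "p \<in> {1..k}" for p
    using simultaneous_diagonalization[OF X(1,2)[OF that], of "1\<^sub>m (a p)"] that by auto
  then obtain P where P: "\<And>p. p \<in> {1..k} \<Longrightarrow> P p \<in> carrier_mat (a p) (a p)"
    "\<And>p. p \<in> {1..k} \<Longrightarrow> mat_adjoint (P p) * (X p * P p) = 1\<^sub>m (a p)" by metis
  have "mat_adjoint (kron_prod k P) * (kron_prod k X * kron_prod k P)
    = kron_prod k (\<lambda>p. mat_adjoint (P p) * (X p * P p))"
    using X P by (intro kron_prod_congruence[of k _ a _ a]) auto
  also have "\<dots> = kron_prod k (\<lambda>p. 1\<^sub>m (a p))" using P by (intro kron_prod_cong) auto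
  also have "\<dots> = 1\<^sub>m (\<Prod>p\<in>{1..k}. a p)" by (rule kron_prod_one)
  finally show ?thesis
    using pos_def_of_congruence_one[OF kron_prod_carrier kron_prod_carrier] X P by blast
qed

text \<open>Diagonalizing each \<open>X p\<close> together with the identity means that
  \<open>P p\<close> is unitary, so all determinants are products of eigenvalues; counting their
  repetitions by digits gives the exponents.\<close>

lemma det_kron_prod_pos_def:
  assumes X: "\<And>p. p \<in> {1..k} \<Longrightarrow> X p \<in> carrier_mat (a p) (a p)"
    "\<And>p. p \<in> {1..k} \<Longrightarrow> pos_def (X p)"
    and a: "\<And>p. p \<in> {1..k} \<Longrightarrow> 0 < a p"
  shows "det (kron_prod k X) = (\<Prod>p\<in>{1..k}. det (X p) ^ ((\<Prod>q\<in>{1..k}. a q) div a p))"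
proof -
  have "\<exists>P x. P \<in> carrier_mat (a p) (a p) \<and> mat_adjoint P * (1\<^sub>m (a p) * P) = 1\<^sub>m (a p) \<and>
      mat_adjoint P * (X p * P) = mat_diag (a p) (\<lambda>j. complex_of_real (x j))"
    if "p \<in> {1..k}" for p
    using simultaneous_diagonalization[OF _ pos_def_one X(1)[OF that]]
      pos_def_dest(1)[OF X(2,1)[OF that]] that by auto
  then obtain P x where P: "\<And>p. p \<in> {1..k} \<Longrightarrow> P p \<in> carrier_mat (a p) (a p)"
    "\<And>p. p \<in> {1..k} \<Longrightarrow> mat_adjoint (P p) * (1\<^sub>m (a p) * P p) = 1\<^sub>m (a p)"
    "\<And>p. p \<in> {1..k} \<Longrightarrow> mat_adjoint (P p) * (X p * P p)
       = mat_diag (a p) (\<lambda>j. complex_of_real (x p j))"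
    by metis
  define N where "N = (\<Prod>p\<in>{1..k}. a p)"
  define Q where "Q = kron_prod k P"
  have Q: "Q \<in> carrier_mat N N" unfolding Q_def N_def using P by (intro kron_prod_carrier)
  have Xk: "kron_prod k X \<in> carrier_mat N N" unfolding N_def using X by (intro kron_prod_carrier)
  have detX: "det (X p) = (\<Prod>j<a p. complex_of_real (x p j))" if p: "p \<in> {1..k}" for p
    using det_congruence[OF X(1)[OF p] P(1)[OF p]] P(2,3)[OF p]
      det_congruence[OF one_carrier_mat P(1)[OF p]] by (simp add: det_mat_diag)
  have "mat_adjoint Q * (1\<^sub>m N * Q) = kron_prod k (\<lambda>p. mat_adjoint (P p) * (1\<^sub>m (a p) * P p))"
    unfolding Q_def N_def kron_prod_one[symmetric] using P by (intro kron_prod_congruence[of k _ a _ a]) auto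
  also have "\<dots> = kron_prod k (\<lambda>p. 1\<^sub>m (a p))" using P by (intro kron_prod_cong) auto
  finally have "mat_adjoint Q * (1\<^sub>m N * Q) = 1\<^sub>m N" by (simp add: kron_prod_one N_def)
  then have Q1: "complex_of_real ((cmod (det Q))\<^sup>2) = 1"
    using det_congruence[OF one_carrier_mat Q] by simp
  have "mat_adjoint Q * (kron_prod k X * Q) = kron_prod k (\<lambda>p. mat_adjoint (P p) * (X p * P p))"
    unfolding Q_def using X P by (intro kron_prod_congruence[of k _ a _ a]) auto
  also have "\<dots> = kron_prod k (\<lambda>p. mat_diag (a p) (\<lambda>j. complex_of_real (x p j)))"
    using P by (intro kron_prod_cong) auto
  also have "\<dots> = mat_diag N (\<lambda>r. \<Prod>p\<in>{1..k}. complex_of_real (x p (digits a k r p)))"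
    unfolding N_def by (rule kron_prod_diag)
  finally have "det (kron_prod k X) = (\<Prod>r<N. \<Prod>p\<in>{1..k}. complex_of_real (x p (digits a k r p)))"
    using det_congruence[OF Xk Q] Q1 by (simp add: det_mat_diag)
  also have "\<dots> = (\<Prod>p\<in>{1..k}. \<Prod>r<N. complex_of_real (x p (digits a k r p)))" by (rule prod.swap)
  also have "\<dots> = (\<Prod>p\<in>{1..k}. det (X p) ^ (N div a p))"
  proof (intro prod.cong refl)
    fix p assume p: "p \<in> {1..k}"
    show "(\<Prod>r<N. complex_of_real (x p (digits a k r p))) = det (X p) ^ (N div a p)"
      unfolding detX[OF p] N_def
      using prod_digits[of k a p "\<lambda>j. complex_of_real (x p j)"] a p by simp
  qed
  finally show ?thesis unfolding N_def .
qed

section \<open>Determinants of differences of Kronecker products\<close>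

lemma congruence_minus:
  fixes X Y P :: "complex mat"
  assumes "X \<in> carrier_mat n n" "Y \<in> carrier_mat n n" "P \<in> carrier_mat n k"
  shows "mat_adjoint P * ((X - Y) * P) = mat_adjoint P * (X * P) - mat_adjoint P * (Y * P)"
proof -
  have "(X - Y) * P = X * P - Y * P" using assms by (intro minus_mult_distrib_mat)
  then show ?thesis using assms by (simp add: mult_minus_distrib_mat[of _ k n _ k])
qed

text \<open>The bound \<open>x j < 1\<close> comes from positivity of \<open>D - T\<close>, whose
  diagonal entries in the common coordinates are \<open>1 - x j\<close>.\<close>

lemma pos_def_diff_spectrum:
  assumes D: "D \<in> carrier_mat n n" "pos_def D" and T: "T \<in> carrier_mat n n" "pos_semidef T"
    and DT: "pos_def (D - T)"
  shows "\<exists>P x. P \<in> carrier_mat n n \<and> mat_adjoint P * (D * P) = 1\<^sub>m n \<and>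
    mat_adjoint P * (T * P) = mat_diag n (\<lambda>j. complex_of_real (x j)) \<and>
    (\<forall>j<n. 0 \<le> x j \<and> x j < 1) \<and> (T = 0\<^sub>m n n \<longleftrightarrow> (\<forall>j<n. x j = 0)) \<and>
    det (D - T) = det D * complex_of_real (\<Prod>j<n. 1 - x j)"
proof -
  obtain P x where P: "P \<in> carrier_mat n n" "det P \<noteq> 0" "mat_adjoint P * (D * P) = 1\<^sub>m n"
    and x: "mat_adjoint P * (T * P) = mat_diag n (\<lambda>j. complex_of_real (x j))"
      "\<forall>j<n. 0 \<le> x j" "T = 0\<^sub>m n n \<longleftrightarrow> (\<forall>j<n. x j = 0)"
      "\<forall>c. det (D + complex_of_real c \<cdot>\<^sub>m T) = det D * complex_of_real (\<Prod>j<n. 1 + c * x j)"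
    using pos_semidef_spectrum[OF D T] by blast
  note det = x(4)[rule_format, of "-1"]
  have DT': "D - T \<in> carrier_mat n n" using T(1) by (rule minus_carrier_mat)
  have "x j < 1" if j: "j < n" for j
  proof -
    have "mat_adjoint P * ((D - T) * P) = mat_diag n (\<lambda>j. complex_of_real (1 - x j))"
      unfolding congruence_minus[OF D(1) T(1) P(1)] P x
      by (rule eq_matI) (auto simp: mat_diag_def)
    then have "complex_of_real (1 - x j) = ((D - T) *\<^sub>v col P j) \<bullet>c col P j"
      using index_mat_diag_congruence[OF DT' P(1) _ j] by simp
    \<comment> \<open>A zero column would contradict the unit diagonal of the congruence of
      \<open>D\<close>.\<close>
    moreover have "col P j \<noteq> 0\<^sub>v n"
    proof
      assume 0: "col P j = 0\<^sub>v n"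
      have "(mat_adjoint P * (D * P)) $$ (j, j) = 0"
        using index_congruence[OF D(1) P(1) P(1) j j] 0 D by (simp add: scalar_prod_def)
      then show False using P j by simp
    qed
    ultimately have "0 < complex_of_real (1 - x j)"
      using pos_def_dest(2)[OF DT DT', of "col P j"] P j by (metis carrier_matD(1) col_dim carrier_vec_dim_vec)
    then show ?thesis by (simp add: less_complex_def)
  qed
  moreover have "D + complex_of_real (-1) \<cdot>\<^sub>m T = D - T"
    using D T by (intro eq_matI) auto
  ultimately show ?thesis using P x det by (intro exI[of _ P] exI[of _ x]) simp
qed

text \<open>Division by \<open>\<Delta>\<close>, the determinant of the Kronecker product of the
  \<open>D p\<close>, turns the determinant of the difference into \<open>a\<close> and
  \<open>\<beta>\<close> into \<open>b\<close>, the two sides of the inequality for independent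
  events indexed by joint coordinates. Equality fails exactly when there is room for a mixed
  outcome: at least two factors, no \<open>T p\<close> zero, and some
  \<open>d q \<ge> 2\<close>.\<close>

lemma det_kron_prod_diff:
  fixes D T :: "nat \<Rightarrow> complex mat" and m :: nat and d :: "nat \<Rightarrow> nat"
  assumes m: "1 \<le> m" and d: "\<And>p. p \<in> {1..m} \<Longrightarrow> 1 \<le> d p"
    and D: "\<And>p. p \<in> {1..m} \<Longrightarrow> D p \<in> carrier_mat (d p) (d p)" "\<And>p. p \<in> {1..m} \<Longrightarrow> pos_def (D p)"
    and T: "\<And>p. p \<in> {1..m} \<Longrightarrow> T p \<in> carrier_mat (d p) (d p)" "\<And>p. p \<in> {1..m} \<Longrightarrow> pos_semidef (T p)"
    and DT: "\<And>p. p \<in> {1..m} \<Longrightarrow> pos_def (D p - T p)"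
  defines "\<sigma> \<equiv> \<lambda>p. (\<Prod>q\<in>{1..m}. d q) div d p"
  defines "\<beta> \<equiv> (\<Prod>p\<in>{1..m}. det (D p) ^ \<sigma> p)
      - (\<Prod>p\<in>{1..m}. det (D p) ^ \<sigma> p - det (D p - T p) ^ \<sigma> p)"
  shows "pos_def (kron_prod m D - kron_prod m T)"
    and "\<beta> \<le> det (kron_prod m D - kron_prod m T)"
    and "\<beta> = det (kron_prod m D - kron_prod m T) \<longleftrightarrow>
      m = 1 \<or> (\<exists>p\<in>{1..m}. T p = 0\<^sub>m (d p) (d p)) \<or> (\<forall>p\<in>{1..m}. d p = 1)"
proof -
  let ?I = "{1..m}"
  define N where "N = (\<Prod>q\<in>?I. d q)"
  let ?S = "\<lambda>p P x. P \<in> carrier_mat (d p) (d p) \<and> mat_adjoint P * (D p * P) = 1\<^sub>m (d p) \<and>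
    mat_adjoint P * (T p * P) = mat_diag (d p) (\<lambda>j. complex_of_real (x j)) \<and>
    (\<forall>j<d p. 0 \<le> x j \<and> x j < 1) \<and> (T p = 0\<^sub>m (d p) (d p) \<longleftrightarrow> (\<forall>j<d p. x j = 0)) \<and>
    det (D p - T p) = det (D p) * complex_of_real (\<Prod>j<d p. 1 - x j)"
  have "\<forall>p\<in>?I. \<exists>P x. ?S p P x"
    by (intro ballI pos_def_diff_spectrum D T DT)
  from bchoice[OF this] obtain P where "\<forall>p\<in>?I. \<exists>x. ?S p (P p) x" by blast
  from bchoice[OF this] obtain x where S: "\<forall>p\<in>?I. ?S p (P p) (x p)" by blast
  then have P: "\<And>p. p \<in> ?I \<Longrightarrow> P p \<in> carrier_mat (d p) (d p)"
      "\<And>p. p \<in> ?I \<Longrightarrow> mat_adjoint (P p) * (D p * P p) = 1\<^sub>m (d p)"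
    and x: "\<And>p. p \<in> ?I \<Longrightarrow> mat_adjoint (P p) * (T p * P p)
        = mat_diag (d p) (\<lambda>j. complex_of_real (x p j))"
      "\<And>p j. p \<in> ?I \<Longrightarrow> j < d p \<Longrightarrow> 0 \<le> x p j \<and> x p j < 1"
      "\<And>p. p \<in> ?I \<Longrightarrow> T p = 0\<^sub>m (d p) (d p) \<longleftrightarrow> (\<forall>j<d p. x p j = 0)"
      "\<And>p. p \<in> ?I \<Longrightarrow> det (D p - T p) = det (D p) * complex_of_real (\<Prod>j<d p. 1 - x p j)"
    by blast+
  \<comment> \<open>The eigenvalue contributed by factor \<open>p\<close> at the joint index
    \<open>r\<close>.\<close>
  define u where "u p r = x p (digits d m r p)" for p r
  have u: "0 \<le> u p r \<and> u p r < 1" if "p \<in> ?I" "r < N" for p r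
    using x(2) digits_less[of r d m p] that by (simp add: u_def N_def)
  \<comment> \<open>An empty product would be 1, so this rests on \<open>1 \<le> m\<close>. It makes
    the diagonalized difference positive definite.\<close>
  have u_less: "(\<Prod>p\<in>?I. u p r) < 1" if r: "r < N" for r
  proof -
    have "(\<Prod>p\<in>?I. u p r) = u 1 r * (\<Prod>p\<in>?I - {1}. u p r)"
      using m by (intro prod.remove) auto
    also have "\<dots> \<le> u 1 r * 1"
      using u m r by (intro mult_left_mono prod_le_1) (auto intro: less_imp_le)
    also have "\<dots> < 1" using u[of 1 r] m r by simp
    finally show ?thesis .
  qed
  define Q where "Q = kron_prod m P"
  define KD where "KD = kron_prod m D"
  define KT where "KT = kron_prod m T"
  have Q: "Q \<in> carrier_mat N N" unfolding Q_def N_def by (rule kron_prod_carrier[OF P(1)])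
  have KD: "KD \<in> carrier_mat N N" unfolding KD_def N_def by (rule kron_prod_carrier[OF D(1)])
  have KT: "KT \<in> carrier_mat N N" unfolding KT_def N_def by (rule kron_prod_carrier[OF T(1)])
  have QD: "mat_adjoint Q * (KD * Q) = 1\<^sub>m N"
  proof -
    have "mat_adjoint Q * (KD * Q) = kron_prod m (\<lambda>p. mat_adjoint (P p) * (D p * P p))"
      unfolding Q_def KD_def by (rule kron_prod_congruence[OF D(1) P(1)])
    also have "\<dots> = kron_prod m (\<lambda>p. 1\<^sub>m (d p))" using P by (intro kron_prod_cong) auto
    finally show ?thesis by (simp add: kron_prod_one N_def)
  qed
  have QT: "mat_adjoint Q * (KT * Q) = mat_diag N (\<lambda>r. complex_of_real (\<Prod>p\<in>?I. u p r))"
  proof -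
    have "mat_adjoint Q * (KT * Q) = kron_prod m (\<lambda>p. mat_adjoint (P p) * (T p * P p))"
      unfolding Q_def KT_def by (rule kron_prod_congruence[OF T(1) P(1)])
    also have "\<dots> = kron_prod m (\<lambda>p. mat_diag (d p) (\<lambda>j. complex_of_real (x p j)))"
      using x by (intro kron_prod_cong) auto
    finally show ?thesis by (simp add: kron_prod_diag N_def u_def)
  qed
  have Qdiff: "mat_adjoint Q * ((KD - KT) * Q)
      = mat_diag N (\<lambda>r. complex_of_real (1 - (\<Prod>p\<in>?I. u p r)))"
    unfolding congruence_minus[OF KD KT Q] QD QT by (rule eq_matI) (auto simp: mat_diag_def)
  have detQ: "det KD * complex_of_real ((cmod (det Q))\<^sup>2) = 1"
    using det_congruence[OF KD Q] QD by simp
  then have "det Q \<noteq> 0" by auto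
  then show "pos_def (kron_prod m D - kron_prod m T)"
    unfolding KD_def[symmetric] KT_def[symmetric]
  proof (rule pos_def_of_congruence[rotated 2])
    show "pos_def (mat_adjoint Q * ((KD - KT) * Q))"
      unfolding Qdiff using u_less by (intro pos_def_mat_diag) simp
  qed (use KT Q in auto)
  have detdiff: "det (KD - KT) = det KD * complex_of_real (\<Prod>r<N. 1 - (\<Prod>p\<in>?I. u p r))"
  proof -
    have "det (KD - KT) * complex_of_real ((cmod (det Q))\<^sup>2)
      = complex_of_real (\<Prod>r<N. 1 - (\<Prod>p\<in>?I. u p r))"
      using det_congruence[OF minus_carrier_mat[OF KT] Q, of KD] Qdiff by (simp add: det_mat_diag)
    then have "det KD * (det (KD - KT) * complex_of_real ((cmod (det Q))\<^sup>2))
      = det KD * complex_of_real (\<Prod>r<N. 1 - (\<Prod>p\<in>?I. u p r))" by simp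
    moreover have "det KD * (det (KD - KT) * complex_of_real ((cmod (det Q))\<^sup>2))
        = det (KD - KT) * (det KD * complex_of_real ((cmod (det Q))\<^sup>2))" by (simp only: mult_ac)
    ultimately show ?thesis unfolding detQ mult_1_right by (rule trans[OF sym, rotated])
  qed
  define \<delta> where "\<delta> p = Re (det (D p)) ^ \<sigma> p" for p
  have \<delta>: "det (D p) ^ \<sigma> p = complex_of_real (\<delta> p)" "0 < \<delta> p" if "p \<in> ?I" for p
    using pos_def_det_pos[OF D(1,2)[OF that]] by (auto simp: \<delta>_def)
  have detKD: "det KD = complex_of_real (\<Prod>p\<in>?I. \<delta> p)"
  proof -
    have "det KD = (\<Prod>p\<in>?I. det (D p) ^ \<sigma> p)"
      unfolding KD_def \<sigma>_def using D d by (intro det_kron_prod_pos_def) (auto simp: Suc_le_eq)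
    then show ?thesis using \<delta> by simp
  qed
  define \<Delta> where "\<Delta> = (\<Prod>p\<in>?I. \<delta> p)"
  have \<Delta>: "0 < \<Delta>" unfolding \<Delta>_def using \<delta> by (intro prod_pos) auto
  have diff: "det (D p) ^ \<sigma> p - det (D p - T p) ^ \<sigma> p
      = complex_of_real (\<delta> p * (1 - (\<Prod>r<N. 1 - u p r)))" if p: "p \<in> ?I" for p
  proof -
    \<comment> \<open>Each \<open>x p j\<close> occurs \<open>\<sigma> p\<close> times among the
      \<open>u p r\<close>, so the power of the determinant quotient becomes a product over joint
      indices.\<close>
    have "(\<Prod>r<N. 1 - u p r) = (\<Prod>j<d p. 1 - x p j) ^ \<sigma> p"
      unfolding u_def N_def \<sigma>_def
      using prod_digits[of m d p "\<lambda>j. 1 - x p j"] d p by (simp add: Suc_le_eq)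
    then show ?thesis unfolding x(4)[OF p] power_mult_distrib \<delta>(1)[OF p]
      by (simp add: algebra_simps)
  qed
  define a b where "a = (\<Prod>r<N. 1 - (\<Prod>p\<in>?I. u p r))"
    and "b = 1 - (\<Prod>p\<in>?I. 1 - (\<Prod>r<N. 1 - u p r))"
  have \<beta>: "\<beta> = complex_of_real (\<Delta> * b)"
  proof -
    have "(\<Prod>p\<in>?I. det (D p) ^ \<sigma> p) = complex_of_real \<Delta>" unfolding \<Delta>_def using \<delta> by simp
    moreover have "(\<Prod>p\<in>?I. det (D p) ^ \<sigma> p - det (D p - T p) ^ \<sigma> p)
      = complex_of_real (\<Delta> * (\<Prod>p\<in>?I. 1 - (\<Prod>r<N. 1 - u p r)))"
      unfolding \<Delta>_def using diff by (simp add: prod.distrib)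
    ultimately show ?thesis unfolding \<beta>_def b_def by (simp add: algebra_simps)
  qed
  have \<alpha>: "det (kron_prod m D - kron_prod m T) = complex_of_real (\<Delta> * a)"
    using detdiff unfolding KD_def[symmetric] KT_def[symmetric] detKD \<Delta>_def[symmetric] a_def
    by simp
  have "b \<le> a" unfolding a_def b_def using u m
    by (intro prod_complement_bound) (auto intro: less_imp_le)
  then show "\<beta> \<le> det (kron_prod m D - kron_prod m T)"
    unfolding \<alpha> \<beta> using \<Delta> by (simp add: less_eq_complex_def)
  have "b = a \<longleftrightarrow> m = 1 \<or> (\<exists>p\<in>?I. T p = 0\<^sub>m (d p) (d p)) \<or> (\<forall>p\<in>?I. d p = 1)"
  proof
    assume "m = 1 \<or> (\<exists>p\<in>?I. T p = 0\<^sub>m (d p) (d p)) \<or> (\<forall>p\<in>?I. d p = 1)"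
    then consider "m = 1" | p where "p \<in> ?I" "T p = 0\<^sub>m (d p) (d p)" | "\<forall>p\<in>?I. d p = 1" by blast
    \<comment> \<open>With one factor, or with a single joint index, \<open>a\<close> and
      \<open>b\<close> reduce to the same expression; a vanishing \<open>T p\<close> makes both
      equal to 1.\<close>
    then show "b = a"
    proof cases
      case 1
      then show ?thesis by (simp add: a_def b_def)
    next
      case 2
      then have "\<And>r. r < N \<Longrightarrow> u p r = 0"
        using x(3) digits_less[of _ d m p] by (simp add: u_def N_def)
      then have 0: "\<And>r. r < N \<Longrightarrow> (\<Prod>p\<in>?I. u p r) = 0" "(\<Prod>r<N. 1 - u p r) = 1"
        using 2(1) by (auto intro!: prod_zero bexI[of _ p])
      have a1: "a = 1" unfolding a_def by (intro prod.neutral ballI) (simp only: 0(1) lessThan_iff diff_zero)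
      have "(\<Prod>p\<in>?I. 1 - (\<Prod>r<N. 1 - u p r)) = 0"
        using 2(1) 0(2) by (intro prod_zero bexI[of _ p]) simp_all
      then show ?thesis using a1 by (simp add: b_def)
    next
      case 3
      then have "N = 1" by (simp add: N_def)
      then show ?thesis by (simp add: a_def b_def)
    qed
  next
    assume "b = a"
    show "m = 1 \<or> (\<exists>p\<in>?I. T p = 0\<^sub>m (d p) (d p)) \<or> (\<forall>p\<in>?I. d p = 1)"
    proof (rule ccontr)
      assume neg: "\<not> ?thesis"
      then obtain q where q: "q \<in> ?I" "d q \<noteq> 1" by blast
      then have dq: "2 \<le> d q" using d[of q] by linarith
      have "\<forall>p\<in>?I. \<exists>j. j < d p \<and> x p j \<noteq> 0" using neg x(3) by blast
      then obtain y where y: "\<And>p. p \<in> ?I \<Longrightarrow> y p < d p \<and> x p (y p) \<noteq> 0" by metis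
      have xy: "0 < x p (y p)" if "p \<in> ?I" for p using y[OF that] x(2)[OF that, of "y p"] by force
      \<comment> \<open>\<open>y\<close> picks a non-zero eigenvalue in every factor;
        \<open>z\<close> moves only its coordinate \<open>q\<close>, which is possible because
        \<open>d q\<close> is at least 2. The joint index of \<open>y\<close> plays the role of
        \<open>j0\<close>, where factor \<open>q\<close> must be positive, and that of
        \<open>z\<close> the role of \<open>j1\<close>, where all other factors must be.\<close>
      define z where "z = y(q := if y q = 0 then 1 else 0)"
      have z: "z p < d p" if "p \<in> ?I" for p using y[OF that] dq by (auto simp: z_def)
      have zq: "z q \<noteq> y q" by (simp add: z_def)
      have dy: "digits d m (undigits d m y) p = y p" if "p \<in> ?I" for p
        using y that by (intro digits_undigits) auto
      have dz: "digits d m (undigits d m z) p = z p" if "p \<in> ?I" for p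
        using z that by (intro digits_undigits) auto
      have "undigits d m y < N" "undigits d m z < N"
        unfolding N_def using y z by (blast intro: undigits_less)+
      moreover have "undigits d m y \<noteq> undigits d m z" using dy[OF q(1)] dz[OF q(1)] zq by metis
      moreover have "0 < u q (undigits d m y)" using xy dy q by (simp add: u_def)
      moreover have "0 < u p (undigits d m z)" if "p \<in> ?I - {q}" for p
        using xy[of p] dz[of p] that by (simp add: u_def z_def)
      moreover have "?I - {q} \<noteq> {}"
      proof -
        have "card (?I - {q}) = m - 1" using q(1) by simp
        then show ?thesis using neg m by (metis One_nat_def card.empty diff_is_0_eq le_antisym)
      qed
      ultimately have "b < a" unfolding a_def b_def using u q(1)
        by (intro prod_complement_bound_strict[of _ _ _ q "undigits d m y" "undigits d m z"]) auto
      then show False using \<open>b = a\<close> by simp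
    qed
  qed
  then show "\<beta> = det (kron_prod m D - kron_prod m T) \<longleftrightarrow>
      m = 1 \<or> (\<exists>p\<in>{1..m}. T p = 0\<^sub>m (d p) (d p)) \<or> (\<forall>p\<in>{1..m}. d p = 1)"
    unfolding \<alpha> \<beta> of_real_eq_iff using \<Delta> by simp
qed

section \<open>Principal submatrices and Schur complements\<close>

text \<open>The columns are the unit vectors at the selected positions. A principal submatrix
  thereby becomes a congruence, to which the positivity results for congruences apply.\<close>

definition sel_mat :: "nat \<Rightarrow> nat \<Rightarrow> (nat \<Rightarrow> nat) \<Rightarrow> complex mat" where
  "sel_mat n k f = mat n k (\<lambda>(a, b). if a = f b then 1 else 0)"

lemma sel_mat_carrier [simp]: "sel_mat n k f \<in> carrier_mat n k"
  by (simp add: sel_mat_def)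

lemma sel_mat_dims [simp]: "dim_row (sel_mat n k f) = n" "dim_col (sel_mat n k f) = k"
  by (simp_all add: sel_mat_def)

lemma mat_adjoint_sel_mat_mult:
  assumes "X \<in> carrier_mat n c" "f ` {..<k} \<subseteq> {..<n}"
  shows "mat_adjoint (sel_mat n k f) * X = mat k c (\<lambda>(a, b). X $$ (f a, b))"
proof (rule eq_matI)
  fix a b assume "a < dim_row (mat k c (\<lambda>(a, b). X $$ (f a, b)))"
    "b < dim_col (mat k c (\<lambda>(a, b). X $$ (f a, b)))"
  then have ab: "a < k" "b < c" by auto
  have "(mat_adjoint (sel_mat n k f) * X) $$ (a, b)
    = (\<Sum>r\<in>{0..<n}. cnj (sel_mat n k f $$ (r, a)) * X $$ (r, b))"
    using ab assms by (simp add: scalar_prod_def)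
  also have "\<dots> = (\<Sum>r\<in>{f a}. cnj (sel_mat n k f $$ (r, a)) * X $$ (r, b))"
    using ab assms by (intro sum.mono_neutral_right) (auto simp: sel_mat_def)
  also have "\<dots> = X $$ (f a, b)" using ab assms by (auto simp: sel_mat_def)
  finally show "(mat_adjoint (sel_mat n k f) * X) $$ (a, b)
    = mat k c (\<lambda>(a, b). X $$ (f a, b)) $$ (a, b)" using ab by simp
qed (use assms in auto)

lemma mult_sel_mat:
  assumes "X \<in> carrier_mat c n" "f ` {..<k} \<subseteq> {..<n}"
  shows "X * sel_mat n k f = mat c k (\<lambda>(a, b). X $$ (a, f b))"
proof (rule eq_matI)
  fix a b assume "a < dim_row (mat c k (\<lambda>(a, b). X $$ (a, f b)))"
    "b < dim_col (mat c k (\<lambda>(a, b). X $$ (a, f b)))"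
  then have ab: "a < c" "b < k" by auto
  have "(X * sel_mat n k f) $$ (a, b) = (\<Sum>r\<in>{0..<n}. X $$ (a, r) * sel_mat n k f $$ (r, b))"
    using ab assms by (simp add: scalar_prod_def)
  also have "\<dots> = (\<Sum>r\<in>{f b}. X $$ (a, r) * sel_mat n k f $$ (r, b))"
    using ab assms by (intro sum.mono_neutral_right) (auto simp: sel_mat_def)
  also have "\<dots> = X $$ (a, f b)" using ab assms by (auto simp: sel_mat_def)
  finally show "(X * sel_mat n k f) $$ (a, b) = mat c k (\<lambda>(a, b). X $$ (a, f b)) $$ (a, b)"
    using ab by simp
qed (use assms in auto)

lemma sel_mat_mult:
  assumes "V \<in> carrier_mat k c" "inj_on f {..<k}" "a < n" "b < c"
  shows "j < k \<Longrightarrow> a = f j \<Longrightarrow> (sel_mat n k f * V) $$ (a, b) = V $$ (j, b)"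
    and "a \<notin> f ` {..<k} \<Longrightarrow> (sel_mat n k f * V) $$ (a, b) = 0"
proof -
  have eq: "(sel_mat n k f * V) $$ (a, b) = (\<Sum>r\<in>{0..<k}. sel_mat n k f $$ (a, r) * V $$ (r, b))"
    using assms by (simp add: scalar_prod_def)
  show "(sel_mat n k f * V) $$ (a, b) = 0" if "a \<notin> f ` {..<k}"
    unfolding eq using that assms by (intro sum.neutral) (auto simp: sel_mat_def)
  show "(sel_mat n k f * V) $$ (a, b) = V $$ (j, b)" if j: "j < k" "a = f j"
  proof -
    have "(\<Sum>r\<in>{0..<k}. sel_mat n k f $$ (a, r) * V $$ (r, b))
      = (\<Sum>r\<in>{j}. sel_mat n k f $$ (a, r) * V $$ (r, b))"
      using j assms by (intro sum.mono_neutral_right) (auto simp: sel_mat_def inj_on_def)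
    also have "\<dots> = V $$ (j, b)" using j assms by (simp add: sel_mat_def)
    finally show ?thesis using eq by simp
  qed
qed

lemma sel_mat_congruence:
  assumes "M \<in> carrier_mat n n" "f ` {..<k} \<subseteq> {..<n}"
  shows "mat_adjoint (sel_mat n k f) * (M * sel_mat n k f) = mat k k (\<lambda>(a, b). M $$ (f a, f b))"
proof -
  have "mat_adjoint (sel_mat n k f) * (M * sel_mat n k f)
    = mat k k (\<lambda>(a, b). (M * sel_mat n k f) $$ (f a, b))"
    using assms by (intro mat_adjoint_sel_mat_mult mult_carrier_mat) auto
  also have "\<dots> = mat k k (\<lambda>(a, b). M $$ (f a, f b))"
    unfolding mult_sel_mat[OF assms] using assms(2) by (intro eq_matI) auto
  finally show ?thesis .
qed

text \<open>Injectivity of \<open>f\<close> makes the selected unit vectors linearly independent, so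
  the selection is an injective congruence.\<close>

lemma pos_def_submatrix:
  assumes M: "M \<in> carrier_mat n n" "pos_def M" and f: "f ` {..<k} \<subseteq> {..<n}" "inj_on f {..<k}"
  shows "pos_def (mat k k (\<lambda>(a, b). M $$ (f a, f b)))"
  unfolding sel_mat_congruence[OF M(1) f(1), symmetric]
proof (rule pos_def_congruence[OF M sel_mat_carrier])
  fix v :: "complex vec" assume v: "v \<in> carrier_vec k" "sel_mat n k f *\<^sub>v v = 0\<^sub>v n"
  show "v = 0\<^sub>v k"
  proof (rule eq_vecI)
    fix j assume "j < dim_vec (0\<^sub>v k :: complex vec)"
    then have j: "j < k" by simp
    then have fj: "f j < n" using f by auto
    have "0 = (sel_mat n k f *\<^sub>v v) $ f j" using v fj by simp
    also have "\<dots> = (\<Sum>r\<in>{0..<k}. sel_mat n k f $$ (f j, r) * v $ r)"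
      using v(1) fj by (simp add: scalar_prod_def)
    also have "\<dots> = (\<Sum>r\<in>{j}. sel_mat n k f $$ (f j, r) * v $ r)"
      using j fj f by (intro sum.mono_neutral_right) (auto simp: sel_mat_def inj_on_def)
    finally show "v $ j = 0\<^sub>v k $ j" using j fj by (simp add: sel_mat_def)
  qed (use v in simp)
qed

text \<open>Congruence by the unit triangular \<open>U\<close> eliminates \<open>b\<close> and
  leaves the direct sum of \<open>C\<close> and the Schur complement. The complement is written in
  Gram form through a solution \<open>v\<close> of \<open>C * v = b\<close>: Gram matrices multiply
  under Kronecker products, and solutions can be compared by uniqueness.\<close>

lemma schur_complement:
  assumes C: "C \<in> carrier_mat k k" and b: "b \<in> carrier_mat k n" and D: "D \<in> carrier_mat n n"
    and L: "pos_def (four_block_mat C b (mat_adjoint b) D)" (is "pos_def ?L")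
  shows "pos_def C" "pos_def D"
    "\<exists>v \<in> carrier_mat k n. C * v = b \<and> pos_def (D - mat_adjoint v * (C * v)) \<and>
      det ?L = det C * det (D - mat_adjoint v * (C * v))"
proof -
  have Lc: "?L \<in> carrier_mat (k + n) (k + n)" using C D by simp
  have "mat k k (\<lambda>(i, j). ?L $$ (id i, id j)) = C" using C D by (intro eq_matI) auto
  then show C_pos: "pos_def C" using pos_def_submatrix[OF Lc L, of id k] by auto
  have shift: "(\<lambda>i. k + i) ` {..<n} \<subseteq> {..<k + n}" "inj_on (\<lambda>i. k + i) {..<n}"
    by (auto simp: inj_on_def)
  have "mat n n (\<lambda>(i, j). ?L $$ (k + i, k + j)) = D" using C D by (intro eq_matI) auto
  then show "pos_def D" using pos_def_submatrix[OF Lc L shift] by simp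
  obtain Ci where Ci: "Ci \<in> carrier_mat k k" "C * Ci = 1\<^sub>m k"
    using det_nonzero_inverse[OF C pos_def_det_nonzero[OF C C_pos]] by metis
  define v where "v = Ci * b"
  have v: "v \<in> carrier_mat k n" using Ci b by (simp add: v_def)
  have Cv: "C * v = b"
    using C Ci b mult_mat_assoc_dim[of C Ci b] by (simp add: v_def)
  define S where "S = D - mat_adjoint v * (C * v)"
  have S: "S \<in> carrier_mat n n" unfolding S_def using C v by (intro minus_carrier_mat) auto
  define U where "U = four_block_mat (1\<^sub>m k) (- v) (0\<^sub>m n k) (1\<^sub>m n)"
  have U: "U \<in> carrier_mat (k + n) (k + n)" unfolding U_def by (intro four_block_carrier_mat) auto
  have C_herm: "mat_adjoint C = C" using pos_def_dest(1)[OF C_pos C] .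
  have vC: "mat_adjoint v * C = mat_adjoint b"
    unfolding Cv[symmetric] using C v C_herm by (simp add: mat_adjoint_mult)
  have "mat_adjoint b * - v = - (mat_adjoint v * (C * v))"
    unfolding vC[symmetric] using C v by (simp add: mult_mat_assoc_dim uminus_mult_right_mat)
  then have low: "mat_adjoint b * - v + D = S"
    unfolding S_def using C v D by (intro eq_matI) auto
  have "?L * U = four_block_mat (C * 1\<^sub>m k + b * 0\<^sub>m n k) (C * - v + b * 1\<^sub>m n)
      (mat_adjoint b * 1\<^sub>m k + D * 0\<^sub>m n k) (mat_adjoint b * - v + D * 1\<^sub>m n)"
    unfolding U_def using C b D v by (intro mult_four_block_mat) auto
  moreover have "C * 1\<^sub>m k + b * 0\<^sub>m n k = C" using C b by simp
  moreover have "C * - v + b * 1\<^sub>m n = 0\<^sub>m k n"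
    using C b v Cv by (simp add: uminus_mult_right_mat)
  moreover have "mat_adjoint b * 1\<^sub>m k + D * 0\<^sub>m n k = mat_adjoint b" using b D by simp
  moreover have "mat_adjoint b * - v + D * 1\<^sub>m n = S" using D low by simp
  ultimately have LU: "?L * U = four_block_mat C (0\<^sub>m k n) (mat_adjoint b) S" by simp
  have U_adj: "mat_adjoint U = four_block_mat (1\<^sub>m k) (0\<^sub>m k n) (- mat_adjoint v) (1\<^sub>m n)"
    unfolding U_def using v by (intro eq_matI) auto
  have "mat_adjoint U * (?L * U) = four_block_mat (1\<^sub>m k * C + 0\<^sub>m k n * mat_adjoint b)
      (1\<^sub>m k * 0\<^sub>m k n + 0\<^sub>m k n * S) (- mat_adjoint v * C + 1\<^sub>m n * mat_adjoint b)
      (- mat_adjoint v * 0\<^sub>m k n + 1\<^sub>m n * S)"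
    unfolding LU U_adj using C b v S by (intro mult_four_block_mat) auto
  moreover have "1\<^sub>m k * C + 0\<^sub>m k n * mat_adjoint b = C" using C b by simp
  moreover have "1\<^sub>m k * 0\<^sub>m k n + 0\<^sub>m k n * S = 0\<^sub>m k n" using S by simp
  moreover have "- mat_adjoint v * C + 1\<^sub>m n * mat_adjoint b = 0\<^sub>m n k"
    using C b v vC by (simp add: uminus_mult_left_mat)
  moreover have "- mat_adjoint v * 0\<^sub>m k n + 1\<^sub>m n * S = S" using v S by simp
  ultimately have ULU: "mat_adjoint U * (?L * U) = four_block_mat C (0\<^sub>m k n) (0\<^sub>m n k) S" by simp
  have detU: "det U = 1" unfolding U_def
    using v det_four_block_mat_lower_left_zero[of "1\<^sub>m k" k "- v" n "0\<^sub>m n k" "1\<^sub>m n"] by simp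
  have "pos_def (mat_adjoint U * (?L * U))"
  proof (rule pos_def_congruence[OF Lc L U])
    fix y assume y: "y \<in> carrier_vec (k + n)" "U *\<^sub>v y = 0\<^sub>v (k + n)"
    then show "y = 0\<^sub>v (k + n)" using det_0_iff_vec_prod_zero[OF U] detU by auto
  qed
  then have "pos_def (four_block_mat C (0\<^sub>m k n) (0\<^sub>m n k) S)" unfolding ULU .
  moreover have "mat n n (\<lambda>(i, j). four_block_mat C (0\<^sub>m k n) (0\<^sub>m n k) S $$ (k + i, k + j)) = S"
    using C S by (intro eq_matI) auto
  ultimately have "pos_def S"
    using pos_def_submatrix[OF _ _ shift, of "four_block_mat C (0\<^sub>m k n) (0\<^sub>m n k) S"] C S
    by simp
  \<comment> \<open>Elimination from one side already gives a block triangular matrix with the same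
    determinant.\<close>
  moreover have "det ?L = det C * det S"
    using det_mult[OF Lc U] detU LU det_four_block_mat_upper_right_zero[OF C refl _ S, of "mat_adjoint b"] b
    by simp
  ultimately show "\<exists>v \<in> carrier_mat k n. C * v = b \<and> pos_def (D - mat_adjoint v * (C * v)) \<and>
      det ?L = det C * det (D - mat_adjoint v * (C * v))"
    using v Cv unfolding S_def by (intro bexI[of _ v]) auto
qed

text \<open>Here \<open>V\<close> is the best approximation of \<open>W\<close> in the inner product of \<open>M\<close> among the matrices
  whose rows outside the range of \<open>f\<close> vanish; passing to a principal submatrix loses exactly the
  Gram matrix of the error.\<close>

lemma submatrix_projection:
  assumes M: "M \<in> carrier_mat n n" "pos_def M" and W: "W \<in> carrier_mat n c"
    and f: "f ` {..<k} \<subseteq> {..<n}" "inj_on f {..<k}"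
  defines "G \<equiv> mat k k (\<lambda>(a, b). M $$ (f a, f b))"
  assumes V: "V \<in> carrier_mat k c" "G * V = mat k c (\<lambda>(a, b). (M * W) $$ (f a, b))"
  shows "\<exists>R \<in> carrier_mat c c. pos_semidef R \<and>
    mat_adjoint V * (G * V) = mat_adjoint W * (M * W) - R \<and>
    (R = 0\<^sub>m c c \<longleftrightarrow> (\<forall>a<n. \<forall>b<c. a \<notin> f ` {..<k} \<longrightarrow> W $$ (a, b) = 0))"
proof -
  define E where "E = sel_mat n k f"
  have E: "E \<in> carrier_mat n k" by (simp add: E_def)
  have G: "G \<in> carrier_mat k k" by (simp add: G_def)
  have EME: "mat_adjoint E * (M * E) = G"
    unfolding E_def G_def by (rule sel_mat_congruence[OF M(1) f(1)])
  have EMW: "mat_adjoint E * (M * W) = G * V"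
    unfolding E_def V(2) using M W f by (intro mat_adjoint_sel_mat_mult) auto
  have M_herm: "mat_adjoint M = M" using pos_def_dest(1)[OF M(2,1)] .
  have G_pos: "pos_def G" unfolding G_def by (rule pos_def_submatrix[OF M f])
  have G_herm: "mat_adjoint G = G" using pos_def_dest(1)[OF G_pos G] .
  define Y where "Y = W - E * V"
  have Y: "Y \<in> carrier_mat n c" unfolding Y_def using E V by (intro minus_carrier_mat) auto
  define R where "R = mat_adjoint Y * (M * Y)"
  have R: "R \<in> carrier_mat c c" using M Y by (auto simp: R_def intro: carrier_matI)
  have EMEV: "mat_adjoint E * (M * (E * V)) = G * V"
    unfolding EME[symmetric] using E M V by (simp add: mult_mat_assoc_dim)
  have WMEV: "mat_adjoint W * (M * (E * V)) = mat_adjoint V * (G * V)"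
  proof -
    have "mat_adjoint W * (M * (E * V)) = mat_adjoint (mat_adjoint E * (M * W)) * V"
      using E M W V(1) M_herm by (simp add: mat_adjoint_mult mult_mat_assoc_dim)
    also have "\<dots> = mat_adjoint V * (G * V)"
      unfolding EMW using G V(1) G_herm by (simp add: mat_adjoint_mult mult_mat_assoc_dim)
    finally show ?thesis .
  qed
  have MY: "M * Y = M * W - M * (E * V)"
    unfolding Y_def using M W E V by (intro mult_minus_distrib_mat) auto
  \<comment> \<open>Normal equations: the residual \<open>Y\<close> is orthogonal, in the inner
    product of \<open>M\<close>, to all matrices supported on the range of \<open>f\<close>. As in
    Pythagoras, \<open>R\<close> becomes the difference of the two Gram matrices.\<close>
  have EMY: "mat_adjoint E * (M * Y) = 0\<^sub>m k c"
  proof -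
    have "mat_adjoint E * (M * Y) = mat_adjoint E * (M * W) - mat_adjoint E * (M * (E * V))"
      unfolding MY using M W E V by (intro mult_minus_distrib_mat) auto
    then show ?thesis unfolding EMW EMEV using G V by (auto intro!: eq_matI)
  qed
  have "R = (mat_adjoint W - mat_adjoint V * mat_adjoint E) * (M * Y)"
    unfolding R_def Y_def using W E V by (simp add: mat_adjoint_minus mat_adjoint_mult)
  also have "\<dots> = mat_adjoint W * (M * Y) - mat_adjoint V * mat_adjoint E * (M * Y)"
    using W E V M Y by (intro minus_mult_distrib_mat) auto
  also have "mat_adjoint V * mat_adjoint E * (M * Y) = mat_adjoint V * (mat_adjoint E * (M * Y))"
    using W E V M Y by (simp add: mult_mat_assoc_dim)
  also have "\<dots> = 0\<^sub>m c c" unfolding EMY using V by simp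
  also have "mat_adjoint W * (M * Y) = mat_adjoint W * (M * W) - mat_adjoint W * (M * (E * V))"
    unfolding MY using M W E V by (intro mult_minus_distrib_mat) auto
  finally have R_eq: "R = mat_adjoint W * (M * W) - mat_adjoint V * (G * V) - 0\<^sub>m c c"
    unfolding WMEV .
  have "mat_adjoint V * (G * V) = mat_adjoint W * (M * W) - R"
    unfolding R_eq using M W G V by (intro eq_matI) auto
  moreover have "pos_semidef R" unfolding R_def by (rule pos_semidef_congruence(1)[OF M Y])
  moreover have "R = 0\<^sub>m c c \<longleftrightarrow> (\<forall>a<n. \<forall>b<c. a \<notin> f ` {..<k} \<longrightarrow> W $$ (a, b) = 0)"
  proof -
    have "R = 0\<^sub>m c c \<longleftrightarrow> Y = 0\<^sub>m n c" unfolding R_def by (rule pos_semidef_congruence(2)[OF M Y])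
    also have "\<dots> \<longleftrightarrow> W = E * V"
    proof
      assume "Y = 0\<^sub>m n c"
      have "W $$ (a, b) = (E * V) $$ (a, b)" if "a < n" "b < c" for a b
        using arg_cong[OF \<open>Y = 0\<^sub>m n c\<close>, of "\<lambda>Z. Z $$ (a, b)"] that W E V
        by (simp add: Y_def)
      then show "W = E * V" using W E V by (intro eq_matI) auto
    qed (use E V in \<open>auto simp: Y_def intro!: eq_matI\<close>)
    also have "\<dots> \<longleftrightarrow> (\<forall>a<n. \<forall>b<c. a \<notin> f ` {..<k} \<longrightarrow> W $$ (a, b) = 0)"
    proof
      assume "W = E * V"
      then show "\<forall>a<n. \<forall>b<c. a \<notin> f ` {..<k} \<longrightarrow> W $$ (a, b) = 0"
        unfolding E_def using sel_mat_mult(2)[OF V(1) f(2)] by auto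
    next
      assume supp: "\<forall>a<n. \<forall>b<c. a \<notin> f ` {..<k} \<longrightarrow> W $$ (a, b) = 0"
      \<comment> \<open>If \<open>W\<close> is supported on the range of \<open>f\<close>, its
        restriction \<open>Z\<close> solves the same system as \<open>V\<close>, and uniqueness
        identifies the two.\<close>
      define Z where "Z = mat k c (\<lambda>(a, b). W $$ (f a, b))"
      have Z: "Z \<in> carrier_mat k c" by (simp add: Z_def)
      have EZ: "E * Z = W"
      proof (rule eq_matI)
        fix a b assume "a < dim_row W" "b < dim_col W"
        then have ab: "a < n" "b < c" using W by auto
        show "(E * Z) $$ (a, b) = W $$ (a, b)"
        proof (cases "a \<in> f ` {..<k}")
          case True
          then obtain j where "j < k" "a = f j" by auto
          then show ?thesis unfolding E_def
            using sel_mat_mult(1)[OF Z f(2) ab, of j] ab by (simp add: Z_def)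
        next
          case False
          then show ?thesis unfolding E_def
            using sel_mat_mult(2)[OF Z f(2) ab] supp ab by simp
        qed
      qed (use E Z W in auto)
      have "G * Z = mat_adjoint E * (M * (E * Z))"
        unfolding EME[symmetric] using E M Z by (simp add: mult_mat_assoc_dim)
      then have "G * Z = G * V" unfolding EZ EMW .
      obtain Gi where Gi: "Gi \<in> carrier_mat k k" "Gi * G = 1\<^sub>m k"
        using det_nonzero_inverse[OF G pos_def_det_nonzero[OF G G_pos]] by metis
      have cancel: "Gi * (G * X) = X" if "X \<in> carrier_mat k c" for X
        using G Gi that mult_mat_assoc_dim[of Gi G X] by simp
      have "Z = V" using cancel[OF Z] cancel[OF V(1)] unfolding \<open>G * Z = G * V\<close> by (rule trans[OF sym])
      then show "W = E * V" using EZ by simp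
    qed
    finally show ?thesis .
  qed
  ultimately show ?thesis using R by blast
qed

section \<open>Block matrices and the Khatri--Rao embedding\<close>

lemma blk_off_Suc: "1 \<le> l \<Longrightarrow> blk_off r (Suc l) = blk_off r l + r l"
  by (simp add: blk_off_def)

lemma blk_off_Suc_eq_sum: "blk_off r (Suc k) = (\<Sum>l\<in>{1..k}. r l)"
  by (simp add: blk_off_def atLeastLessThanSuc_atLeastAtMost)

lemma blk_off_mono: "l \<le> l' \<Longrightarrow> blk_off r l \<le> blk_off r l'"
  unfolding blk_off_def by (intro sum_mono2) auto

lemma blk_idx_blk_off:
  assumes "1 \<le> l" "t < r l"
  shows "blk_idx r (blk_off r l + t) = l"
  unfolding blk_idx_def
proof (rule Least_equality)
  show "blk_off r l + t < (\<Sum>l\<in>{1..l}. r l)"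
    unfolding blk_off_Suc_eq_sum[symmetric] using assms by (simp add: blk_off_Suc)
  fix j assume "blk_off r l + t < (\<Sum>l\<in>{1..j}. r l)"
  then have "blk_off r l < blk_off r (Suc j)" by (simp add: blk_off_Suc_eq_sum)
  then show "l \<le> j" using blk_off_mono[of "Suc j" l r] by (meson not_less not_less_eq_eq)
qed

lemma blk_off_add_less:
  assumes "l \<in> {1..k}" "t < r l"
  shows "blk_off r l + t < (\<Sum>l\<in>{1..k}. r l)"
proof -
  have "blk_off r l + t < blk_off r (Suc l)" using assms by (simp add: blk_off_Suc)
  also have "\<dots> \<le> blk_off r (Suc k)" using assms by (intro blk_off_mono) simp
  finally show ?thesis by (simp add: blk_off_Suc_eq_sum)
qed

lemma blk_decomp:
  assumes "a < (\<Sum>l\<in>{1..k}. r l)"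
  obtains l t where "l \<in> {1..k}" "t < r l" "a = blk_off r l + t"
  using assms
proof (induction k arbitrary: thesis)
  case (Suc k)
  show ?case
  proof (cases "a < (\<Sum>l\<in>{1..k}. r l)")
    case True
    then show ?thesis using Suc.IH[of thesis] Suc.prems(1) by force
  next
    case False
    then show ?thesis using Suc.prems(2)
      by (intro Suc.prems(1)[of "Suc k" "a - (\<Sum>l\<in>{1..k}. r l)"]) (auto simp: blk_off_Suc_eq_sum)
  qed
qed simp

lemma blk_idx_eqD:
  assumes "a < (\<Sum>l\<in>{1..k}. r l)" "blk_idx r a = l"
  shows "l \<in> {1..k}" "a - blk_off r l < r l" "a = blk_off r l + (a - blk_off r l)"
proof -
  obtain l' t where "l' \<in> {1..k}" "t < r l'" "a = blk_off r l' + t"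
    using blk_decomp[OF assms(1)] by metis
  then show "l \<in> {1..k}" "a - blk_off r l < r l" "a = blk_off r l + (a - blk_off r l)"
    using assms(2) blk_idx_blk_off[of l' t r] by auto
qed

lemma dim_block_mat [simp]:
  "dim_row (block_mat r c k F) = (\<Sum>l\<in>{1..k}. r l)" "dim_col (block_mat r c k F) = (\<Sum>l\<in>{1..k}. c l)"
  by (simp_all add: block_mat_def)

lemma block_mat_carrier: "block_mat r c k F \<in> carrier_mat (\<Sum>l\<in>{1..k}. r l) (\<Sum>l\<in>{1..k}. c l)"
  by (rule carrier_matI) simp_all

lemma index_block_mat:
  assumes "l \<in> {1..k}" "t < r l" "j \<in> {1..k}" "u < c j"
  shows "block_mat r c k F $$ (blk_off r l + t, blk_off c j + u) = F l j $$ (t, u)"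
  using blk_off_add_less[of l k t r] blk_off_add_less[of j k u c] assms
  by (simp add: block_mat_def blk_idx_blk_off)

lemma pos_def_block_mat_leading:
  assumes "pos_def (block_mat r r s F)" "k \<le> s"
  shows "pos_def (block_mat r r k F)"
proof -
  have le: "(\<Sum>l\<in>{1..k}. r l) \<le> (\<Sum>l\<in>{1..s}. r l)" using assms(2) by (intro sum_mono2) auto
  have "block_mat r r k F
    = mat (\<Sum>l\<in>{1..k}. r l) (\<Sum>l\<in>{1..k}. r l) (\<lambda>(a, b). block_mat r r s F $$ (id a, id b))"
    using le by (intro eq_matI) (auto simp: block_mat_def)
  then show ?thesis
    using pos_def_submatrix[OF block_mat_carrier assms(1), of id "\<Sum>l\<in>{1..k}. r l"] le by auto
qed

lemma pos_def_block_mat_diag: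
  assumes "pos_def (block_mat r r s F)" "l \<in> {1..s}" "F l l \<in> carrier_mat (r l) (r l)"
  shows "pos_def (F l l)"
proof -
  have f: "(\<lambda>t. blk_off r l + t) ` {..<r l} \<subseteq> {..<\<Sum>l\<in>{1..s}. r l}"
    "inj_on (\<lambda>t. blk_off r l + t) {..<r l}"
    using blk_off_add_less[OF assms(2)] by (auto simp: inj_on_def image_subset_iff simp del: One_nat_def)
  have "F l l = mat (r l) (r l)
      (\<lambda>(a, b). block_mat r r s F $$ (blk_off r l + a, blk_off r l + b))"
    using assms by (intro eq_matI) (auto simp: index_block_mat)
  then show ?thesis using pos_def_submatrix[OF block_mat_carrier assms(1) f] by simp
qed

lemma pos_def_block_mat_hermitian:
  assumes "pos_def (block_mat r r s F)" "l \<in> {1..s}" "j \<in> {1..s}"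
    "F l j \<in> carrier_mat (r l) (r j)" "F j l \<in> carrier_mat (r j) (r l)"
  shows "F j l = mat_adjoint (F l j)"
proof (rule eq_matI)
  fix a b assume "a < dim_row (mat_adjoint (F l j))" "b < dim_col (mat_adjoint (F l j))"
  then have ab: "a < r j" "b < r l" using assms by auto
  have "F j l $$ (a, b) = block_mat r r s F $$ (blk_off r j + a, blk_off r l + b)"
    using assms ab by (simp add: index_block_mat)
  also have "\<dots> = mat_adjoint (block_mat r r s F) $$ (blk_off r j + a, blk_off r l + b)"
    using pos_def_dest(1)[OF assms(1) block_mat_carrier] by simp
  also have "\<dots> = cnj (block_mat r r s F $$ (blk_off r l + b, blk_off r j + a))"
    using blk_off_add_less[of j s a r] blk_off_add_less[of l s b r] assms ab by simp
  also have "\<dots> = cnj (F l j $$ (b, a))" using assms ab by (simp add: index_block_mat)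
  finally show "F j l $$ (a, b) = mat_adjoint (F l j) $$ (a, b)" using assms ab by simp
qed (use assms in auto)

section \<open>Splitting off the last block row and column\<close>

definition block_col :: "(nat \<Rightarrow> nat) \<Rightarrow> nat \<Rightarrow> (nat \<Rightarrow> nat \<Rightarrow> 'a mat) \<Rightarrow> 'a mat" where
  "block_col r k F = mat (\<Sum>l\<in>{1..k}. r l) (r (Suc k))
     (\<lambda>(a, u). F (blk_idx r a) (Suc k) $$ (a - blk_off r (blk_idx r a), u))"

lemma block_col_carrier: "block_col r k F \<in> carrier_mat (\<Sum>l\<in>{1..k}. r l) (r (Suc k))"
  by (simp add: block_col_def)

lemma index_block_col:
  assumes "l \<in> {1..k}" "t < r l" "u < r (Suc k)"
  shows "block_col r k F $$ (blk_off r l + t, u) = F l (Suc k) $$ (t, u)"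
  using blk_off_add_less[of l k t r] assms by (simp add: block_col_def blk_idx_blk_off)

text \<open>The upper rows are compared entry by entry; the lower left block then follows from
  Hermitian symmetry, which \<open>pos\<close> supplies.\<close>

lemma block_mat_Suc:
  assumes pos: "pos_def (block_mat r r (Suc k) F)"
    and F: "F (Suc k) (Suc k) \<in> carrier_mat (r (Suc k)) (r (Suc k))"
  shows "block_mat r r (Suc k) F = four_block_mat (block_mat r r k F) (block_col r k F)
    (mat_adjoint (block_col r k F)) (F (Suc k) (Suc k))" (is "?L = ?R")
proof -
  let ?K = "\<Sum>l\<in>{1..k}. r l" and ?n = "r (Suc k)"
  have K: "(\<Sum>l\<in>{1..Suc k}. r l) = ?K + ?n" by simp
  have off: "blk_off r (Suc k) = ?K" by (rule blk_off_Suc_eq_sum)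
  have up: "?L $$ (a, b) = ?R $$ (a, b)" if a: "a < ?K" and b: "b < ?K + ?n" for a b
  proof -
    obtain l t where l: "l \<in> {1..k}" "t < r l" "a = blk_off r l + t" using blk_decomp[OF a] by metis
    then have l': "l \<in> {1..Suc k}" by simp
    show ?thesis
    proof (cases "b < ?K")
      case True
      then obtain j u where j: "j \<in> {1..k}" "u < r j" "b = blk_off r j + u"
        using blk_decomp[OF True] by metis
      then have j': "j \<in> {1..Suc k}" by simp
      have "?R $$ (a, b) = block_mat r r k F $$ (a, b)" using a b True F by simp
      then show ?thesis unfolding l(3) j(3)
        using index_block_mat[where r = r and c = r and F = F, OF l' l(2) j' j(2)]
          index_block_mat[where r = r and c = r and F = F, OF l(1,2) j(1,2)] by simp
    next
      case False
      define u where "u = b - ?K"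
      have u: "u < ?n" "b = blk_off r (Suc k) + u" using False b by (auto simp: u_def off)
      have "?R $$ (a, b) = block_col r k F $$ (a, u)"
        using a b False F by (simp add: u_def)
      also have "\<dots> = F l (Suc k) $$ (t, u)" unfolding l(3) using index_block_col[OF l(1,2) u(1)] .
      finally show ?thesis unfolding l(3) u(2)
        using index_block_mat[where r = r and c = r and F = F, OF l' l(2) _ u(1)] by simp
    qed
  qed
  have L_herm: "mat_adjoint ?L = ?L" by (rule pos_def_dest(1)[OF pos block_mat_carrier])
  show ?thesis
  proof (rule eq_matI)
    fix a b assume "a < dim_row ?R" "b < dim_col ?R"
    then have a: "a < ?K + ?n" and b: "b < ?K + ?n" using F by auto
    show "?L $$ (a, b) = ?R $$ (a, b)"
    proof (cases "a < ?K")
      case True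
      then show ?thesis using up b by blast
    next
      case a_ge: False
      show ?thesis
      proof (cases "b < ?K")
        case True
        have "?L $$ (a, b) = mat_adjoint ?L $$ (a, b)" by (simp add: L_herm)
        also have "\<dots> = cnj (?L $$ (b, a))" using a b by simp
        also have "\<dots> = cnj (?R $$ (b, a))" using up[OF True a] by simp
        also have "\<dots> = ?R $$ (a, b)"
          using a b a_ge True F block_col_carrier[of r k F] by simp
        finally show ?thesis .
      next
        case False
        define t u where "t = a - ?K" and "u = b - ?K"
        have tu: "t < ?n" "u < ?n" "a = blk_off r (Suc k) + t" "b = blk_off r (Suc k) + u"
          using a_ge False a b by (auto simp: t_def u_def off)
        have "?R $$ (a, b) = F (Suc k) (Suc k) $$ (t, u)"
          using a b a_ge False F by (simp add: t_def u_def)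
        then show ?thesis unfolding tu(3,4)
          using index_block_mat[where r = r and c = r and F = F, OF _ tu(1) _ tu(2), of "Suc k"] by simp
      qed
    qed
  qed (use F in auto)
qed

text \<open>Position, in the full Kronecker product of the block matrices, of the row of the
  Khatri--Rao product with index \<open>a\<close>.\<close>

definition kr_emb :: "(nat \<Rightarrow> nat \<Rightarrow> nat) \<Rightarrow> nat \<Rightarrow> nat \<Rightarrow> nat \<Rightarrow> nat" where
  "kr_emb n m k a = (let N = \<lambda>l. \<Prod>q\<in>{1..m}. n l q; l = blk_idx N a in
     undigits (\<lambda>p. \<Sum>l\<in>{1..k}. n l p) m
       (\<lambda>p. blk_off (\<lambda>l. n l p) l + digits (n l) m (a - blk_off N l) p))"

context
  fixes n :: "nat \<Rightarrow> nat \<Rightarrow> nat" and m k :: nat and N K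
  defines "N \<equiv> \<lambda>l. \<Prod>q\<in>{1..m}. n l q" and "K \<equiv> \<lambda>p. \<Sum>l\<in>{1..k}. n l p"
begin

lemma kr_emb_eq:
  assumes "l \<in> {1..k}" "t < N l"
  shows "kr_emb n m k (blk_off N l + t)
    = undigits K m (\<lambda>p. blk_off (\<lambda>l. n l p) l + digits (n l) m t p)"
  using assms blk_idx_blk_off[of l t N]
  unfolding kr_emb_def N_def[symmetric] K_def[symmetric] Let_def by simp

lemma kr_emb_digit_less:
  assumes "l \<in> {1..k}" "t < N l" "p \<in> {1..m}"
  shows "digits (n l) m t p < n l p" "blk_off (\<lambda>l. n l p) l + digits (n l) m t p < K p"
proof -
  show "digits (n l) m t p < n l p" using digits_less[of t "n l" m p] assms by (simp add: N_def)
  then show "blk_off (\<lambda>l. n l p) l + digits (n l) m t p < K p"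
    unfolding K_def using blk_off_add_less[of l k _ "\<lambda>l. n l p"] assms by simp
qed

lemma kr_emb_less:
  assumes "l \<in> {1..k}" "t < N l"
  shows "kr_emb n m k (blk_off N l + t) < (\<Prod>p\<in>{1..m}. K p)"
  unfolding kr_emb_eq[OF assms] by (rule undigits_less) (rule kr_emb_digit_less(2)[OF assms])

lemma digits_kr_emb:
  assumes "l \<in> {1..k}" "t < N l" "p \<in> {1..m}"
  shows "digits K m (kr_emb n m k (blk_off N l + t)) p
    = blk_off (\<lambda>l. n l p) l + digits (n l) m t p"
  unfolding kr_emb_eq[OF assms(1,2)]
  by (rule digits_undigits[OF kr_emb_digit_less(2)[OF assms(1,2)] assms(3)])

lemma kr_emb_image: "kr_emb n m k ` {..<\<Sum>l\<in>{1..k}. N l} \<subseteq> {..<\<Prod>p\<in>{1..m}. K p}"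
proof (rule image_subsetI)
  fix a assume "a \<in> {..<\<Sum>l\<in>{1..k}. N l}"
  then obtain l t where "l \<in> {1..k}" "t < N l" "a = blk_off N l + t"
    using blk_decomp[of a N k] by blast
  then show "kr_emb n m k a \<in> {..<\<Prod>p\<in>{1..m}. K p}" using kr_emb_less by simp
qed

text \<open>The block number is read off from coordinate 1, present since \<open>1 \<le> m\<close>;
  once it is known, the offsets within the blocks are the mixed-radix digits of the
  position.\<close>

lemma kr_emb_inj:
  assumes "1 \<le> m"
  shows "inj_on (kr_emb n m k) {..<\<Sum>l\<in>{1..k}. N l}"
proof (rule inj_onI)
  fix a a' assume a: "a \<in> {..<\<Sum>l\<in>{1..k}. N l}" "a' \<in> {..<\<Sum>l\<in>{1..k}. N l}"
    and eq: "kr_emb n m k a = kr_emb n m k a'"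
  obtain l t where l: "l \<in> {1..k}" "t < N l" "a = blk_off N l + t"
    using blk_decomp[of a N k] a by blast
  obtain l' t' where l': "l' \<in> {1..k}" "t' < N l'" "a' = blk_off N l' + t'"
    using blk_decomp[of a' N k] a by blast
  have dig: "blk_off (\<lambda>l. n l p) l + digits (n l) m t p = blk_off (\<lambda>l. n l p) l' + digits (n l') m t' p"
    if "p \<in> {1..m}" for p
    using eq digits_kr_emb[OF l(1,2) that] digits_kr_emb[OF l'(1,2) that] l l' by simp
  have "l = blk_idx (\<lambda>l. n l 1) (blk_off (\<lambda>l. n l 1) l + digits (n l) m t 1)"
    using blk_idx_blk_off[of l _ "\<lambda>l. n l 1"] kr_emb_digit_less(1)[OF l(1,2), of 1] l assms by simp
  also have "\<dots> = l'" unfolding dig[of 1, simplified, OF assms[simplified]]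
    using blk_idx_blk_off[of l' _ "\<lambda>l. n l 1"] kr_emb_digit_less(1)[OF l'(1,2), of 1] l' assms dig[of 1]
    by simp
  finally have ll: "l = l'" .
  have "t = undigits (n l) m (digits (n l) m t)"
    using undigits_digits[of t "n l" m] l by (simp add: N_def)
  also have "\<dots> = undigits (n l) m (digits (n l) m t')"
    using dig ll by (intro undigits_cong) simp
  also have "\<dots> = t'" using undigits_digits[of t' "n l" m] l' ll by (simp add: N_def)
  finally show "a = a'" using l l' ll by simp
qed

text \<open>Membership in the image becomes a condition on coordinates, the form in which supports
  of Kronecker products can be tested. If all coordinates have the same block number, their offsets
  recombine into a single position of that diagonal block.\<close>

lemma kr_emb_range:
  assumes x: "x < (\<Prod>p\<in>{1..m}. K p)" and m: "1 \<le> m"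
  shows "x \<in> kr_emb n m k ` {..<\<Sum>l\<in>{1..k}. N l}
    \<longleftrightarrow> (\<exists>l. \<forall>p\<in>{1..m}. blk_idx (\<lambda>l. n l p) (digits K m x p) = l)"
proof
  assume "x \<in> kr_emb n m k ` {..<\<Sum>l\<in>{1..k}. N l}"
  then obtain a where a: "a < (\<Sum>l\<in>{1..k}. N l)" "x = kr_emb n m k a" by blast
  obtain l t where l: "l \<in> {1..k}" "t < N l" "a = blk_off N l + t"
    using blk_decomp[OF a(1)] by blast
  have "blk_idx (\<lambda>l. n l p) (digits K m x p) = l" if p: "p \<in> {1..m}" for p
    unfolding a(2) l(3) digits_kr_emb[OF l(1,2) p]
    using blk_idx_blk_off[of l _ "\<lambda>l. n l p"] kr_emb_digit_less(1)[OF l(1,2) p] l by simp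
  then show "\<exists>l. \<forall>p\<in>{1..m}. blk_idx (\<lambda>l. n l p) (digits K m x p) = l" by blast
next
  assume "\<exists>l. \<forall>p\<in>{1..m}. blk_idx (\<lambda>l. n l p) (digits K m x p) = l"
  then obtain l where l: "\<And>p. p \<in> {1..m} \<Longrightarrow> blk_idx (\<lambda>l. n l p) (digits K m x p) = l" by blast
  have dig: "digits K m x p < (\<Sum>l\<in>{1..k}. n l p)" if "p \<in> {1..m}" for p
    using digits_less[OF x that] by (simp add: K_def)
  define y where "y p = digits K m x p - blk_off (\<lambda>l. n l p) l" for p
  have y: "y p < n l p" "digits K m x p = blk_off (\<lambda>l. n l p) l + y p" if "p \<in> {1..m}" for p
    using blk_idx_eqD[OF dig[OF that] l[OF that]] by (simp_all add: y_def)
  have lk: "l \<in> {1..k}" using blk_idx_eqD(1)[OF dig[of 1] l[of 1]] m by simp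
  define t where "t = undigits (n l) m y"
  have t: "t < N l" unfolding t_def N_def by (rule undigits_less[OF y(1)])
  have "kr_emb n m k (blk_off N l + t) = undigits K m (digits K m x)"
    unfolding kr_emb_eq[OF lk t]
  proof (rule undigits_cong)
    fix p assume p: "p \<in> {1..m}"
    show "blk_off (\<lambda>l. n l p) l + digits (n l) m t p = digits K m x p"
      unfolding t_def y(2)[OF p] using digits_undigits[of m y "n l" p, OF y(1) p] by simp
  qed
  then have "x = kr_emb n m k (blk_off N l + t)" using undigits_digits[OF x] by simp
  then show "x \<in> kr_emb n m k ` {..<\<Sum>l\<in>{1..k}. N l}"
    using blk_off_add_less[of l k t N] lk t by blast
qed

text \<open>Both sides are products over \<open>p\<close> of the same entries of
  \<open>B p l j\<close>: the embedding shifts each digit by the offset of its block, and indexing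
  into the block matrix removes the shift.\<close>

lemma block_mat_kron_prod:
  fixes B :: "nat \<Rightarrow> nat \<Rightarrow> nat \<Rightarrow> complex mat"
  assumes B: "\<And>p l j. p \<in> {1..m} \<Longrightarrow> l \<in> {1..k} \<Longrightarrow> j \<in> {1..k} \<Longrightarrow> B p l j \<in> carrier_mat (n l p) (n j p)"
  shows "block_mat N N k (\<lambda>l j. kron_prod m (\<lambda>p. B p l j))
    = mat (\<Sum>l\<in>{1..k}. N l) (\<Sum>l\<in>{1..k}. N l) (\<lambda>(a, b).
        kron_prod m (\<lambda>p. block_mat (\<lambda>l. n l p) (\<lambda>l. n l p) k (B p)) $$ (kr_emb n m k a, kr_emb n m k b))"
    (is "?L = ?R")
proof (rule eq_matI)
  fix a b assume "a < dim_row ?R" "b < dim_col ?R"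
  then have a: "a < (\<Sum>l\<in>{1..k}. N l)" and b: "b < (\<Sum>l\<in>{1..k}. N l)" by auto
  obtain l t where l: "l \<in> {1..k}" "t < N l" "a = blk_off N l + t" using blk_decomp[OF a] by blast
  obtain j u where j: "j \<in> {1..k}" "u < N j" "b = blk_off N j + u" using blk_decomp[OF b] by blast
  have "?L $$ (a, b) = kron_prod m (\<lambda>p. B p l j) $$ (t, u)"
    unfolding l(3) j(3) by (rule index_block_mat[where r = N and c = N, OF l(1,2) j(1,2)])
  also have "\<dots> = (\<Prod>p\<in>{1..m}. B p l j $$ (digits (n l) m t p, digits (n j) m u p))"
    using B l j by (intro index_kron_prod) (auto simp: N_def)
  also have "\<dots> = (\<Prod>p\<in>{1..m}. block_mat (\<lambda>l. n l p) (\<lambda>l. n l p) k (B p) $$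
      (digits K m (kr_emb n m k a) p, digits K m (kr_emb n m k b) p))"
  proof (intro prod.cong refl)
    fix p assume p: "p \<in> {1..m}"
    show "B p l j $$ (digits (n l) m t p, digits (n j) m u p)
      = block_mat (\<lambda>l. n l p) (\<lambda>l. n l p) k (B p) $$
      (digits K m (kr_emb n m k a) p, digits K m (kr_emb n m k b) p)"
      unfolding l(3) j(3) digits_kr_emb[OF l(1,2) p] digits_kr_emb[OF j(1,2) p]
      by (rule index_block_mat[where r = "\<lambda>l. n l p" and c = "\<lambda>l. n l p", symmetric,
            OF l(1) kr_emb_digit_less(1)[OF l(1,2) p] j(1) kr_emb_digit_less(1)[OF j(1,2) p]])
  qed
  also have "\<dots> = kron_prod m (\<lambda>p. block_mat (\<lambda>l. n l p) (\<lambda>l. n l p) k (B p))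
      $$ (kr_emb n m k a, kr_emb n m k b)"
    unfolding l(3) j(3) using kr_emb_less[OF l(1,2)] kr_emb_less[OF j(1,2)]
    by (intro index_kron_prod[symmetric]) (auto simp: K_def block_mat_carrier simp del: One_nat_def)
  finally show "?L $$ (a, b) = ?R $$ (a, b)" using a b by simp
qed auto

text \<open>Selection affects rows alone: each factor carries the single column block
  \<open>Suc k\<close>, so the columns of the Kronecker product are already those of the Khatri-Rao
  product.\<close>

lemma block_col_kron_prod:
  fixes B :: "nat \<Rightarrow> nat \<Rightarrow> nat \<Rightarrow> complex mat"
  assumes B: "\<And>p l. p \<in> {1..m} \<Longrightarrow> l \<in> {1..k} \<Longrightarrow> B p l (Suc k) \<in> carrier_mat (n l p) (n (Suc k) p)"
  shows "block_col N k (\<lambda>l j. kron_prod m (\<lambda>p. B p l j))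
    = mat (\<Sum>l\<in>{1..k}. N l) (N (Suc k)) (\<lambda>(a, u).
        kron_prod m (\<lambda>p. block_col (\<lambda>l. n l p) k (B p)) $$ (kr_emb n m k a, u))"
    (is "?L = ?R")
proof (rule eq_matI)
  fix a u assume "a < dim_row ?R" "u < dim_col ?R"
  then have a: "a < (\<Sum>l\<in>{1..k}. N l)" and u: "u < N (Suc k)" by auto
  obtain l t where l: "l \<in> {1..k}" "t < N l" "a = blk_off N l + t" using blk_decomp[OF a] by blast
  have "?L $$ (a, u) = kron_prod m (\<lambda>p. B p l (Suc k)) $$ (t, u)"
    unfolding l(3) by (rule index_block_col[OF l(1,2) u])
  also have "\<dots> = (\<Prod>p\<in>{1..m}. B p l (Suc k) $$ (digits (n l) m t p, digits (n (Suc k)) m u p))"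
    using B l u by (intro index_kron_prod) (auto simp: N_def)
  also have "\<dots> = (\<Prod>p\<in>{1..m}. block_col (\<lambda>l. n l p) k (B p) $$
      (digits K m (kr_emb n m k a) p, digits (n (Suc k)) m u p))"
  proof (intro prod.cong refl)
    fix p assume p: "p \<in> {1..m}"
    have u': "digits (n (Suc k)) m u p < n (Suc k) p"
      using digits_less[of u "n (Suc k)" m p] u p by (simp add: N_def)
    show "B p l (Suc k) $$ (digits (n l) m t p, digits (n (Suc k)) m u p)
      = block_col (\<lambda>l. n l p) k (B p) $$ (digits K m (kr_emb n m k a) p, digits (n (Suc k)) m u p)"
      unfolding l(3) digits_kr_emb[OF l(1,2) p]
      by (rule index_block_col[where r = "\<lambda>l. n l p", symmetric,
            OF l(1) kr_emb_digit_less(1)[OF l(1,2) p] u'])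
  qed
  also have "\<dots> = kron_prod m (\<lambda>p. block_col (\<lambda>l. n l p) k (B p)) $$ (kr_emb n m k a, u)"
    unfolding l(3) using kr_emb_less[OF l(1,2)] u block_col_carrier[of "\<lambda>l. n l _" k]
    by (intro index_kron_prod[symmetric]) (auto simp: K_def N_def simp del: One_nat_def)
  finally show "?L $$ (a, u) = ?R $$ (a, u)" using a u by simp
qed (auto simp: block_col_def)

end

section \<open>Support of the Kronecker product of block columns\<close>

lemma block_mat_mult_supported:
  fixes F :: "nat \<Rightarrow> nat \<Rightarrow> complex mat"
  assumes F: "F l i0 \<in> carrier_mat (r l) (r i0)" and l: "l \<in> {1..k}" and i0: "i0 \<in> {1..k}"
    and w: "w \<in> carrier_mat (\<Sum>l\<in>{1..k}. r l) d"
    and supp: "\<And>a u. a < (\<Sum>l\<in>{1..k}. r l) \<Longrightarrow> u < d \<Longrightarrow> w $$ (a, u) \<noteq> 0 \<Longrightarrow> blk_idx r a = i0"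
    and t: "t < r l" and u: "u < d"
  shows "(block_mat r r k F * w) $$ (blk_off r l + t, u)
    = (F l i0 * mat (r i0) d (\<lambda>(t, u). w $$ (blk_off r i0 + t, u))) $$ (t, u)"
proof -
  let ?K = "\<Sum>l\<in>{1..k}. r l" and ?C = "block_mat r r k F"
  let ?f = "\<lambda>a. ?C $$ (blk_off r l + t, a) * w $$ (a, u)"
  have "(?C * w) $$ (blk_off r l + t, u) = (\<Sum>a\<in>{0..<?K}. ?f a)"
    using blk_off_add_less[where r = r, OF l t] w u by (simp add: scalar_prod_def)
  also have "\<dots> = (\<Sum>a\<in>(\<lambda>t. blk_off r i0 + t) ` {0..<r i0}. ?f a)"
  proof (rule sum.mono_neutral_right)
    show "(\<lambda>t. blk_off r i0 + t) ` {0..<r i0} \<subseteq> {0..<?K}"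
      using blk_off_add_less[OF i0] by (auto simp del: One_nat_def image_add_atLeastLessThan)
    show "\<forall>a\<in>{0..<?K} - (\<lambda>t. blk_off r i0 + t) ` {0..<r i0}. ?f a = 0"
    proof
      fix a assume a: "a \<in> {0..<?K} - (\<lambda>t. blk_off r i0 + t) ` {0..<r i0}"
      have "blk_idx r a \<noteq> i0"
      proof
        assume "blk_idx r a = i0"
        then have "a \<in> (\<lambda>t. blk_off r i0 + t) ` {0..<r i0}"
          using blk_idx_eqD(2,3)[of a r k i0] a
          by (intro image_eqI[of _ _ "a - blk_off r i0"]) auto
        then show False using a by blast
      qed
      then show "?f a = 0" using supp[of a u] a u by auto
    qed
  qed simp
  also have "\<dots> = (\<Sum>t'\<in>{0..<r i0}. ?f (blk_off r i0 + t'))"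
    by (subst sum.reindex) (auto simp: inj_on_def)
  also have "\<dots> = (\<Sum>t'\<in>{0..<r i0}. F l i0 $$ (t, t') * w $$ (blk_off r i0 + t', u))"
    using index_block_mat[where r = r and c = r and F = F, OF l t i0] by (intro sum.cong) auto
  also have "\<dots> = (F l i0 * mat (r i0) d (\<lambda>(t, u). w $$ (blk_off r i0 + t, u))) $$ (t, u)"
    using F t u by (simp add: scalar_prod_def)
  finally show ?thesis .
qed

text \<open>If \<open>y\<close> is the only non-zero block of \<open>v\<close>, in position
  \<open>i0\<close>, the system reads \<open>F l (Suc k) = F l i0 * y\<close>, and its row
  \<open>i0\<close> determines \<open>y\<close>. Conversely this \<open>y\<close>, padded by zeros,
  solves the system and must equal \<open>v\<close>, as the coefficient matrix is invertible. This
  is the source of condition (c).\<close>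

lemma block_supported_solution_iff:
  fixes F :: "nat \<Rightarrow> nat \<Rightarrow> complex mat"
  assumes F: "\<And>l j. l \<in> {1..Suc k} \<Longrightarrow> j \<in> {1..Suc k} \<Longrightarrow> F l j \<in> carrier_mat (r l) (r j)"
    and pos: "pos_def (block_mat r r k F)"
    and v: "v \<in> carrier_mat (\<Sum>l\<in>{1..k}. r l) (r (Suc k))" "block_mat r r k F * v = block_col r k F"
    and i0: "i0 \<in> {1..k}"
  shows "(\<forall>a<(\<Sum>l\<in>{1..k}. r l). \<forall>u<r (Suc k). v $$ (a, u) \<noteq> 0 \<longrightarrow> blk_idx r a = i0) \<longleftrightarrow>
    (\<forall>l\<in>{1..k}. F l (Suc k) = F l i0 * the (mat_inverse (F i0 i0)) * F i0 (Suc k))"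
proof -
  let ?K = "\<Sum>l\<in>{1..k}. r l" and ?C = "block_mat r r k F" and ?d = "r (Suc k)"
  have C: "?C \<in> carrier_mat ?K ?K" by (rule block_mat_carrier)
  have Fl: "F l i0 \<in> carrier_mat (r l) (r i0)" "F l (Suc k) \<in> carrier_mat (r l) ?d"
    if "l \<in> {1..k}" for l using F that i0 by auto
  have F0_pos: "pos_def (F i0 i0)" using pos_def_block_mat_diag[OF pos i0 Fl(1)[OF i0]] .
  define X where "X = the (mat_inverse (F i0 i0))"
  have X: "X \<in> carrier_mat (r i0) (r i0)" "F i0 i0 * X = 1\<^sub>m (r i0)" "X * F i0 i0 = 1\<^sub>m (r i0)"
  proof -
    have "F i0 i0 \<in> Units (ring_mat TYPE(complex) (r i0) ())"
      using det_non_zero_imp_unit[OF Fl(1)[OF i0] pos_def_det_nonzero[OF Fl(1)[OF i0] F0_pos]] .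
    \<comment> \<open>\<open>mat_inverse\<close> returns an option; invertibility of the positive
      definite block excludes \<open>None\<close>, so \<open>the\<close> yields the actual
      inverse.\<close>
    then obtain Y where "mat_inverse (F i0 i0) = Some Y"
      using mat_inverse(1)[OF Fl(1)[OF i0], of "()"] by (cases "mat_inverse (F i0 i0)") auto
    then show "X \<in> carrier_mat (r i0) (r i0)" "F i0 i0 * X = 1\<^sub>m (r i0)" "X * F i0 i0 = 1\<^sub>m (r i0)"
      using mat_inverse(2)[OF Fl(1)[OF i0]] by (auto simp: X_def)
  qed
  show ?thesis unfolding X_def[symmetric]
  proof
    assume supp: "\<forall>a<?K. \<forall>u<?d. v $$ (a, u) \<noteq> 0 \<longrightarrow> blk_idx r a = i0"
    define y where "y = mat (r i0) ?d (\<lambda>(t, u). v $$ (blk_off r i0 + t, u))"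
    have y: "y \<in> carrier_mat (r i0) ?d" by (simp add: y_def)
    have eq: "F l (Suc k) = F l i0 * y" if l: "l \<in> {1..k}" for l
    proof (rule eq_matI)
      fix t u assume "t < dim_row (F l i0 * y)" "u < dim_col (F l i0 * y)"
      then have tu: "t < r l" "u < ?d" using Fl[OF l] y by auto
      have "F l (Suc k) $$ (t, u) = (?C * v) $$ (blk_off r l + t, u)"
        unfolding v(2) by (rule index_block_col[where r = r, OF l tu, symmetric])
      also have "\<dots> = (F l i0 * y) $$ (t, u)" unfolding y_def
        by (rule block_mat_mult_supported[where r = r and F = F, OF Fl(1)[OF l] l i0 v(1) _ tu]) (use supp in blast)
      finally show "F l (Suc k) $$ (t, u) = (F l i0 * y) $$ (t, u)" .
    qed (use Fl[OF l] y in auto)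
    have "X * F i0 (Suc k) = y"
      using eq[OF i0] X y Fl(1)[OF i0] mult_mat_assoc_dim[of X "F i0 i0" y] by simp
    then have "F l i0 * X * F i0 (Suc k) = F l i0 * y" if "l \<in> {1..k}" for l
      using assoc_mult_mat[OF Fl(1)[OF that] X(1) Fl(2)[OF i0]] by simp
    then show "\<forall>l\<in>{1..k}. F l (Suc k) = F l i0 * X * F i0 (Suc k)" using eq by simp
  next
    assume eq: "\<forall>l\<in>{1..k}. F l (Suc k) = F l i0 * X * F i0 (Suc k)"
    define y where "y = X * F i0 (Suc k)"
    have y: "y \<in> carrier_mat (r i0) ?d" using X Fl(2)[OF i0] by (simp add: y_def)
    define w where "w = mat ?K ?d (\<lambda>(a, u). if blk_idx r a = i0 then y $$ (a - blk_off r i0, u) else 0)"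
    have w: "w \<in> carrier_mat ?K ?d" by (simp add: w_def)
    have wy: "mat (r i0) ?d (\<lambda>(t, u). w $$ (blk_off r i0 + t, u)) = y"
      using y blk_off_add_less[OF i0, of _ r] i0
      by (intro eq_matI) (auto simp: w_def blk_idx_blk_off simp del: One_nat_def)
    have "?C * w = block_col r k F"
    proof (rule eq_matI)
      fix a u assume "a < dim_row (block_col r k F)" "u < dim_col (block_col r k F)"
      then have a: "a < ?K" and u: "u < ?d" using block_col_carrier[of r k F] by auto
      obtain l t where l: "l \<in> {1..k}" "t < r l" "a = blk_off r l + t"
        using blk_decomp[OF a] by blast
      have "(?C * w) $$ (a, u) = (F l i0 * y) $$ (t, u)"
        unfolding l(3) wy[symmetric]
        by (rule block_mat_mult_supported[where r = r and F = F, OF Fl(1)[OF l(1)] l(1) i0 w _ l(2) u])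
          (auto simp: w_def split: if_splits)
      also have "F l i0 * y = F l (Suc k)"
        using eq l(1) Fl(1)[OF l(1)] Fl(2)[OF i0] X by (simp add: y_def mult_mat_assoc_dim)
      also have "\<dots> $$ (t, u) = block_col r k F $$ (a, u)"
        unfolding l(3) by (rule index_block_col[where r = r, OF l(1,2) u, symmetric])
      finally show "(?C * w) $$ (a, u) = block_col r k F $$ (a, u)" .
    qed (use w in \<open>auto simp: block_col_def\<close>)
    obtain Ci where Ci: "Ci \<in> carrier_mat ?K ?K" "Ci * ?C = 1\<^sub>m ?K"
      using det_nonzero_inverse[OF C pos_def_det_nonzero[OF C pos]] by metis
    have cancel: "Ci * (?C * Z) = Z" if Z: "Z \<in> carrier_mat ?K ?d" for Z
    proof -
      have "Ci * (?C * Z) = Ci * ?C * Z" using Ci(1) C Z by (intro assoc_mult_mat[symmetric])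
      then show ?thesis unfolding Ci(2) using Z by simp
    qed
    have "w = v" using cancel[OF w] cancel[OF v(1)] unfolding v(2) \<open>?C * w = block_col r k F\<close>
      by (rule trans[OF sym])
    then show "\<forall>a<?K. \<forall>u<?d. v $$ (a, u) \<noteq> 0 \<longrightarrow> blk_idx r a = i0"
      by (auto simp: w_def split: if_splits)
  qed
qed

text \<open>This is the criterion for a vanishing error \<open>R\<close>, specialized to the
  Kronecker product of the \<open>v p\<close> and the Khatri-Rao embedding.\<close>

definition kron_supported :: "(nat \<Rightarrow> nat \<Rightarrow> nat) \<Rightarrow> nat \<Rightarrow> nat \<Rightarrow> (nat \<Rightarrow> complex mat) \<Rightarrow> (nat \<Rightarrow> nat) \<Rightarrow> bool" where
  "kron_supported n m k v d \<longleftrightarrow>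
    (\<forall>x<(\<Prod>p\<in>{1..m}. \<Sum>l\<in>{1..k}. n l p). \<forall>b<(\<Prod>p\<in>{1..m}. d p).
     x \<notin> kr_emb n m k ` {..<\<Sum>l\<in>{1..k}. \<Prod>q\<in>{1..m}. n l q} \<longrightarrow> kron_prod m v $$ (x, b) = 0)"

context
  fixes n :: "nat \<Rightarrow> nat \<Rightarrow> nat" and m k :: nat and v :: "nat \<Rightarrow> complex mat" and d :: "nat \<Rightarrow> nat" and K
  defines "K \<equiv> \<lambda>p. \<Sum>l\<in>{1..k}. n l p"
  assumes v: "\<And>p. p \<in> {1..m} \<Longrightarrow> v p \<in> carrier_mat (K p) (d p)"
begin

text \<open>An entry of the Kronecker product is non-zero exactly when all its factors are, so only
  tuples of non-zero entries matter, and their rows must share a block number.\<close>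

lemma kron_supported_iff:
  assumes "1 \<le> m"
  shows "kron_supported n m k v d \<longleftrightarrow> (\<forall>x<(\<Prod>p\<in>{1..m}. K p). \<forall>b<(\<Prod>p\<in>{1..m}. d p).
    (\<forall>p\<in>{1..m}. v p $$ (digits K m x p, digits d m b p) \<noteq> 0) \<longrightarrow>
    (\<exists>l. \<forall>p\<in>{1..m}. blk_idx (\<lambda>l. n l p) (digits K m x p) = l))"
proof -
  have "kron_prod m v $$ (x, b) = 0 \<longleftrightarrow> \<not> (\<forall>p\<in>{1..m}. v p $$ (digits K m x p, digits d m b p) \<noteq> 0)"
    if "x < (\<Prod>p\<in>{1..m}. K p)" "b < (\<Prod>p\<in>{1..m}. d p)" for x b
    using index_kron_prod[OF v that] by simp
  moreover have "x \<in> kr_emb n m k ` {..<\<Sum>l\<in>{1..k}. \<Prod>q\<in>{1..m}. n l q} \<longleftrightarrow>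
      (\<exists>l. \<forall>p\<in>{1..m}. blk_idx (\<lambda>l. n l p) (digits K m x p) = l)"
    if "x < (\<Prod>p\<in>{1..m}. K p)" for x
    using kr_emb_range[of x n k m] that assms unfolding K_def by blast
  ultimately show ?thesis unfolding kron_supported_def K_def by blast
qed

lemma kron_supported_single:
  assumes "m = 1"
  shows "kron_supported n m k v d"
  using kron_supported_iff assms by simp

lemma kron_supported_zero:
  assumes "p \<in> {1..m}" "v p = 0\<^sub>m (K p) (d p)"
  shows "kron_supported n m k v d"
proof -
  have m: "1 \<le> m" using assms(1) by simp
  have "v p $$ (digits K m x p, digits d m b p) = 0"
    if "x < (\<Prod>p\<in>{1..m}. K p)" "b < (\<Prod>p\<in>{1..m}. d p)" for x b
    unfolding assms(2) using digits_less[OF that(1) assms(1)] digits_less[OF that(2) assms(1)] by simp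
  then show ?thesis unfolding kron_supported_iff[OF m] using assms(1) by blast
qed

text \<open>Non-zero rows can be chosen independently in the factors. Fix one per factor and call
  their common block \<open>i0\<close>; exchanging the row of one factor leaves another factor
  pinned to \<open>i0\<close>, so every non-zero row lies there.\<close>

lemma kron_supported_cols:
  assumes m: "2 \<le> m" and d: "\<And>p. p \<in> {1..m} \<Longrightarrow> d p = 1"
    and nz: "\<And>p. p \<in> {1..m} \<Longrightarrow> v p \<noteq> 0\<^sub>m (K p) (d p)"
  shows "kron_supported n m k v d \<longleftrightarrow> (\<exists>i0\<in>{1..k}. \<forall>p\<in>{1..m}. \<forall>a<K p. \<forall>u<d p.
    v p $$ (a, u) \<noteq> 0 \<longrightarrow> blk_idx (\<lambda>l. n l p) a = i0)"
proof -
  have m1: "1 \<le> m" using m by simp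
  have d_prod: "(\<Prod>p\<in>{1..m}. d p) = 1" using d by simp
  \<comment> \<open>Every factor has a single column, so 0 is the only column index, jointly and in
    each factor.\<close>
  have dig0: "digits d m 0 p = 0" if "p \<in> {1..m}" for p
    using digits_less[of 0 d m p] d[OF that] that unfolding d_prod by simp
  show ?thesis
  proof
    assume supp: "kron_supported n m k v d"
    have "\<exists>a. a < K p \<and> v p $$ (a, 0) \<noteq> 0" if p: "p \<in> {1..m}" for p
    proof (rule ccontr)
      assume "\<not> ?thesis"
      then have "v p = 0\<^sub>m (K p) (d p)" using v[OF p] d[OF p] by (intro eq_matI) auto
      then show False using nz[OF p] by simp
    qed
    then obtain a where a: "\<And>p. p \<in> {1..m} \<Longrightarrow> a p < K p \<and> v p $$ (a p, 0) \<noteq> 0" by metis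
    have common: "\<exists>l. \<forall>p\<in>{1..m}. blk_idx (\<lambda>l. n l p) (y p) = l"
      if y: "\<And>p. p \<in> {1..m} \<Longrightarrow> y p < K p \<and> v p $$ (y p, 0) \<noteq> 0" for y
    proof -
      have dig: "digits K m (undigits K m y) p = y p" if "p \<in> {1..m}" for p
        using y that by (intro digits_undigits) auto
      have "undigits K m y < (\<Prod>p\<in>{1..m}. K p)" using y by (intro undigits_less) blast
      moreover have "0 < (\<Prod>p\<in>{1..m}. d p)" using d_prod by simp
      moreover have "\<forall>p\<in>{1..m}. v p $$ (digits K m (undigits K m y) p, digits d m 0 p) \<noteq> 0"
        using y dig dig0 by simp
      ultimately obtain l where "\<forall>p\<in>{1..m}. blk_idx (\<lambda>l. n l p) (digits K m (undigits K m y) p) = l"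
        using supp unfolding kron_supported_iff[OF m1] by blast
      then show ?thesis using dig by (intro exI[of _ l]) simp
    qed
    obtain i0 where i0: "\<And>p. p \<in> {1..m} \<Longrightarrow> blk_idx (\<lambda>l. n l p) (a p) = i0" using common[OF a] by blast
    have "i0 \<in> {1..k}"
      using blk_idx_eqD(1)[of "a 1" "\<lambda>l. n l 1" k i0] a[of 1] i0[of 1] m by (simp add: K_def)
    moreover have "blk_idx (\<lambda>l. n l p) b = i0"
      if p: "p \<in> {1..m}" and b: "b < K p" "u < d p" "v p $$ (b, u) \<noteq> 0" for p b u
    proof -
      \<comment> \<open>Any index other than \<open>p\<close> would do; one of 1 and 2 is available
        because \<open>2 \<le> m\<close>.\<close>
      define q where "q = (if p = 1 then 2 else 1 :: nat)"
      have q: "q \<in> {1..m}" "q \<noteq> p" using m by (auto simp: q_def)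
      have "u = 0" using b d[OF p] by simp
      then have "(a(p := b)) p' < K p' \<and> v p' $$ ((a(p := b)) p', 0) \<noteq> 0" if "p' \<in> {1..m}" for p'
        using a[OF that] b by simp
      from common[OF this] obtain l where
        "\<forall>p'\<in>{1..m}. blk_idx (\<lambda>l. n l p') ((a(p := b)) p') = l" by blast
      then have "blk_idx (\<lambda>l. n l p) b = l" "blk_idx (\<lambda>l. n l q) (a q) = l"
        using p q by (metis fun_upd_same, metis fun_upd_other)
      then show ?thesis using i0[OF q(1)] by simp
    qed
    ultimately show "\<exists>i0\<in>{1..k}. \<forall>p\<in>{1..m}. \<forall>a<K p. \<forall>u<d p.
      v p $$ (a, u) \<noteq> 0 \<longrightarrow> blk_idx (\<lambda>l. n l p) a = i0" by blast
  next
    assume "\<exists>i0\<in>{1..k}. \<forall>p\<in>{1..m}. \<forall>a<K p. \<forall>u<d p.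
      v p $$ (a, u) \<noteq> 0 \<longrightarrow> blk_idx (\<lambda>l. n l p) a = i0"
    then obtain i0 where i0: "\<forall>p\<in>{1..m}. \<forall>a<K p. \<forall>u<d p.
      v p $$ (a, u) \<noteq> 0 \<longrightarrow> blk_idx (\<lambda>l. n l p) a = i0" by blast
    show "kron_supported n m k v d" unfolding kron_supported_iff[OF m1]
    proof (intro allI impI)
      fix x b assume x: "x < (\<Prod>p\<in>{1..m}. K p)" "b < (\<Prod>p\<in>{1..m}. d p)"
        and nz: "\<forall>p\<in>{1..m}. v p $$ (digits K m x p, digits d m b p) \<noteq> 0"
      have "blk_idx (\<lambda>l. n l p) (digits K m x p) = i0" if p: "p \<in> {1..m}" for p
        using i0 nz p digits_less[OF x(1) p] digits_less[OF x(2) p] by blast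
      then show "\<exists>l. \<forall>p\<in>{1..m}. blk_idx (\<lambda>l. n l p) (digits K m x p) = l" by blast
    qed
  qed
qed

end

section \<open>Assembly of the bound and of its equality cases\<close>

theorem mainTheorem2:
  fixes m s i :: nat
    and n :: "nat \<Rightarrow> nat \<Rightarrow> nat"
    and B :: "nat \<Rightarrow> nat \<Rightarrow> nat \<Rightarrow> complex mat"
  assumes "m \<ge> 1" and "s \<ge> 1"
    and "\<forall>l\<in>{1..s}. \<forall>p\<in>{1..m}. n l p \<ge> 1"
    and "\<forall>p\<in>{1..m}. \<forall>l\<in>{1..s}. \<forall>j\<in>{1..s}. B p l j \<in> carrier_mat (n l p) (n j p)"
    and "\<forall>p\<in>{1..m}. pos_def (block_mat (\<lambda>l. n l p) (\<lambda>l. n l p) s (B p))"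
    and "i \<in> {1..s}"
  defines "\<sigma> \<equiv> \<lambda>p. (\<Prod>q\<in>{1..m}. n i q) div n i p"
    and "N \<equiv> \<lambda>l. \<Prod>q\<in>{1..m}. n l q"
    and "A \<equiv> \<lambda>l j. kron_prod m (\<lambda>p. B p l j)"
  shows "det (block_mat N N i A) / det (block_mat N N (i - 1) A)
           \<ge> (\<Prod>p\<in>{1..m}. det (B p i i) ^ \<sigma> p)
              - (\<Prod>p\<in>{1..m}. det (B p i i) ^ \<sigma> p
                  - (det (block_mat (\<lambda>l. n l p) (\<lambda>l. n l p) i (B p))
                     / det (block_mat (\<lambda>l. n l p) (\<lambda>l. n l p) (i - 1) (B p))) ^ \<sigma> p)
       \<and> (det (block_mat N N i A) / det (block_mat N N (i - 1) A)
           = (\<Prod>p\<in>{1..m}. det (B p i i) ^ \<sigma> p)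
              - (\<Prod>p\<in>{1..m}. det (B p i i) ^ \<sigma> p
                  - (det (block_mat (\<lambda>l. n l p) (\<lambda>l. n l p) i (B p))
                     / det (block_mat (\<lambda>l. n l p) (\<lambda>l. n l p) (i - 1) (B p))) ^ \<sigma> p)
          \<longleftrightarrow> (m = 1 \<or> i = 1)
            \<or> (\<exists>p\<in>{1..m}. \<forall>l\<in>{1..<i}. B p l i = 0\<^sub>m (n l p) (n i p) \<and> B p i l = 0\<^sub>m (n i p) (n l p))
            \<or> ((\<forall>p\<in>{1..m}. n i p = 1) \<and>
               (\<exists>i0\<in>{1..<i}. \<forall>l\<in>{1..<i}. \<forall>p\<in>{1..m}.
                  B p l i = B p l i0 * the (mat_inverse (B p i0 i0)) * B p i0 i)))"
proof -
  let ?I = "{1..m}"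
  note m = assms(1) and n = assms(3) and Bc = assms(4) and pos_s = assms(5)
  \<comment> \<open>\<open>k\<close> counts the blocks before block \<open>i\<close>. For
    \<open>i = 1\<close> the matrix \<open>C p\<close> is empty and \<open>v p\<close> has no rows,
    so \<open>v p\<close> counts as zero and the general argument covers this case.\<close>
  obtain k where i: "i = Suc k" and ks: "Suc k \<le> s" using assms(6) by (cases i) auto
  define K where "K = (\<lambda>p. \<Sum>l\<in>{1..k}. n l p)"
  define d where "d = n (Suc k)"
  define C where "C = (\<lambda>p. block_mat (\<lambda>l. n l p) (\<lambda>l. n l p) k (B p))"
  define L where "L = (\<lambda>p. block_mat (\<lambda>l. n l p) (\<lambda>l. n l p) (Suc k) (B p))"
  define D where "D = (\<lambda>p. B p (Suc k) (Suc k))"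
  define b where "b = (\<lambda>p. block_col (\<lambda>l. n l p) k (B p))"
  have B: "B p l j \<in> carrier_mat (n l p) (n j p)"
    if "p \<in> ?I" "l \<in> {1..Suc k}" "j \<in> {1..Suc k}" for p l j
    using Bc that ks by auto
  have C: "C p \<in> carrier_mat (K p) (K p)" for p unfolding C_def K_def by (rule block_mat_carrier)
  have b: "b p \<in> carrier_mat (K p) (d p)" for p
    unfolding b_def K_def d_def by (rule block_col_carrier)
  have D: "D p \<in> carrier_mat (d p) (d p)" if "p \<in> ?I" for p
    unfolding D_def d_def using B[OF that] by simp
  have L_pos: "pos_def (L p)" if "p \<in> ?I" for p
    unfolding L_def using pos_def_block_mat_leading pos_s that ks by blast
  have L_eq: "L p = four_block_mat (C p) (b p) (mat_adjoint (b p)) (D p)" if "p \<in> ?I" for p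
    unfolding L_def C_def b_def D_def
    by (rule block_mat_Suc) (use L_pos[OF that] D[OF that] in \<open>auto simp: L_def D_def d_def\<close>)
  have C_pos: "pos_def (C p)" and D_pos: "pos_def (D p)" if "p \<in> ?I" for p
    using schur_complement(1,2)[OF C b D[OF that]] L_pos[OF that] L_eq[OF that] by simp_all
  have "\<forall>p\<in>?I. \<exists>v. v \<in> carrier_mat (K p) (d p) \<and> C p * v = b p \<and>
      pos_def (D p - mat_adjoint v * (C p * v)) \<and>
      det (L p) = det (C p) * det (D p - mat_adjoint v * (C p * v))"
  proof
    fix p assume p: "p \<in> ?I"
    show "\<exists>v. v \<in> carrier_mat (K p) (d p) \<and> C p * v = b p \<and>
      pos_def (D p - mat_adjoint v * (C p * v)) \<and>
      det (L p) = det (C p) * det (D p - mat_adjoint v * (C p * v))"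
      using schur_complement(3)[OF C b D[OF p]] L_pos[OF p] unfolding L_eq[OF p] by blast
  qed
  from bchoice[OF this] obtain v where v_all: "\<forall>p\<in>?I. v p \<in> carrier_mat (K p) (d p) \<and>
      C p * v p = b p \<and> pos_def (D p - mat_adjoint (v p) * (C p * v p)) \<and>
      det (L p) = det (C p) * det (D p - mat_adjoint (v p) * (C p * v p))" by blast
  define T where "T = (\<lambda>p. mat_adjoint (v p) * (C p * v p))"
  have v: "v p \<in> carrier_mat (K p) (d p)" "C p * v p = b p" "pos_def (D p - T p)"
    "det (L p) = det (C p) * det (D p - T p)" if "p \<in> ?I" for p
    unfolding T_def using v_all that by blast+
  have T: "T p \<in> carrier_mat (d p) (d p)" if "p \<in> ?I" for p
    unfolding T_def using v(1)[OF that] C[of p] by (auto intro: carrier_matI)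
  have T_psd: "pos_semidef (T p)" and T_zero: "T p = 0\<^sub>m (d p) (d p) \<longleftrightarrow> v p = 0\<^sub>m (K p) (d p)"
    if "p \<in> ?I" for p
    unfolding T_def using pos_semidef_congruence[OF C C_pos[OF that] v(1)[OF that]] by auto
  have d1: "1 \<le> d p" if "p \<in> ?I" for p using n that ks by (auto simp: d_def)

  define KD where "KD = kron_prod m D"
  define KT where "KT = kron_prod m T"
  define M where "M = kron_prod m C"
  define W where "W = kron_prod m v"
  define f where "f = kr_emb n m k"
  define q where "q = (\<Sum>l\<in>{1..k}. N l)"
  define Nd where "Nd = (\<Prod>p\<in>?I. d p)"
  have Nd: "N (Suc k) = Nd" by (simp add: N_def Nd_def d_def)
  have KD: "KD \<in> carrier_mat Nd Nd" unfolding KD_def Nd_def by (rule kron_prod_carrier[OF D])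
  have KT: "KT \<in> carrier_mat Nd Nd" unfolding KT_def Nd_def by (rule kron_prod_carrier[OF T])
  have M: "M \<in> carrier_mat (\<Prod>p\<in>?I. K p) (\<Prod>p\<in>?I. K p)"
    unfolding M_def by (rule kron_prod_carrier[OF C])
  have M_pos: "pos_def M" unfolding M_def by (rule pos_def_kron_prod[OF C C_pos])
  have W: "W \<in> carrier_mat (\<Prod>p\<in>?I. K p) Nd"
    unfolding W_def Nd_def by (rule kron_prod_carrier[OF v(1)])
  \<comment> \<open>Gram matrices multiply factor by factor.\<close>
  have WMW: "mat_adjoint W * (M * W) = KT"
    unfolding W_def M_def KT_def T_def by (rule kron_prod_congruence[OF C v(1)])
  have MW: "M * W = kron_prod m b"
  proof -
    have "M * W = kron_prod m (\<lambda>p. C p * v p)"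
      unfolding M_def W_def by (rule kron_prod_mult[OF C v(1)])
    also have "\<dots> = kron_prod m b" using v(2) by (intro kron_prod_cong)
    finally show ?thesis .
  qed
  have f: "f ` {..<q} \<subseteq> {..<\<Prod>p\<in>?I. K p}" "inj_on f {..<q}"
    unfolding f_def q_def N_def K_def using kr_emb_image[of n m k] kr_emb_inj[OF m, of n k] by auto

  define G where "G = block_mat N N k A"
  have G_eq: "G = mat q q (\<lambda>(x, y). M $$ (f x, f y))"
    unfolding G_def A_def N_def M_def q_def f_def C_def using B by (intro block_mat_kron_prod) auto
  have G: "G \<in> carrier_mat q q" by (simp add: G_eq)
  \<comment> \<open>This embedding runs over \<open>Suc k\<close> blocks and so uses other radices
    than \<open>f\<close>, which belongs to the leading \<open>k\<close> blocks.\<close>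
  have A_pos: "pos_def (block_mat N N (Suc k) A)"
  proof -
    have Lc: "L p \<in> carrier_mat (\<Sum>l\<in>{1..Suc k}. n l p) (\<Sum>l\<in>{1..Suc k}. n l p)" for p
      unfolding L_def by (rule block_mat_carrier)
    have "block_mat N N (Suc k) A = mat (\<Sum>l\<in>{1..Suc k}. N l) (\<Sum>l\<in>{1..Suc k}. N l)
        (\<lambda>(x, y). kron_prod m L $$ (kr_emb n m (Suc k) x, kr_emb n m (Suc k) y))"
      unfolding A_def N_def L_def using B by (intro block_mat_kron_prod) auto
    moreover have "pos_def \<dots>"
      unfolding N_def
      by (rule pos_def_submatrix[OF kron_prod_carrier[OF Lc] pos_def_kron_prod[OF Lc L_pos]
            kr_emb_image kr_emb_inj[OF m]])
    ultimately show ?thesis by simp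
  qed
  define bA where "bA = block_col N k A"
  have bA: "bA \<in> carrier_mat q Nd"
    unfolding bA_def q_def Nd[symmetric] by (rule block_col_carrier)
  have bA_eq: "bA = mat q Nd (\<lambda>(x, y). (M * W) $$ (f x, y))"
    unfolding MW bA_def A_def Nd[symmetric] q_def f_def N_def b_def
    using B by (intro block_col_kron_prod) auto
  have A_Suc: "A (Suc k) (Suc k) = KD" by (simp add: A_def KD_def D_def)
  have A_eq: "block_mat N N (Suc k) A = four_block_mat G bA (mat_adjoint bA) KD"
    unfolding G_def bA_def A_Suc[symmetric]
    by (rule block_mat_Suc[OF A_pos]) (use KD Nd A_Suc in simp)
  have G_pos: "pos_def G" using schur_complement(1)[OF G bA KD] A_pos unfolding A_eq by simp
  obtain V where V: "V \<in> carrier_mat q Nd" "G * V = bA"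
    "det (block_mat N N (Suc k) A) = det G * det (KD - mat_adjoint V * (G * V))"
    using schur_complement(3)[OF G bA KD] A_pos unfolding A_eq by blast
  \<comment> \<open>The right side of the system for \<open>V\<close> consists of selected rows of
    \<open>M * W\<close>. Hence \<open>V\<close> represents the projection of \<open>W\<close> onto
    the matrices supported on the diagonal blocks.\<close>
  have "G * V = mat q Nd (\<lambda>(x, y). (M * W) $$ (f x, y))" using V(2) bA_eq by simp
  then obtain R where R: "R \<in> carrier_mat Nd Nd" "pos_semidef R" "mat_adjoint V * (G * V) = KT - R"
    "R = 0\<^sub>m Nd Nd \<longleftrightarrow> (\<forall>x<(\<Prod>p\<in>?I. K p). \<forall>y<Nd. x \<notin> f ` {..<q} \<longrightarrow> W $$ (x, y) = 0)"
    using submatrix_projection[OF M M_pos W f V(1)] unfolding G_eq[symmetric] WMW by blast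
  have supp: "R = 0\<^sub>m Nd Nd \<longleftrightarrow> kron_supported n m k v d"
    using R(4) unfolding kron_supported_def K_def f_def q_def N_def Nd_def W_def by simp
  \<comment> \<open>Projection shrinks the Gram matrix that is subtracted from \<open>KD\<close>, so
    \<open>R\<close> enters the Schur complement with a positive sign.\<close>
  have "KD - (KT - R) = (KD - KT) + R" using KD KT R(1) by (intro eq_matI) auto
  then have ratio: "det (block_mat N N i A) / det (block_mat N N (i - 1) A) = det ((KD - KT) + R)"
    using V(3) R(3) pos_def_det_nonzero[OF G G_pos] by (simp add: i G_def)
  have \<sigma>: "\<sigma> p = (\<Prod>q\<in>?I. d q) div d p" for p by (simp add: \<sigma>_def i d_def)
  define \<beta> where "\<beta> = (\<Prod>p\<in>?I. det (D p) ^ \<sigma> p)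
      - (\<Prod>p\<in>?I. det (D p) ^ \<sigma> p - det (D p - T p) ^ \<sigma> p)"
  have rhs: "(\<Prod>p\<in>?I. det (B p i i) ^ \<sigma> p) - (\<Prod>p\<in>?I. det (B p i i) ^ \<sigma> p
      - (det (block_mat (\<lambda>l. n l p) (\<lambda>l. n l p) i (B p))
         / det (block_mat (\<lambda>l. n l p) (\<lambda>l. n l p) (i - 1) (B p))) ^ \<sigma> p) = \<beta>"
  proof -
    have "det (L p) / det (C p) = det (D p - T p)" if "p \<in> ?I" for p
      using v(4)[OF that] pos_def_det_nonzero[OF C C_pos[OF that]] by simp
    then show ?thesis unfolding \<beta>_def i diff_Suc_1 L_def[symmetric, THEN fun_cong]
        C_def[symmetric, THEN fun_cong] D_def by simp
  qed
  have diff: "pos_def (KD - KT)" "\<beta> \<le> det (KD - KT)"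
    "\<beta> = det (KD - KT) \<longleftrightarrow>
      m = 1 \<or> (\<exists>p\<in>?I. T p = 0\<^sub>m (d p) (d p)) \<or> (\<forall>p\<in>?I. d p = 1)"
    unfolding KD_def KT_def \<beta>_def \<sigma>
    by (rule det_kron_prod_diff[where D = D and T = T and d = d, OF m];
        rule d1 D D_pos T T_psd v(3); assumption)+
  have KDT: "KD - KT \<in> carrier_mat Nd Nd" by (rule minus_carrier_mat[OF KT])
  note add = pos_def_det_add[OF KDT diff(1) R(1,2)]
  have le: "\<beta> \<le> det ((KD - KT) + R)" using diff(2) add(1) by (rule order_trans)
  \<comment> \<open>The chain runs from \<open>\<beta>\<close> through \<open>det (KD - KT)\<close>;
    by antisymmetry, equality of its ends makes both links tight.\<close>
  have eq: "det ((KD - KT) + R) = \<beta> \<longleftrightarrow> kron_supported n m k v d \<and>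
      (m = 1 \<or> (\<exists>p\<in>?I. v p = 0\<^sub>m (K p) (d p)) \<or> (\<forall>p\<in>?I. d p = 1))"
  proof -
    have "det ((KD - KT) + R) = \<beta> \<longleftrightarrow> det ((KD - KT) + R) = det (KD - KT) \<and> \<beta> = det (KD - KT)"
      using diff(2) add(1) by (metis order_antisym)
    then show ?thesis unfolding add(2) diff(3) supp using T_zero by blast
  qed
  have zero: "v p = 0\<^sub>m (K p) (d p) \<longleftrightarrow>
      (\<forall>l\<in>{1..<i}. B p l i = 0\<^sub>m (n l p) (n i p) \<and> B p i l = 0\<^sub>m (n i p) (n l p))"
    if p: "p \<in> ?I" for p
  proof
    assume "v p = 0\<^sub>m (K p) (d p)"
    then have b0: "b p = 0\<^sub>m (K p) (d p)" using v(2)[OF p] C[of p] by (metis right_mult_zero_mat)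
    show "\<forall>l\<in>{1..<i}. B p l i = 0\<^sub>m (n l p) (n i p) \<and> B p i l = 0\<^sub>m (n i p) (n l p)"
    proof
      fix l assume "l \<in> {1..<i}"
      then have l: "l \<in> {1..k}" "l \<in> {1..Suc k}" "Suc k \<in> {1..Suc k}" by (auto simp: i)
      have 0: "B p l (Suc k) = 0\<^sub>m (n l p) (n (Suc k) p)"
      proof (rule eq_matI)
        fix t u assume "t < dim_row (0\<^sub>m (n l p) (n (Suc k) p) :: complex mat)"
          "u < dim_col (0\<^sub>m (n l p) (n (Suc k) p) :: complex mat)"
        then have tu: "t < n l p" "u < n (Suc k) p" by auto
        have "B p l (Suc k) $$ (t, u) = b p $$ (blk_off (\<lambda>l. n l p) l + t, u)"
          unfolding b_def by (rule index_block_col[where r = "\<lambda>l. n l p", OF l(1) tu, symmetric])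
        also have "\<dots> = 0"
          unfolding b0 using blk_off_add_less[where r = "\<lambda>l. n l p", OF l(1) tu(1)] tu(2)
          by (simp add: K_def d_def)
        finally show "B p l (Suc k) $$ (t, u) = 0\<^sub>m (n l p) (n (Suc k) p) $$ (t, u)" using tu by simp
      qed (use B[OF p l(2,3)] in auto)
      have "B p (Suc k) l = mat_adjoint (B p l (Suc k))"
        using pos_def_block_mat_hermitian[where r = "\<lambda>l. n l p" and F = "B p",
            OF L_pos[OF p, unfolded L_def] l(2,3) B[OF p l(2,3)] B[OF p l(3,2)]] .
      also have "\<dots> = 0\<^sub>m (n (Suc k) p) (n l p)" unfolding 0 by (intro eq_matI) auto
      finally show "B p l i = 0\<^sub>m (n l p) (n i p) \<and> B p i l = 0\<^sub>m (n i p) (n l p)"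
        using 0 by (simp add: i)
    qed
  next
    assume 0: "\<forall>l\<in>{1..<i}. B p l i = 0\<^sub>m (n l p) (n i p) \<and> B p i l = 0\<^sub>m (n i p) (n l p)"
    have "b p = 0\<^sub>m (K p) (d p)"
    proof (rule eq_matI)
      fix x u assume "x < dim_row (0\<^sub>m (K p) (d p) :: complex mat)"
        "u < dim_col (0\<^sub>m (K p) (d p) :: complex mat)"
      then have x: "x < (\<Sum>l\<in>{1..k}. n l p)" and u: "u < n (Suc k) p" by (auto simp: K_def d_def)
      obtain l t where l: "l \<in> {1..k}" "t < n l p" "x = blk_off (\<lambda>l. n l p) l + t"
        using blk_decomp[OF x] by blast
      have "b p $$ (x, u) = B p l (Suc k) $$ (t, u)"
        unfolding b_def l(3) by (rule index_block_col[where r = "\<lambda>l. n l p", OF l(1,2) u])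
      then show "b p $$ (x, u) = 0\<^sub>m (K p) (d p) $$ (x, u)"
        using 0 l u x by (simp add: i K_def d_def)
    qed (use b[of p] in auto)
    \<comment> \<open>The detour through \<open>T p\<close> avoids inverting \<open>C p\<close>: a
      zero Gram matrix already forces \<open>v p = 0\<close>.\<close>
    then have "T p = 0\<^sub>m (d p) (d p)"
      unfolding T_def v(2)[OF p] using right_mult_zero_mat[of "mat_adjoint (v p)" "d p" "K p"] v(1)[OF p]
      by simp
    then show "v p = 0\<^sub>m (K p) (d p)" using T_zero[OF p] by simp
  qed
  have col: "(\<forall>a<K p. \<forall>u<d p. v p $$ (a, u) \<noteq> 0 \<longrightarrow> blk_idx (\<lambda>l. n l p) a = i0) \<longleftrightarrow>
      (\<forall>l\<in>{1..<i}. B p l i = B p l i0 * the (mat_inverse (B p i0 i0)) * B p i0 i)"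
    if p: "p \<in> ?I" and i0: "i0 \<in> {1..k}" for p i0
    using block_supported_solution_iff[where r = "\<lambda>l. n l p" and F = "B p" and v = "v p",
        OF B[OF p] C_pos[OF p, unfolded C_def] _ _ i0] v(1,2)[OF p]
    unfolding K_def d_def C_def b_def i by (simp add: atLeastLessThanSuc_atLeastAtMost)
  have "kron_supported n m k v d \<and>
      (m = 1 \<or> (\<exists>p\<in>?I. v p = 0\<^sub>m (K p) (d p)) \<or> (\<forall>p\<in>?I. d p = 1)) \<longleftrightarrow>
    (m = 1 \<or> i = 1)
      \<or> (\<exists>p\<in>?I. \<forall>l\<in>{1..<i}. B p l i = 0\<^sub>m (n l p) (n i p) \<and> B p i l = 0\<^sub>m (n i p) (n l p))
      \<or> ((\<forall>p\<in>?I. n i p = 1) \<and> (\<exists>i0\<in>{1..<i}. \<forall>l\<in>{1..<i}. \<forall>p\<in>?I.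
            B p l i = B p l i0 * the (mat_inverse (B p i0 i0)) * B p i0 i))"
    (is "?lhs \<longleftrightarrow> ?rhs")
  proof -
    have vK: "v p \<in> carrier_mat (\<Sum>l\<in>{1..k}. n l p) (d p)" if "p \<in> ?I" for p
      using v(1)[OF that] by (simp add: K_def)
    show ?thesis
    proof (cases "m = 1 \<or> (\<exists>p\<in>?I. v p = 0\<^sub>m (K p) (d p))")
      case True
      \<comment> \<open>With a single factor or a zero factor the support condition is automatic, so
        (a) and (b) carry no further constraint.\<close>
      have "kron_supported n m k v d"
        using True kron_supported_single[OF vK] kron_supported_zero[OF vK] by (auto simp: K_def)
      then have ?lhs using True by blast
      moreover have ?rhs using True zero by blast
      ultimately show ?thesis by blast
    next
      case False
      then have m2: "2 \<le> m" using m by simp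
      \<comment> \<open>For \<open>i = 1\<close> condition (b) holds vacuously, so
        \<open>v 1\<close> would be zero, which is excluded in this branch.\<close>
      have "i \<noteq> 1"
      proof
        assume "i = 1"
        then have "v 1 = 0\<^sub>m (K 1) (d 1)" using zero[of 1] m by simp
        then show False using False m by auto
      qed
      \<comment> \<open>All factors share one \<open>i0\<close>; for each factor separately, support
        in block \<open>i0\<close> is the identity in (c).\<close>
      moreover have "kron_supported n m k v d \<longleftrightarrow> (\<exists>i0\<in>{1..<i}. \<forall>l\<in>{1..<i}. \<forall>p\<in>?I.
            B p l i = B p l i0 * the (mat_inverse (B p i0 i0)) * B p i0 i)"
        if d: "\<forall>p\<in>?I. d p = 1"
      proof -
        have "kron_supported n m k v d \<longleftrightarrow> (\<exists>i0\<in>{1..k}. \<forall>p\<in>?I. \<forall>a<K p. \<forall>u<d p.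
          v p $$ (a, u) \<noteq> 0 \<longrightarrow> blk_idx (\<lambda>l. n l p) a = i0)"
          unfolding K_def using d False
          by (intro kron_supported_cols[OF vK m2]) (auto simp: K_def)
        also have "\<dots> \<longleftrightarrow> (\<exists>i0\<in>{1..k}. \<forall>p\<in>?I. \<forall>l\<in>{1..<i}.
            B p l i = B p l i0 * the (mat_inverse (B p i0 i0)) * B p i0 i)"
          using col by (intro bex_cong ball_cong refl) blast
        finally show ?thesis unfolding i atLeastLessThanSuc_atLeastAtMost by blast
      qed
      moreover have "\<not> (\<exists>p\<in>?I. \<forall>l\<in>{1..<i}. B p l i = 0\<^sub>m (n l p) (n i p) \<and> B p i l = 0\<^sub>m (n i p) (n l p))"
        using False zero by blast
      moreover have "(\<forall>p\<in>?I. d p = 1) \<longleftrightarrow> (\<forall>p\<in>?I. n i p = 1)" by (simp add: d_def i)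
      ultimately show ?thesis using False by blast
    qed
  qed
  then show ?thesis unfolding ratio rhs eq using le by blast
qed

end
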